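(* Let $A$ be a finitely generated group. Then there exists a Riemann surface $\mathcal{S}$ whose automorphism group $\mathrm{Aut}\,\mathcal{S}$ is isomorphic to $A$ (as an abstract group). Moreover, if $A$ is finite, then $\mathcal{S}$ can be taken to be compact, i.e. there exists a compact Riemann surface $\mathcal{S}$ with $\mathrm{Aut}\,\mathcal{S}\cong A$.
   Context: A Riemann surface is a connected one-dimensional complex manifold. Its automorphism group $\mathrm{Aut}\,\mathcal{S}$ is the group, under composition, of all biholomorphic (conformal, orientation-preserving) bijections $\mathcal{S}\to\mathcal{S}$; for example, the automorphism group of the hyperbolic plane $\mathbb{H}$ is $PSL_2(\mathbb{R})$. *)

theory Defs
  imports "HOL-Analysis.Analysis" "HOL-Algebra.Bij" "HOL-Algebra.Generated_Groups"
begin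

definition finitely_generated_group :: "('g, 'm) monoid_scheme \<Rightarrow> bool" where
  "finitely_generated_group G \<longleftrightarrow>
     group G \<and> (\<exists>S. finite S \<and> S \<subseteq> carrier G \<and> generate G S = carrier G)"

text \<open>
  A pair \<open>(U, \<phi>)\<close> is a chart if \<open>U\<close> is an open set and \<open>\<phi>\<close> maps \<open>U\<close> homeomorphically
  onto an open subset of the complex plane; the values of \<open>\<phi>\<close> outside \<open>U\<close> are irrelevant.
\<close>

definition complex_chart :: "'a topology \<Rightarrow> 'a set \<times> ('a \<Rightarrow> complex) \<Rightarrow> bool" where
  "complex_chart X = (\<lambda>(U, \<phi>).
     openin X U \<and> open (\<phi> ` U) \<and>
     homeomorphic_map (subtopology X U) (top_of_set (\<phi> ` U)) \<phi>)"

text \<open>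
  The type \<open>'a\<close> only provides names for the points. A Riemann surface has the cardinality of
  the continuum, hence is isomorphic to one whose points are labelled by complex numbers, so
  asserting existence in \<open>complex charted_space\<close> loses no generality; the topology is a separate
  component and is unrelated to that of the complex plane.
\<close>

record 'a charted_space =
  space_of :: "'a topology"
  atlas :: "('a set \<times> ('a \<Rightarrow> complex)) set"

abbreviation points :: "('a, 'm) charted_space_scheme \<Rightarrow> 'a set" where
  "points \<S> \<equiv> topspace (space_of \<S>)"

text \<open>
  The atlas is not required to be maximal: an atlas determines the complex structure, and
  holomorphy of maps does not depend on which compatible atlas is used.
  Nonemptiness has to be demanded separately because \<^const>\<open>connected_space\<close> holds for the
  empty space. Second countability is part of the usual notion of a manifold; for connected
  complex one-dimensional manifolds it is automatic by Rado's theorem.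
\<close>

definition riemann_surface :: "('a, 'm) charted_space_scheme \<Rightarrow> bool" where
  "riemann_surface \<S> \<longleftrightarrow>
     points \<S> \<noteq> {} \<and>
     connected_space (space_of \<S>) \<and>
     Hausdorff_space (space_of \<S>) \<and>
     second_countable (space_of \<S>) \<and>
     (\<forall>c \<in> atlas \<S>. complex_chart (space_of \<S>) c) \<and>
     (\<Union>(U, \<phi>) \<in> atlas \<S>. U) = points \<S> \<and>
     (\<forall>(U, \<phi>) \<in> atlas \<S>. \<forall>(V, \<psi>) \<in> atlas \<S>.
        (\<psi> \<circ> inv_into U \<phi>) holomorphic_on \<phi> ` (U \<inter> V))"

definition holomorphic_map ::
    "('a, 'm) charted_space_scheme \<Rightarrow> ('b, 'n) charted_space_scheme \<Rightarrow> ('a \<Rightarrow> 'b) \<Rightarrow> bool" where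
  "holomorphic_map \<S> \<T> f \<longleftrightarrow>
     continuous_map (space_of \<S>) (space_of \<T>) f \<and>
     (\<forall>(U, \<phi>) \<in> atlas \<S>. \<forall>(V, \<psi>) \<in> atlas \<T>.
        (\<psi> \<circ> f \<circ> inv_into U \<phi>) holomorphic_on \<phi> ` (U \<inter> f -` V))"

text \<open>
  Elements of \<^const>\<open>Bij\<close> are extensional, so that distinct elements of the carrier are distinct
  as maps on the surface; the operation is composition.
\<close>

definition Aut :: "('a, 'm) charted_space_scheme \<Rightarrow> ('a \<Rightarrow> 'a) monoid" where
  "Aut \<S> = BijGroup (points \<S>)
     \<lparr>carrier := {f \<in> Bij (points \<S>).
        holomorphic_map \<S> \<S> f \<and> holomorphic_map \<S> \<S> (inv_into (points \<S>) f)}\<rparr>"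

definition compact_riemann_surface :: "('a, 'm) charted_space_scheme \<Rightarrow> bool" where
  "compact_riemann_surface \<S> \<longleftrightarrow> riemann_surface \<S> \<and> compact_space (space_of \<S>)"

end

theory Submission
  imports Defs "HOL-Complex_Analysis.Complex_Analysis"
begin

text \<open>
  The surface is a covering of a disc with finitely many punctures (in the finite case of the Riemann
  sphere), made from copies of the base, the sheets, slit along disjoint real segments and glued
  crosswise along each slit according to a fixed-point-free involution of the set of sheets. Near a
  slit the Joukowski map \<open>\<zeta> \<mapsto> m + l (\<zeta> + 1/\<zeta>) / 2\<close> is a chart: the unit circle is the slit, its
  exterior and its interior are the two sheets, and \<open>\<plusminus>1\<close> are branch points. The sheets are labelled
  by finitely many copies of \<open>A\<close>, and the permutations of the labels that commute with all involutions
  are the left translations, so \<open>A\<close> is the group of deck transformations.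

  Every automorphism \<open>g\<close> is a deck transformation. Let \<open>f\<close> be the projection to the base.
  The difference of two sheets of \<open>f \<circ> g\<close> that are glued along slits of one type vanishes at all
  branch points of this type. Over the punctured disc these accumulate at a puncture, near which the
  squared difference is bounded, so it is zero. Over the sphere one uses the product of the nonzero
  differences of sheets, a rational function with a bounded number of poles, and sufficiently many
  slits of each type. Hence \<open>f \<circ> g = H \<circ> f\<close> for an automorphism \<open>H\<close> of the base, and \<open>H\<close>
  preserves the set of branch points. The slits are placed so that this forces \<open>H\<close> to be the identity.
\<close>

section \<open>Surfaces glued from parametrizations\<close>

text \<open>Two bases occur because infinite and finite \<open>A\<close> call for different
  arguments. For infinite \<open>A\<close> there are infinitely many sheets, and poles cannot be
  counted; over a bounded base \<open>proj \<circ> g\<close> is bounded, and removable singularities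
  at the punctures replace the count. A compact surface has no nonconstant bounded holomorphic
  functions, but its covering has finite degree, so counting works. Finite generation enters through
  the number of slit types, four plus the number of generators: each type has its own puncture at
  which its slits accumulate. The difference of two sheets glued along a slit changes sign there,
  and other differences are permuted; squaring and taking a product are the two ways to get a
  function on the base. After the descent an automorphism is only known to map branch points to
  branch points. The branch points are therefore made asymmetric: their distances from the punctures
  decay like inverse factorials, and over the sphere all of them are rational except the cube root
  of 2. Several copies of \<open>A\<close> are used as labels since the gluings must be involutions
  without fixed points, which generators need not provide.\<close>

lemma holomorphic_on_locallyI:
  assumes "\<And>z. z \<in> S \<Longrightarrow>
    \<exists>N \<tau>. open N \<and> z \<in> N \<and> \<tau> holomorphic_on N \<and> (\<forall>w\<in>N \<inter> S. F w = \<tau> w)"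
  shows "F holomorphic_on S"
  unfolding holomorphic_on_def
proof
  fix z assume z: "z \<in> S"
  then obtain N \<tau> where N: "open N" "z \<in> N" "\<tau> holomorphic_on N" "\<forall>w\<in>N \<inter> S. F w = \<tau> w"
    using assms by blast
  obtain d where d: "d > 0" "ball z d \<subseteq> N"
    using N(1,2) by (auto simp: open_contains_ball)
  have "\<tau> field_differentiable at z within S"
    using N(1,2,3) holomorphic_on_imp_differentiable_at field_differentiable_at_within by blast
  then show "F field_differentiable at z within S"
  proof (rule field_differentiable_transform_within[OF d(1) z, rotated])
    fix w assume "w \<in> S" "dist w z < d"
    then have "w \<in> N \<inter> S" using d by (auto simp: dist_commute)
    then show "\<tau> w = F w" using N(4) by simp
  qed
qed

lemma open_vimage_Collect:
  assumes "open N" "continuous_on N \<tau>" "open M"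
  shows "open {w \<in> N. \<tau> w \<in> M}"
proof -
  have "{w \<in> N. \<tau> w \<in> M} = N \<inter> \<tau> -` M" by auto
  then show ?thesis using continuous_open_preimage[OF assms(2,1,3)] by simp
qed

text \<open>Holomorphy of a map expressed through parametrizations instead of charts, so that no
  inverse functions occur. With the identity for \<open>g\<close> it says that the pieces
  \<open>i\<close> and \<open>j\<close> are compatible near \<open>z\<close>.\<close>

definition lifts_at ::
    "('i \<Rightarrow> complex set) \<Rightarrow> ('i \<Rightarrow> complex \<Rightarrow> 'a) \<Rightarrow> ('a \<Rightarrow> 'a) \<Rightarrow> 'i \<Rightarrow> 'i \<Rightarrow> complex \<Rightarrow> bool" where
  "lifts_at D \<psi> g i j z \<longleftrightarrow>
     (\<exists>N \<tau>. open N \<and> z \<in> N \<and> N \<subseteq> D i \<and> \<tau> holomorphic_on N \<and> \<tau> ` N \<subseteq> D j \<and>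
        (\<forall>w\<in>N. g (\<psi> i w) = \<psi> j (\<tau> w)))"

lemma lifts_atI:
  assumes "open N" "z \<in> N" "N \<subseteq> D i" "\<tau> holomorphic_on N" "\<And>w. w \<in> N \<Longrightarrow> \<tau> w \<in> D j"
    "\<And>w. w \<in> N \<Longrightarrow> g (\<psi> i w) = \<psi> j (\<tau> w)"
  shows "lifts_at D \<psi> g i j z"
  using assms unfolding lifts_at_def by blast

lemma lifts_atE:
  assumes "lifts_at D \<psi> g i j z"
  obtains N \<tau> where "open N" "z \<in> N" "N \<subseteq> D i" "\<tau> holomorphic_on N" "\<And>w. w \<in> N \<Longrightarrow> \<tau> w \<in> D j"
    "\<And>w. w \<in> N \<Longrightarrow> g (\<psi> i w) = \<psi> j (\<tau> w)"
  using assms unfolding lifts_at_def by blast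

text \<open>A surface is given by injective parametrizations \<open>\<psi> i\<close> of its pieces by open sets \<open>D i\<close>;
  they are the inverses of the charts.\<close>

locale glued =
  fixes I :: "'i set" and D :: "'i \<Rightarrow> complex set" and \<psi> :: "'i \<Rightarrow> complex \<Rightarrow> 'a"
  assumes open_D: "i \<in> I \<Longrightarrow> open (D i)"
    and inj_\<psi>: "i \<in> I \<Longrightarrow> inj_on (\<psi> i) (D i)"
    and transition: "\<lbrakk>i \<in> I; j \<in> I; z \<in> D i; \<psi> i z \<in> \<psi> j ` D j\<rbrakk> \<Longrightarrow> lifts_at D \<psi> (\<lambda>p. p) i j z"
begin

definition X :: "'a set" where "X = (\<Union>i\<in>I. \<psi> i ` D i)"

definition T :: "'a topology" where
  "T = topology (\<lambda>W. W \<subseteq> X \<and> (\<forall>i\<in>I. open {z \<in> D i. \<psi> i z \<in> W}))"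

definition surf :: "'a charted_space" where
  "surf = \<lparr>space_of = T, atlas = (\<lambda>i. (\<psi> i ` D i, inv_into (D i) (\<psi> i))) ` I\<rparr>"

lemma space_surf [simp]: "space_of surf = T"
  and atlas_surf: "atlas surf = (\<lambda>i. (\<psi> i ` D i, inv_into (D i) (\<psi> i))) ` I"
  by (simp_all add: surf_def)

lemma openin_T: "openin T W \<longleftrightarrow> W \<subseteq> X \<and> (\<forall>i\<in>I. open {z \<in> D i. \<psi> i z \<in> W})"
proof -
  have "istopology (\<lambda>W. W \<subseteq> X \<and> (\<forall>i\<in>I. open {z \<in> D i. \<psi> i z \<in> W}))"
    unfolding istopology_def
  proof (intro conjI allI impI; (elim conjE)?)
    fix V W assume V: "V \<subseteq> X" "\<forall>i\<in>I. open {z \<in> D i. \<psi> i z \<in> V}"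
      and W: "W \<subseteq> X" "\<forall>i\<in>I. open {z \<in> D i. \<psi> i z \<in> W}"
    show "V \<inter> W \<subseteq> X" using V by blast
    have "{z \<in> D i. \<psi> i z \<in> V \<inter> W} = {z \<in> D i. \<psi> i z \<in> V} \<inter> {z \<in> D i. \<psi> i z \<in> W}" for i by auto
    then show "\<forall>i\<in>I. open {z \<in> D i. \<psi> i z \<in> V \<inter> W}" using V W by auto
  next
    fix \<K> assume K: "\<forall>W\<in>\<K>. W \<subseteq> X \<and> (\<forall>i\<in>I. open {z \<in> D i. \<psi> i z \<in> W})"
    show "\<Union>\<K> \<subseteq> X" using K by blast
    have "{z \<in> D i. \<psi> i z \<in> \<Union>\<K>} = (\<Union>W\<in>\<K>. {z \<in> D i. \<psi> i z \<in> W})" for i by auto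
    then show "\<forall>i\<in>I. open {z \<in> D i. \<psi> i z \<in> \<Union>\<K>}" using K by auto
  qed
  then show ?thesis by (simp add: T_def topology_inverse')
qed

lemma topspace_T [simp]: "topspace T = X"
proof (rule antisym)
  show "topspace T \<subseteq> X" using openin_T openin_topspace by blast
  have "{z \<in> D i. \<psi> i z \<in> X} = D i" if "i \<in> I" for i using that by (auto simp: X_def)
  then have "openin T X" using open_D by (simp add: openin_T)
  then show "X \<subseteq> topspace T" by (rule openin_subset)
qed

lemma \<psi>_in_X: "i \<in> I \<Longrightarrow> z \<in> D i \<Longrightarrow> \<psi> i z \<in> X"
  by (auto simp: X_def)

text \<open>Injectivity of \<open>\<psi> j\<close> forces every lift to take the prescribed
  parameter at \<open>z\<close>; this is what allows lifts to be composed.\<close>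

lemma lifts_at_value:
  assumes "lifts_at D \<psi> g i j z" "j \<in> I" "z' \<in> D j" "g (\<psi> i z) = \<psi> j z'"
  obtains N \<tau> where "open N" "z \<in> N" "N \<subseteq> D i" "\<tau> holomorphic_on N" "\<And>w. w \<in> N \<Longrightarrow> \<tau> w \<in> D j"
    "\<And>w. w \<in> N \<Longrightarrow> g (\<psi> i w) = \<psi> j (\<tau> w)" "\<tau> z = z'"
proof -
  obtain N \<tau> where *: "open N" "z \<in> N" "N \<subseteq> D i" "\<tau> holomorphic_on N" "\<And>w. w \<in> N \<Longrightarrow> \<tau> w \<in> D j"
    "\<And>w. w \<in> N \<Longrightarrow> g (\<psi> i w) = \<psi> j (\<tau> w)"
    using lifts_atE[OF assms(1)] by metis
  have "\<tau> z = z'" using *(2,5,6) assms inj_\<psi>[OF assms(2)] by (metis inj_onD)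
  then show ?thesis using that * by blast
qed

lemma lifts_at_comp:
  assumes "lifts_at D \<psi> g i j z" "j \<in> I" "z' \<in> D j" "g (\<psi> i z) = \<psi> j z'" "lifts_at D \<psi> h j k z'"
  shows "lifts_at D \<psi> (\<lambda>p. h (g p)) i k z"
proof -
  obtain N \<tau> where 1: "open N" "z \<in> N" "N \<subseteq> D i" "\<tau> holomorphic_on N" "\<And>w. w \<in> N \<Longrightarrow> \<tau> w \<in> D j"
    "\<And>w. w \<in> N \<Longrightarrow> g (\<psi> i w) = \<psi> j (\<tau> w)" "\<tau> z = z'"
    using lifts_at_value[OF assms(1-4)] by metis
  obtain M \<rho> where 2: "open M" "z' \<in> M" "M \<subseteq> D j" "\<rho> holomorphic_on M" "\<And>w. w \<in> M \<Longrightarrow> \<rho> w \<in> D k"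
    "\<And>w. w \<in> M \<Longrightarrow> h (\<psi> j w) = \<psi> k (\<rho> w)"
    using lifts_atE[OF assms(5)] by metis
  show ?thesis
  proof (rule lifts_atI)
    show "open {w \<in> N. \<tau> w \<in> M}"
      using 1 2 by (intro open_vimage_Collect holomorphic_on_imp_continuous_on) auto
    show "z \<in> {w \<in> N. \<tau> w \<in> M}" using 1 2 by auto
    show "{w \<in> N. \<tau> w \<in> M} \<subseteq> D i" using 1 by auto
    show "(\<rho> \<circ> \<tau>) holomorphic_on {w \<in> N. \<tau> w \<in> M}"
      using 1(4) 2(4) by (intro holomorphic_on_compose_gen[where t = M]) (auto elim: holomorphic_on_subset)
  qed (use 1 2 in auto)
qed

text \<open>\<open>T\<close> is the final topology of the parametrizations, so their continuity is
  built in. Their openness is the content of \<open>transition\<close>: in the parameters of another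
  piece, the image of \<open>N\<close> is locally the preimage of \<open>N\<close> under a
  holomorphic map.\<close>

lemma openin_\<psi>_image:
  assumes "i \<in> I" "open N" "N \<subseteq> D i"
  shows "openin T (\<psi> i ` N)"
  unfolding openin_T
proof (intro conjI ballI)
  show "\<psi> i ` N \<subseteq> X" using assms by (auto simp: X_def)
  fix j assume j: "j \<in> I"
  show "open {z \<in> D j. \<psi> j z \<in> \<psi> i ` N}"
  proof (subst open_subopen, safe)
    fix z w assume z: "z \<in> D j" "w \<in> N" "\<psi> j z = \<psi> i w"
    then have lift: "lifts_at D \<psi> (\<lambda>p. p) j i z" using transition[OF j assms(1)] assms by blast
    have wD: "w \<in> D i" using z(2) assms(3) by blast
    obtain M \<tau> where M: "open M" "z \<in> M" "M \<subseteq> D j" "\<tau> holomorphic_on M"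
      "\<And>w. w \<in> M \<Longrightarrow> \<psi> j w = \<psi> i (\<tau> w)" "\<tau> z = w"
      using lifts_at_value[OF lift assms(1) wD z(3)] by blast
    show "\<exists>S. open S \<and> z \<in> S \<and> S \<subseteq> {z \<in> D j. \<psi> j z \<in> \<psi> i ` N}"
    proof (intro exI conjI)
      show "open {v \<in> M. \<tau> v \<in> N}"
        using M assms by (intro open_vimage_Collect holomorphic_on_imp_continuous_on) auto
    qed (use M z in auto)
  qed
qed

lemma continuous_map_\<psi>: "i \<in> I \<Longrightarrow> continuous_map (top_of_set (D i)) T (\<psi> i)"
  unfolding continuous_map_def
  by (auto simp: openin_T \<psi>_in_X open_D openin_open_eq)

lemma inv_\<psi> [simp]: "i \<in> I \<Longrightarrow> z \<in> D i \<Longrightarrow> inv_into (D i) (\<psi> i) (\<psi> i z) = z"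
  by (simp add: inj_\<psi>)

lemma inv_chart:
  assumes "i \<in> I" "z \<in> D i"
  shows "inv_into (\<psi> i ` D i) (inv_into (D i) (\<psi> i)) z = \<psi> i z"
proof -
  have "inj_on (inv_into (D i) (\<psi> i)) (\<psi> i ` D i)" by (simp add: inj_on_inv_into)
  from inv_into_f_f[OF this, of "\<psi> i z"] show ?thesis using assms by simp
qed

lemma chart_image: "i \<in> I \<Longrightarrow> inv_into (D i) (\<psi> i) ` (\<psi> i ` D i \<inter> A) = {z \<in> D i. \<psi> i z \<in> A}"
  by (auto simp: image_iff) (metis IntI imageI inv_\<psi>)

lemma complex_chart_surf:
  assumes i: "i \<in> I"
  shows "complex_chart T (\<psi> i ` D i, inv_into (D i) (\<psi> i))"
proof -
  have im: "inv_into (D i) (\<psi> i) ` (\<psi> i ` D i) = D i"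
    using chart_image[OF i, of UNIV] by simp
  have "homeomorphic_maps (subtopology T (\<psi> i ` D i)) (top_of_set (D i)) (inv_into (D i) (\<psi> i)) (\<psi> i)"
    unfolding homeomorphic_maps_def
  proof (intro conjI)
    show "continuous_map (top_of_set (D i)) (subtopology T (\<psi> i ` D i)) (\<psi> i)"
      using continuous_map_\<psi>[OF i] by (auto simp: continuous_map_in_subtopology)
    show "continuous_map (subtopology T (\<psi> i ` D i)) (top_of_set (D i)) (inv_into (D i) (\<psi> i))"
      unfolding continuous_map_def
    proof (intro conjI allI impI)
      fix N assume "openin (top_of_set (D i)) N"
      then have N: "open N" "N \<subseteq> D i" using open_D[OF i] by (auto simp: openin_open_eq)
      have "{p \<in> topspace (subtopology T (\<psi> i ` D i)). inv_into (D i) (\<psi> i) p \<in> N} = \<psi> i ` N"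
        using N \<psi>_in_X[OF i] i by (auto simp: subset_iff)
      moreover have "openin (subtopology T (\<psi> i ` D i)) (\<psi> i ` N)"
        using openin_\<psi>_image[OF i N] N by (auto simp: openin_subtopology)
      ultimately show "openin (subtopology T (\<psi> i ` D i))
         {p \<in> topspace (subtopology T (\<psi> i ` D i)). inv_into (D i) (\<psi> i) p \<in> N}" by simp
    qed (use i in auto)
  qed (use i in auto)
  then have "homeomorphic_map (subtopology T (\<psi> i ` D i)) (top_of_set (D i)) (inv_into (D i) (\<psi> i))"
    using homeomorphic_map_maps by blast
  then show ?thesis
    unfolding complex_chart_def using i open_D openin_\<psi>_image[OF i, of "D i"] im by simp
qed

lemma second_countable_T:
  assumes "countable I"
  shows "second_countable T"
proof -
  obtain B :: "complex set set" where B: "countable B" "\<And>S. S \<in> B \<Longrightarrow> open S"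
    "\<And>S. open S \<Longrightarrow> \<exists>U. U \<subseteq> B \<and> S = \<Union>U"
    using univ_second_countable by blast
  let ?C = "(\<lambda>(i, b). \<psi> i ` (b \<inter> D i)) ` (I \<times> B)"
  show ?thesis
    unfolding second_countable_def
  proof (intro exI[of _ ?C] conjI ballI allI impI)
    show "countable ?C" using assms B(1) by auto
    show "openin T V" if "V \<in> ?C" for V
      using that B(2) open_D by (auto intro!: openin_\<psi>_image)
  next
    fix W p assume "openin T W \<and> p \<in> W"
    then have W: "openin T W" "p \<in> W" by auto
    then have "p \<in> X" using openin_T by blast
    then obtain i z where i: "i \<in> I" "z \<in> D i" "p = \<psi> i z" by (auto simp: X_def)
    have "open {z \<in> D i. \<psi> i z \<in> W}" using W openin_T i by blast
    then obtain U where "U \<subseteq> B" "{z \<in> D i. \<psi> i z \<in> W} = \<Union>U" using B(3) by blast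
    then obtain b where "b \<in> B" "z \<in> b" "b \<subseteq> {z \<in> D i. \<psi> i z \<in> W}" using i W by blast
    then show "\<exists>V\<in>?C. p \<in> V \<and> V \<subseteq> W" using i by (intro bexI[of _ "\<psi> i ` (b \<inter> D i)"]) auto
  qed
qed

lemma lifts_at_chart:
  assumes "lifts_at D \<psi> g i j z" "j \<in> I"
  shows "\<exists>N \<tau>. open N \<and> z \<in> N \<and> \<tau> holomorphic_on N \<and>
    (\<forall>w\<in>N. w \<in> D i \<and> g (\<psi> i w) \<in> \<psi> j ` D j \<and> inv_into (D j) (\<psi> j) (g (\<psi> i w)) = \<tau> w)"
proof -
  obtain N \<tau> where "open N" "z \<in> N" "N \<subseteq> D i" "\<tau> holomorphic_on N" "\<And>w. w \<in> N \<Longrightarrow> \<tau> w \<in> D j"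
    "\<And>w. w \<in> N \<Longrightarrow> g (\<psi> i w) = \<psi> j (\<tau> w)"
    using lifts_atE[OF assms(1)] by blast
  then show ?thesis using assms(2) by (intro exI[of _ N] exI[of _ \<tau>]) auto
qed

theorem riemann_surface_surf:
  assumes "X \<noteq> {}" "connected_space T" "Hausdorff_space T" "countable I"
  shows "riemann_surface surf"
proof -
  have "(inv_into (D j) (\<psi> j) \<circ> inv_into (\<psi> i ` D i) (inv_into (D i) (\<psi> i)))
      holomorphic_on inv_into (D i) (\<psi> i) ` (\<psi> i ` D i \<inter> \<psi> j ` D j)"
    if ij: "i \<in> I" "j \<in> I" for i j
  proof (rule holomorphic_on_locallyI)
    fix z assume "z \<in> inv_into (D i) (\<psi> i) ` (\<psi> i ` D i \<inter> \<psi> j ` D j)"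
    then have z: "z \<in> D i" "\<psi> i z \<in> \<psi> j ` D j" using chart_image ij by auto
    obtain N \<tau> where "open N" "z \<in> N" "\<tau> holomorphic_on N"
      "\<forall>w\<in>N. w \<in> D i \<and> \<psi> i w \<in> \<psi> j ` D j \<and> inv_into (D j) (\<psi> j) (\<psi> i w) = \<tau> w"
      using lifts_at_chart[OF transition[OF ij z] ij(2)] by blast
    then show "\<exists>N \<tau>. open N \<and> z \<in> N \<and> \<tau> holomorphic_on N \<and>
      (\<forall>w\<in>N \<inter> inv_into (D i) (\<psi> i) ` (\<psi> i ` D i \<inter> \<psi> j ` D j).
        (inv_into (D j) (\<psi> j) \<circ> inv_into (\<psi> i ` D i) (inv_into (D i) (\<psi> i))) w = \<tau> w)"
      using ij by (intro exI[of _ N] exI[of _ \<tau>]) (auto simp: inv_chart)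
  qed
  moreover have "(\<Union>(U, \<phi>) \<in> atlas surf. U) = X" by (auto simp: atlas_surf X_def)
  ultimately show ?thesis
    unfolding riemann_surface_def using assms second_countable_T complex_chart_surf
    by (auto simp: atlas_surf)
qed

text \<open>One target piece per point suffices: a lift into any other piece containing the image
  point arises by composition with a transition, which recovers the quantification over all pairs of
  charts in \<open>holomorphic_map\<close>.\<close>

lemma holomorphic_map_surfI:
  assumes g: "\<And>i z. i \<in> I \<Longrightarrow> z \<in> D i \<Longrightarrow> \<exists>j\<in>I. lifts_at D \<psi> g i j z"
  shows "holomorphic_map surf surf g"
proof -
  have "continuous_map T T g"
    unfolding continuous_map_def topspace_T
  proof (intro conjI allI impI)
    show "g \<in> X \<rightarrow> X" using g unfolding lifts_at_def X_def by fastforce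
    then have gX: "g p \<in> X" if "p \<in> X" for p using that by auto
    fix W assume W: "openin T W"
    show "openin T {p \<in> X. g p \<in> W}"
      unfolding openin_T
    proof (intro conjI ballI)
      fix i assume i: "i \<in> I"
      show "open {z \<in> D i. \<psi> i z \<in> {p \<in> X. g p \<in> W}}"
      proof (subst open_subopen, safe)
        fix z assume z: "z \<in> D i" "g (\<psi> i z) \<in> W"
        obtain j where j: "j \<in> I" "lifts_at D \<psi> g i j z" using g i z by blast
        obtain N \<tau> where N: "open N" "z \<in> N" "N \<subseteq> D i" "\<tau> holomorphic_on N" "\<And>w. w \<in> N \<Longrightarrow> \<tau> w \<in> D j"
          "\<And>w. w \<in> N \<Longrightarrow> g (\<psi> i w) = \<psi> j (\<tau> w)"
          using lifts_atE[OF j(2)] by metis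
        have "open {v \<in> D j. \<psi> j v \<in> W}" using W j openin_T by blast
        then have "open {w \<in> N. \<tau> w \<in> {v \<in> D j. \<psi> j v \<in> W}}"
          using N by (intro open_vimage_Collect holomorphic_on_imp_continuous_on) auto
        then show "\<exists>S. open S \<and> z \<in> S \<and> S \<subseteq> {z \<in> D i. \<psi> i z \<in> {p \<in> X. g p \<in> W}}"
          using N z i \<psi>_in_X by (intro exI[of _ "{w \<in> N. \<tau> w \<in> {v \<in> D j. \<psi> j v \<in> W}}"]) auto
      qed
    qed auto
  qed
  moreover have "(inv_into (D j) (\<psi> j) \<circ> g \<circ> inv_into (\<psi> i ` D i) (inv_into (D i) (\<psi> i)))
      holomorphic_on inv_into (D i) (\<psi> i) ` (\<psi> i ` D i \<inter> g -` \<psi> j ` D j)"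
    if ij: "i \<in> I" "j \<in> I" for i j
  proof (rule holomorphic_on_locallyI)
    fix z assume "z \<in> inv_into (D i) (\<psi> i) ` (\<psi> i ` D i \<inter> g -` \<psi> j ` D j)"
    then have z: "z \<in> D i" "g (\<psi> i z) \<in> \<psi> j ` D j" using chart_image ij by auto
    obtain k where k: "k \<in> I" "lifts_at D \<psi> g i k z" using g ij z by blast
    then obtain v where v: "v \<in> D k" "g (\<psi> i z) = \<psi> k v" unfolding lifts_at_def by force
    have "lifts_at D \<psi> (\<lambda>p. p) k j v" using transition k ij v z by metis
    then obtain N \<tau> where "open N" "z \<in> N" "\<tau> holomorphic_on N"
      "\<forall>w\<in>N. w \<in> D i \<and> g (\<psi> i w) \<in> \<psi> j ` D j \<and> inv_into (D j) (\<psi> j) (g (\<psi> i w)) = \<tau> w"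
      using lifts_at_chart[OF lifts_at_comp[OF k(2,1) v] ij(2)] by blast
    then show "\<exists>N \<tau>. open N \<and> z \<in> N \<and> \<tau> holomorphic_on N \<and>
      (\<forall>w\<in>N \<inter> inv_into (D i) (\<psi> i) ` (\<psi> i ` D i \<inter> g -` \<psi> j ` D j).
        (inv_into (D j) (\<psi> j) \<circ> g \<circ> inv_into (\<psi> i ` D i) (inv_into (D i) (\<psi> i))) w = \<tau> w)"
      using ij by (intro exI[of _ N] exI[of _ \<tau>]) (auto simp: inv_chart)
  qed
  ultimately show ?thesis
    unfolding holomorphic_map_def by (auto simp: atlas_surf)
qed

text \<open>Continuity of \<open>g\<close> makes the set of parameters sent into the piece
  \<open>j\<close> open; on this set the coordinate expression of \<open>g\<close> is itself the
  lift.\<close>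

lemma holomorphic_map_surfD:
  assumes g: "holomorphic_map surf surf g" and ij: "i \<in> I" "j \<in> I"
    and z: "z \<in> D i" "g (\<psi> i z) \<in> \<psi> j ` D j"
  shows "lifts_at D \<psi> g i j z"
proof -
  let ?N = "{w \<in> D i. g (\<psi> i w) \<in> \<psi> j ` D j}"
  have "continuous_map T T g" using g by (simp add: holomorphic_map_def)
  moreover have "openin T (\<psi> j ` D j)" using openin_\<psi>_image open_D ij by simp
  ultimately have "openin T {p \<in> X. g p \<in> \<psi> j ` D j}" by (auto simp: continuous_map_def)
  then have "open {w \<in> D i. \<psi> i w \<in> {p \<in> X. g p \<in> \<psi> j ` D j}}" using openin_T ij by blast
  moreover have "{w \<in> D i. \<psi> i w \<in> {p \<in> X. g p \<in> \<psi> j ` D j}} = ?N" using ij \<psi>_in_X by auto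
  ultimately have oN: "open ?N" by simp
  have "(inv_into (D j) (\<psi> j) \<circ> g \<circ> inv_into (\<psi> i ` D i) (inv_into (D i) (\<psi> i)))
      holomorphic_on inv_into (D i) (\<psi> i) ` (\<psi> i ` D i \<inter> g -` \<psi> j ` D j)"
    using g ij unfolding holomorphic_map_def by (force simp: atlas_surf)
  then have "(inv_into (D j) (\<psi> j) \<circ> g \<circ> inv_into (\<psi> i ` D i) (inv_into (D i) (\<psi> i))) holomorphic_on ?N"
    using chart_image[OF ij(1)] by simp
  moreover have "(inv_into (D j) (\<psi> j) \<circ> g \<circ> inv_into (\<psi> i ` D i) (inv_into (D i) (\<psi> i))) w
      = inv_into (D j) (\<psi> j) (g (\<psi> i w))" if "w \<in> ?N" for w
    using that ij by (simp add: inv_chart)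
  ultimately have hol: "(\<lambda>w. inv_into (D j) (\<psi> j) (g (\<psi> i w))) holomorphic_on ?N"
    by (rule holomorphic_transform)
  show ?thesis
    by (rule lifts_atI[OF oN _ _ hol]) (use z ij in \<open>auto simp: inv_into_into f_inv_into_f\<close>)
qed

end

section \<open>Coverings branched at the ends of slits\<close>

lemma norm_1_Im_0: "norm (\<zeta>::complex) = 1 \<Longrightarrow> Im \<zeta> = 0 \<Longrightarrow> \<zeta> = 1 \<or> \<zeta> = -1"
  by (auto simp: cmod_def complex_eq_iff power2_eq_1_iff)

lemma norm_1_inverse_Im: "norm (\<zeta>::complex) = 1 \<Longrightarrow> Im (1 / \<zeta>) = - Im \<zeta>"
  by (simp add: Im_divide cmod_def power2_eq_square)

definition jk :: "complex \<Rightarrow> complex \<Rightarrow> complex \<Rightarrow> complex" where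
  "jk m l \<zeta> = m + l * (\<zeta> + 1 / \<zeta>) / 2"

definition slit :: "complex \<Rightarrow> complex \<Rightarrow> complex set" where
  "slit m l = jk m l ` sphere 0 1"

lemma jk_inverse: "jk m l (1 / \<zeta>) = jk m l \<zeta>"
  by (simp add: jk_def add.commute)

lemma jk_1 [simp]: "jk m l 1 = m + l" and jk_minus_1 [simp]: "jk m l (-1) = m - l"
  by (simp_all add: jk_def)

lemma jk_eq_iff:
  assumes "l \<noteq> 0" "\<zeta> \<noteq> 0" "\<xi> \<noteq> 0"
  shows "jk m l \<zeta> = jk m l \<xi> \<longleftrightarrow> \<xi> = \<zeta> \<or> \<xi> = 1 / \<zeta>"
proof -
  have "jk m l \<zeta> = jk m l \<xi> \<longleftrightarrow> \<zeta> + 1 / \<zeta> = \<xi> + 1 / \<xi>" using assms(1) by (simp add: jk_def)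
  also have "\<zeta> + 1 / \<zeta> = \<xi> + 1 / \<xi> \<longleftrightarrow> (\<xi> - \<zeta>) * (\<xi> * \<zeta> - 1) / (\<xi> * \<zeta>) = 0"
  proof -
    have "(\<xi> + 1 / \<xi>) - (\<zeta> + 1 / \<zeta>) = (\<xi> - \<zeta>) * (\<xi> * \<zeta> - 1) / (\<xi> * \<zeta>)"
      using assms(2,3) by (simp add: field_simps)
    then show ?thesis by (metis eq_iff_diff_eq_0)
  qed
  also have "\<dots> \<longleftrightarrow> \<xi> = \<zeta> \<or> \<xi> = 1 / \<zeta>"
    using assms(2,3) by (simp add: eq_divide_eq)
  finally show ?thesis .
qed

lemma jk_surj:
  assumes "l \<noteq> 0"
  obtains \<zeta> where "\<zeta> \<noteq> 0" "jk m l \<zeta> = w"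
proof -
  define a where "a = (w - m) / l"
  \<comment> \<open>A root of \<open>\<zeta>\<^sup>2 - 2 * a * \<zeta> + 1 = 0\<close>, which is
    \<open>(\<zeta> + 1 / \<zeta>) / 2 = a\<close> with the denominator cleared.\<close>
  define \<zeta> where "\<zeta> = a + csqrt (a\<^sup>2 - 1)"
  have *: "\<zeta> * (2 * a - \<zeta>) = 1"
    using power2_csqrt[of "a\<^sup>2 - 1"] by (simp add: \<zeta>_def algebra_simps power2_eq_square)
  then have "\<zeta> \<noteq> 0" by auto
  then have "\<zeta> + 1 / \<zeta> = 2 * a" using * by (simp add: field_simps)
  moreover have "l * (2 * a) = 2 * (w - m)" using assms by (simp add: a_def)
  ultimately have "jk m l \<zeta> = w" unfolding jk_def by (simp only:) (simp add: diff_divide_distrib)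
  then show ?thesis using \<open>\<zeta> \<noteq> 0\<close> that by blast
qed

lemma jk_in_slit_iff:
  assumes "l \<noteq> 0" "\<zeta> \<noteq> 0"
  shows "jk m l \<zeta> \<in> slit m l \<longleftrightarrow> norm \<zeta> = 1"
proof
  assume "jk m l \<zeta> \<in> slit m l"
  then obtain \<xi> where \<xi>: "norm \<xi> = 1" "jk m l \<zeta> = jk m l \<xi>" by (auto simp: slit_def)
  then have "\<xi> \<noteq> 0" by auto
  then have "\<xi> = \<zeta> \<or> \<xi> = 1 / \<zeta>" using \<xi> jk_eq_iff assms by blast
  then have "\<xi> = \<zeta> \<or> \<xi> * \<zeta> = 1" using assms by auto
  then show "norm \<zeta> = 1" using \<xi> by (metis mult_1 norm_mult norm_one)
qed (auto simp: slit_def)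

lemma jk_end_iff:
  assumes "l \<noteq> 0" "\<zeta> \<noteq> 0"
  shows "jk m l \<zeta> = m + l \<longleftrightarrow> \<zeta> = 1" and "jk m l \<zeta> = m - l \<longleftrightarrow> \<zeta> = -1"
proof -
  have "1 / \<zeta> = 1 \<longleftrightarrow> \<zeta> = 1" "1 / \<zeta> = -1 \<longleftrightarrow> \<zeta> = -1"
    using assms(2) by (simp_all add: divide_eq_eq) (metis minus_minus)+
  then show "jk m l \<zeta> = m + l \<longleftrightarrow> \<zeta> = 1" and "jk m l \<zeta> = m - l \<longleftrightarrow> \<zeta> = -1"
    using jk_eq_iff[of l \<zeta> 1 m] jk_eq_iff[of l \<zeta> "-1" m] assms by auto
qed

lemma ends_in_slit: "m + l \<in> slit m l" "m - l \<in> slit m l"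
  unfolding slit_def by (rule image_eqI[of _ _ 1] image_eqI[of _ _ "-1"]; simp)+

lemma jk_has_field_derivative:
  "\<zeta> \<noteq> 0 \<Longrightarrow> (jk m l has_field_derivative l * (1 - 1 / \<zeta>\<^sup>2) / 2) (at \<zeta>)"
  unfolding jk_def by (auto intro!: derivative_eq_intros simp: power2_eq_square)

lemma holomorphic_on_jk: "0 \<notin> S \<Longrightarrow> jk m l holomorphic_on S"
  unfolding jk_def by (intro holomorphic_intros) auto

text \<open>Open mapping theorem: fibres have at most two points, so \<open>jk\<close> is not
  constant on a nonempty open set. In contrast to a local inverse this is available at the branch
  points as well.\<close>

lemma open_jk_image:
  assumes "l \<noteq> 0" "open N" "0 \<notin> N"
  shows "open (jk m l ` N)"
proof (rule open_mapping_thm2[of _ "- {0}"])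
  fix W :: "complex set" assume W: "open W" "W \<subseteq> - {0}" "W \<noteq> {}"
  then obtain \<zeta> where \<zeta>: "\<zeta> \<in> W" by blast
  have "\<not> W \<subseteq> {\<zeta>, 1 / \<zeta>}" using W finite_imp_not_open finite_subset by blast
  then obtain \<xi> where "\<xi> \<in> W" "\<xi> \<noteq> \<zeta>" "\<xi> \<noteq> 1 / \<zeta>" by blast
  then have "jk m l \<zeta> \<noteq> jk m l \<xi>" using jk_eq_iff[OF assms(1), of \<zeta> \<xi> m] W(2) \<zeta> by blast
  then show "\<not> jk m l constant_on W" using \<zeta> \<open>\<xi> \<in> W\<close> by (metis constant_on_def)
qed (use assms in \<open>auto intro!: holomorphic_on_jk\<close>)

text \<open>Among nonzero parameters the derivative \<open>l * (1 - 1 / \<zeta>\<^sup>2) / 2\<close>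
  vanishes only at \<open>1\<close> and \<open>-1\<close>, the two parameters of the ends of the
  slit.\<close>

lemma jk_local_inverse:
  assumes "l \<noteq> 0" "open N" "0 \<notin> N" "\<zeta> \<in> N" "\<zeta> \<noteq> 1" "\<zeta> \<noteq> -1"
  obtains M \<rho> where "open M" "jk m l \<zeta> \<in> M" "\<rho> holomorphic_on M" "\<And>w. w \<in> M \<Longrightarrow> \<rho> w \<in> N"
    "\<And>w. w \<in> M \<Longrightarrow> jk m l (\<rho> w) = w"
proof -
  have "\<zeta> \<noteq> 0" using assms by auto
  have "\<zeta>\<^sup>2 \<noteq> 1" using assms by (auto simp: power2_eq_1_iff)
  then have "1 - 1 / \<zeta>\<^sup>2 \<noteq> 0" using \<open>\<zeta> \<noteq> 0\<close> by (simp add: field_simps)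
  then have "l * (1 - 1 / \<zeta>\<^sup>2) / 2 \<noteq> 0" using assms(1) by (metis divide_eq_0_iff mult_eq_0_iff zero_neq_numeral)
  then have "deriv (jk m l) \<zeta> \<noteq> 0"
    using DERIV_imp_deriv[OF jk_has_field_derivative[OF \<open>\<zeta> \<noteq> 0\<close>]] by metis
  then obtain r where r: "r > 0" "ball \<zeta> r \<subseteq> N" "open (jk m l ` ball \<zeta> r)" "inj_on (jk m l) (ball \<zeta> r)"
    using has_complex_derivative_locally_invertible[OF holomorphic_on_jk[OF assms(3)] assms(4,2)] by blast
  have "jk m l holomorphic_on ball \<zeta> r" using r(2) assms(3) by (intro holomorphic_on_jk) blast
  then obtain \<rho> where \<rho>: "\<rho> holomorphic_on jk m l ` ball \<zeta> r" "\<And>z. z \<in> ball \<zeta> r \<Longrightarrow> \<rho> (jk m l z) = z"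
    using holomorphic_has_inverse[OF _ open_ball r(4)] by metis
  show ?thesis
    by (rule that[OF r(3) _ \<rho>(1)]) (use r \<rho> in auto)
qed

text \<open>The indices of the charts: slit sheets, annuli around slits, and neighbourhoods of infinity.
  In the locale below \<open>E\<close> is the set of sheets, \<open>m s \<plusminus> l s\<close> are the ends of the slit \<open>s\<close>, \<open>pt c z\<close> is the
  point over \<open>z\<close> on the sheet \<open>c\<close> (on a slit, the one on its upper side), and \<open>E_inf\<close> is the set of sheets
  that carry a point at infinity \<open>infp c\<close>.\<close>

datatype 'e idx = Sh 'e | An nat 'e | In 'e

text \<open>\<open>\<sigma>_transitive\<close> is the connectedness of the gluing pattern in the
  form of an induction rule. \<open>open_minus_slits\<close> speaks of every subfamily because
  infinitely many slits may accumulate outside \<open>Y\<close>, and both the base without slits and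
  the base with one slit restored have to be open. The alternative for \<open>E_inf\<close> treats
  the punctured disc and the sphere at once. By \<open>pt_eq_iff\<close> points on different sheets
  coincide only at ends of slits.\<close>

locale slit_cover =
  fixes E :: "'e set" and K :: "nat set" and \<sigma> :: "nat \<Rightarrow> 'e \<Rightarrow> 'e"
    and m l :: "nat \<Rightarrow> complex" and Y :: "complex set" and E_inf :: "'e set" and R0 :: real
    and pt :: "'e \<Rightarrow> complex \<Rightarrow> 'a" and infp :: "'e \<Rightarrow> 'a"
  assumes countable_E: "countable E" and E_nonempty: "E \<noteq> {}"
    and \<sigma>_in: "\<lbrakk>s \<in> K; c \<in> E\<rbrakk> \<Longrightarrow> \<sigma> s c \<in> E"
    and \<sigma>_\<sigma>: "\<lbrakk>s \<in> K; c \<in> E\<rbrakk> \<Longrightarrow> \<sigma> s (\<sigma> s c) = c"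
    and \<sigma>_neq: "\<lbrakk>s \<in> K; c \<in> E\<rbrakk> \<Longrightarrow> \<sigma> s c \<noteq> c"
    and \<sigma>_transitive: "\<lbrakk>Q c0; c0 \<in> E; \<And>s c. \<lbrakk>s \<in> K; c \<in> E; Q c\<rbrakk> \<Longrightarrow> Q (\<sigma> s c); c \<in> E\<rbrakk> \<Longrightarrow> Q c"
    and l_nonzero: "s \<in> K \<Longrightarrow> l s \<noteq> 0"
    and open_Y: "open Y"
    and slit_in_Y: "s \<in> K \<Longrightarrow> slit (m s) (l s) \<subseteq> Y"
    and disjoint_slits: "\<lbrakk>s \<in> K; t \<in> K; s \<noteq> t\<rbrakk> \<Longrightarrow> slit (m s) (l s) \<inter> slit (m t) (l t) = {}"
    and open_minus_slits: "K' \<subseteq> K \<Longrightarrow> open (Y - (\<Union>s\<in>K'. slit (m s) (l s)))"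
    and connected_Y0: "connected (Y - (\<Union>s\<in>K. slit (m s) (l s)))"
    and Y0_nonempty: "Y - (\<Union>s\<in>K. slit (m s) (l s)) \<noteq> {}"
    and R0_pos: "R0 > 0"
    and E_inf: "E_inf = {} \<or> E_inf = E"
    and closed_base: "c \<in> E_inf \<Longrightarrow> Y = UNIV"
      "c \<in> E_inf \<Longrightarrow> s \<in> K \<Longrightarrow> slit (m s) (l s) \<subseteq> cball 0 R0"
    and pt_eq_iff: "\<lbrakk>c \<in> E; d \<in> E\<rbrakk> \<Longrightarrow> pt c z = pt d w \<longleftrightarrow>
       z = w \<and> (c = d \<or> (\<exists>s\<in>K. (z = m s + l s \<or> z = m s - l s) \<and> d = \<sigma> s c))"
    and infp_eq_iff: "\<lbrakk>c \<in> E; d \<in> E\<rbrakk> \<Longrightarrow> infp c = infp d \<longleftrightarrow> c = d"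
    and infp_neq_pt: "\<lbrakk>c \<in> E; d \<in> E\<rbrakk> \<Longrightarrow> infp c \<noteq> pt d z"
begin

abbreviation J :: "nat \<Rightarrow> complex \<Rightarrow> complex" where "J s \<equiv> jk (m s) (l s)"
abbreviation L :: "nat \<Rightarrow> complex set" where "L s \<equiv> slit (m s) (l s)"

definition Y0 :: "complex set" where "Y0 = Y - (\<Union>s\<in>K. L s)"
definition Ys :: "nat \<Rightarrow> complex set" where "Ys s = Y - (\<Union>t\<in>K - {s}. L t)"
text \<open>More than a thin annulus: all parameters whose image avoids the other slits. For a slit
  \<open>s\<close> the parts outside and inside the unit circle are each a full copy of
  \<open>Y0\<close>, so one slit chart covers two complete sheets.\<close>

definition DA :: "nat \<Rightarrow> complex set" where "DA s = {\<zeta> \<in> - {0}. J s \<zeta> \<in> Ys s}"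

fun dom :: "'e idx \<Rightarrow> complex set" where
  "dom (Sh c) = Y0"
| "dom (An s c) = DA s"
| "dom (In c) = ball 0 (1 / R0)"

text \<open>The case distinction on the unit circle encodes the crosswise gluing: the upper half
  carries the sheet \<open>c\<close> and the lower half the sheet \<open>\<sigma> s c\<close>, so
  leaving \<open>c\<close> through the slit leads to \<open>\<sigma> s c\<close>. At
  \<open>1\<close> and \<open>-1\<close> both choices give the same point by
  \<open>pt_eq_iff\<close>. At infinity the coordinate is \<open>1 / z\<close>.\<close>

fun par :: "'e idx \<Rightarrow> complex \<Rightarrow> 'a" where
  "par (Sh c) z = pt c z"
| "par (An s c) \<zeta> =
     (if norm \<zeta> > 1 \<or> (norm \<zeta> = 1 \<and> Im \<zeta> \<ge> 0) then pt c (J s \<zeta>) else pt (\<sigma> s c) (J s \<zeta>))"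
| "par (In c) w = (if w = 0 then infp c else pt c (1 / w))"

definition Idx :: "'e idx set" where
  "Idx = Sh ` E \<union> {An s c | s c. s \<in> K \<and> c \<in> E} \<union> In ` E_inf"

lemma open_Y0: "open Y0" and open_Ys: "open (Ys s)"
  unfolding Y0_def Ys_def by (intro open_minus_slits; auto)+

lemma Y0_subset: "Y0 \<subseteq> Y" "Ys s \<subseteq> Y" by (auto simp: Y0_def Ys_def)

lemma open_DA: "s \<in> K \<Longrightarrow> open (DA s)"
  unfolding DA_def
  by (intro open_vimage_Collect holomorphic_on_imp_continuous_on holomorphic_on_jk open_Ys) auto

lemma zero_notin_DA: "0 \<notin> DA s" by (simp add: DA_def)

lemma ends_in_L: "m s + l s \<in> L s" "m s - l s \<in> L s" by (rule ends_in_slit)+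

lemma L_subset_Ys: "s \<in> K \<Longrightarrow> L s \<subseteq> Ys s"
  using slit_in_Y disjoint_slits by (fastforce simp: Ys_def)

lemma Ys_eq: "s \<in> K \<Longrightarrow> Ys s = Y0 \<union> L s"
  using L_subset_Ys by (auto simp: Ys_def Y0_def)

lemma DA_iff: "\<zeta> \<in> DA s \<longleftrightarrow> \<zeta> \<noteq> 0 \<and> J s \<zeta> \<in> Ys s" by (auto simp: DA_def)

lemma J_in_L_iff: "s \<in> K \<Longrightarrow> \<zeta> \<noteq> 0 \<Longrightarrow> J s \<zeta> \<in> L s \<longleftrightarrow> norm \<zeta> = 1"
  by (simp add: jk_in_slit_iff l_nonzero)

lemma DA_J: "s \<in> K \<Longrightarrow> \<zeta> \<in> DA s \<Longrightarrow> norm \<zeta> \<noteq> 1 \<Longrightarrow> J s \<zeta> \<in> Y0"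
  using Ys_eq J_in_L_iff by (auto simp: DA_iff)

lemma inverse_in_DA: "\<zeta> \<in> DA s \<Longrightarrow> 1 / \<zeta> \<in> DA s"
  by (auto simp: DA_iff jk_inverse)

lemma circle_in_DA: "s \<in> K \<Longrightarrow> norm \<zeta> = 1 \<Longrightarrow> \<zeta> \<in> DA s"
  using L_subset_Ys[of s] J_in_L_iff[of s \<zeta>] by (cases "\<zeta> = 0") (auto simp: DA_iff)

lemma pt_eq_Y0: "\<lbrakk>z \<in> Y0; c \<in> E; d \<in> E\<rbrakk> \<Longrightarrow> pt c z = pt d w \<longleftrightarrow> z = w \<and> c = d"
  using pt_eq_iff ends_in_L by (fastforce simp: Y0_def)

lemma pt_eq_Ys:
  "\<lbrakk>z \<in> Ys s; s \<in> K; c \<in> E; d \<in> E\<rbrakk> \<Longrightarrow>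
    pt c z = pt d w \<longleftrightarrow> z = w \<and> (c = d \<or> (z = m s + l s \<or> z = m s - l s) \<and> d = \<sigma> s c)"
  using pt_eq_iff ends_in_L by (fastforce simp: Ys_def)

lemma pt_end: "\<lbrakk>s \<in> K; c \<in> E; z = m s + l s \<or> z = m s - l s\<rbrakk> \<Longrightarrow> pt (\<sigma> s c) z = pt c z"
  using pt_eq_iff[of c "\<sigma> s c" z z] \<sigma>_in by metis

text \<open>Inversion exchanges the exterior and the interior of the circle as well as its upper and
  lower half, which has the same effect as exchanging \<open>c\<close> and
  \<open>\<sigma> s c\<close>.\<close>

lemma par_flip:
  assumes "s \<in> K" "c \<in> E" "\<zeta> \<noteq> 0"
  shows "par (An s c) (1 / \<zeta>) = par (An s (\<sigma> s c)) \<zeta>"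
proof -
  have eq: "J s (1 / \<zeta>) = J s \<zeta>" by (rule jk_inverse)
  consider "norm \<zeta> > 1" | "norm \<zeta> < 1" | "norm \<zeta> = 1" "Im \<zeta> > 0" | "norm \<zeta> = 1" "Im \<zeta> < 0"
    | "norm \<zeta> = 1" "Im \<zeta> = 0" by linarith
  then show ?thesis
  proof cases
    case 1
    then have "norm (1 / \<zeta>) < 1" by (simp add: norm_divide divide_less_eq)
    then show ?thesis using 1 assms \<sigma>_\<sigma> by (simp add: eq)
  next
    case 2
    then have "norm (1 / \<zeta>) > 1" using assms by (simp add: norm_divide less_divide_eq)
    then show ?thesis using 2 assms \<sigma>_\<sigma> by (simp add: eq)
  next
    case 3
    then have "norm (1 / \<zeta>) = 1" "Im (1 / \<zeta>) < 0" using norm_1_inverse_Im by (simp_all add: norm_divide)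
    then show ?thesis using 3 assms \<sigma>_\<sigma> by (simp add: eq)
  next
    case 4
    then have "norm (1 / \<zeta>) = 1" "Im (1 / \<zeta>) > 0" using norm_1_inverse_Im by (simp_all add: norm_divide)
    then show ?thesis using 4 assms \<sigma>_\<sigma> by (simp add: eq)
  next
    case 5
    then have "\<zeta> = 1 \<or> \<zeta> = -1" by (rule norm_1_Im_0)
    then show ?thesis using pt_end[OF assms(1,2), of "m s + l s"] pt_end[OF assms(1,2), of "m s - l s"] by auto
  qed
qed

lemma par_An_cases: "par (An s c) \<zeta> = pt c (J s \<zeta>) \<or> par (An s c) \<zeta> = pt (\<sigma> s c) (J s \<zeta>)"
  by simp

lemma par_An_eq_same:
  assumes "s \<in> K" "c \<in> E" "d \<in> E" "\<zeta> \<in> DA s" "par (An s c) \<zeta> = par (An s d) \<zeta>"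
  shows "c = d \<or> (d = \<sigma> s c \<and> (\<zeta> = 1 \<or> \<zeta> = -1))"
proof -
  have z: "J s \<zeta> \<in> Ys s" "\<zeta> \<noteq> 0" using assms by (auto simp: DA_iff)
  have e: "J s \<zeta> = m s + l s \<or> J s \<zeta> = m s - l s \<longleftrightarrow> \<zeta> = 1 \<or> \<zeta> = -1"
    using jk_end_iff[OF l_nonzero[OF assms(1)] z(2)] by blast
  have "pt c (J s \<zeta>) = pt d (J s \<zeta>) \<or> pt (\<sigma> s c) (J s \<zeta>) = pt (\<sigma> s d) (J s \<zeta>)"
    using assms(5) by (auto split: if_splits)
  then show ?thesis
  proof
    assume "pt c (J s \<zeta>) = pt d (J s \<zeta>)"
    then show ?thesis using pt_eq_Ys[OF z(1) assms(1-3)] e by blast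
  next
    assume "pt (\<sigma> s c) (J s \<zeta>) = pt (\<sigma> s d) (J s \<zeta>)"
    then have "\<sigma> s c = \<sigma> s d \<or> (\<zeta> = 1 \<or> \<zeta> = -1) \<and> \<sigma> s d = \<sigma> s (\<sigma> s c)"
      using pt_eq_Ys[OF z(1) assms(1) \<sigma>_in[OF assms(1,2)] \<sigma>_in[OF assms(1,3)]] e by blast
    then show ?thesis using \<sigma>_\<sigma>[OF assms(1)] assms(2,3) \<sigma>_in[OF assms(1)] by metis
  qed
qed

text \<open>Equal projections leave \<open>\<xi> = \<zeta>\<close> or
  \<open>\<xi> = 1 / \<zeta>\<close>, and \<open>par_flip\<close> reduces the second case to the
  first. The coincidences at \<open>1\<close> and \<open>-1\<close> fit the second alternative since
  these parameters are their own inverses.\<close>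

lemma par_An_eq:
  assumes "s \<in> K" "c \<in> E" "d \<in> E" "\<zeta> \<in> DA s" "\<xi> \<in> DA s" "par (An s c) \<zeta> = par (An s d) \<xi>"
  shows "(d = c \<and> \<xi> = \<zeta>) \<or> (d = \<sigma> s c \<and> \<xi> = 1 / \<zeta>)"
proof -
  have nz: "\<zeta> \<noteq> 0" "\<xi> \<noteq> 0" using assms by (auto simp: DA_iff)
  have "J s \<zeta> = J s \<xi>"
    using assms(6) par_An_cases[of s c \<zeta>] par_An_cases[of s d \<xi>] \<sigma>_in[OF assms(1)] assms(2,3)
    by (metis pt_eq_iff)
  then have "\<xi> = \<zeta> \<or> \<xi> = 1 / \<zeta>" using jk_eq_iff[OF l_nonzero[OF assms(1)] nz] by blast
  then show ?thesis
  proof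
    assume "\<xi> = \<zeta>"
    then show ?thesis using par_An_eq_same[OF assms(1-4)] assms(6) by auto
  next
    assume \<xi>: "\<xi> = 1 / \<zeta>"
    then have "par (An s c) \<zeta> = par (An s (\<sigma> s d)) \<zeta>" using assms(6) par_flip[OF assms(1,3) nz(1)] by simp
    then have "c = \<sigma> s d \<or> (\<sigma> s d = \<sigma> s c \<and> (\<zeta> = 1 \<or> \<zeta> = -1))"
      using par_An_eq_same[OF assms(1,2) \<sigma>_in[OF assms(1,3)] assms(4)] by blast
    then show ?thesis using \<sigma>_\<sigma>[OF assms(1)] assms(2,3) \<xi> by (metis div_by_1 divide_minus1 minus_minus)
  qed
qed

lemma Idx_cases:
  assumes "i \<in> Idx"
  obtains c where "i = Sh c" "c \<in> E" | s c where "i = An s c" "s \<in> K" "c \<in> E"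
    | c where "i = In c" "c \<in> E" "c \<in> E_inf"
  using assms E_inf by (auto simp: Idx_def)

lemma Idx_intros: "c \<in> E \<Longrightarrow> Sh c \<in> Idx" "s \<in> K \<Longrightarrow> c \<in> E \<Longrightarrow> An s c \<in> Idx"
  "c \<in> E_inf \<Longrightarrow> In c \<in> Idx"
  unfolding Idx_def by auto

lemma far_in_Y0: "c \<in> E_inf \<Longrightarrow> norm z > R0 \<Longrightarrow> z \<in> Y0"
proof -
  assume cb: "c \<in> E_inf" and z: "norm z > R0"
  have "z \<notin> L s" if "s \<in> K" for s using closed_base(2)[OF cb that] z by auto
  then show "z \<in> Y0" unfolding Y0_def using closed_base(1)[OF cb] by auto
qed

lemma In_in_Y0: "c \<in> E_inf \<Longrightarrow> w \<in> ball 0 (1 / R0) \<Longrightarrow> w \<noteq> 0 \<Longrightarrow> 1 / w \<in> Y0"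
  using R0_pos by (intro far_in_Y0) (auto simp: norm_divide field_simps)

lemma open_dom: "i \<in> Idx \<Longrightarrow> open (dom i)"
  by (elim Idx_cases) (auto simp: open_Y0 open_DA)

lemma inj_par: "i \<in> Idx \<Longrightarrow> inj_on (par i) (dom i)"
proof (elim Idx_cases)
  show "inj_on (par i) (dom i)" if "i = Sh c" "c \<in> E" for c
    using that by (auto simp: inj_on_def pt_eq_iff)
  show "inj_on (par i) (dom i)" if "i = An s c" "s \<in> K" "c \<in> E" for s c
    unfolding that(1) dom.simps
    using par_An_eq[OF that(2,3,3)] \<sigma>_neq[OF that(2,3)] by (intro inj_onI) metis
  show "inj_on (par i) (dom i)" if "i = In c" "c \<in> E" for c
    using that infp_neq_pt by (auto simp: inj_on_def pt_eq_iff) metis+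
qed

lemma An_norm_neq:
  assumes "s \<in> K" "c \<in> E" "d \<in> E" "\<zeta> \<in> DA s" "par (An s c) \<zeta> = pt d w" "w \<in> Y0"
  shows "J s \<zeta> = w" "norm \<zeta> \<noteq> 1" "norm \<zeta> > 1 \<Longrightarrow> d = c" "norm \<zeta> < 1 \<Longrightarrow> d = \<sigma> s c"
proof -
  show w: "J s \<zeta> = w"
    using par_An_cases[of s c \<zeta>] assms \<sigma>_in by (metis pt_eq_iff)
  then show n: "norm \<zeta> \<noteq> 1" using J_in_L_iff[OF assms(1)] assms by (auto simp: Y0_def DA_iff)
  show "d = c" if "norm \<zeta> > 1"
  proof -
    have "pt d w = pt c w" using that assms(5) w by simp
    then show ?thesis using pt_eq_Y0[OF assms(6,3,2)] by simp
  qed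
  show "d = \<sigma> s c" if "norm \<zeta> < 1"
  proof -
    have "pt d w = pt (\<sigma> s c) w" using that assms(5) w by simp
    then show ?thesis using pt_eq_Y0[OF assms(6,3) \<sigma>_in[OF assms(1,2)]] by simp
  qed
qed

lemma lift_to_sheet:
  assumes "i \<in> Idx" "z \<in> dom i" "par i z = pt d w" "w \<in> Y0" "d \<in> E"
  shows "lifts_at dom par (\<lambda>p. p) i (Sh d) z"
  using assms(1)
proof (cases rule: Idx_cases)
  case (1 c)
  have "c = d" using assms 1 pt_eq_Y0[of w d c] by simp metis
  show ?thesis
    by (rule lifts_atI[of Y0 _ _ _ "\<lambda>z. z"]) (use 1 assms \<open>c = d\<close> open_Y0 in auto)
next
  case (2 s c)
  have z: "z \<in> DA s" using assms 2 by simp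
  note * = An_norm_neq[OF 2(2,3) assms(5) z _ assms(4)]
  have eq: "par (An s c) z = pt d w" using assms 2 by simp
  consider "norm z > 1" | "norm z < 1" using *(2)[OF eq] by linarith
  then show ?thesis
  proof cases
    case a: 1
    have o: "open (DA s \<inter> {z. norm z > 1})"
      using open_DA[OF 2(2)] by (intro open_Int open_Collect_less continuous_intros)
    show ?thesis
      by (rule lifts_atI[OF o, where \<tau> = "J s"])
        (use a 2 z *[OF eq] DA_J zero_notin_DA in \<open>auto intro!: holomorphic_on_jk\<close>)
  next
    case b: 2
    have o: "open (DA s \<inter> {z. norm z < 1})"
      using open_DA[OF 2(2)] by (intro open_Int open_Collect_less continuous_intros)
    show ?thesis
      by (rule lifts_atI[OF o, where \<tau> = "J s"])
        (use b 2 z *[OF eq] DA_J zero_notin_DA in \<open>auto intro!: holomorphic_on_jk\<close>)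
  qed
next
  case (3 c)
  have z: "z \<noteq> 0" using assms 3 infp_neq_pt by auto
  then have "c = d" using assms 3 pt_eq_Y0[of w d c] by simp metis
  have o: "open (ball 0 (1 / R0) - {0::complex})" by (simp add: open_delete)
  show ?thesis
    by (rule lifts_atI[OF o, where \<tau> = "\<lambda>z. 1 / z"])
      (use z 3 assms In_in_Y0 \<open>c = d\<close> in \<open>auto intro!: holomorphic_intros\<close>)
qed

text \<open>Passing to a sheet uses the projection itself; passing back uses a local inverse of
  \<open>J s\<close> with values on one side of the unit circle, which keeps it on the sheet
  \<open>d\<close>.\<close>

lemma lift_from_sheet:
  assumes "j \<in> Idx" "z \<in> dom j" "par j z = pt d w" "w \<in> Y0" "d \<in> E"
  shows "lifts_at dom par (\<lambda>p. p) (Sh d) j w"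
  using assms(1)
proof (cases rule: Idx_cases)
  case (1 c)
  have "c = d" using assms 1 pt_eq_Y0[of w d c] by simp metis
  show ?thesis
    by (rule lifts_atI[of Y0 _ _ _ "\<lambda>z. z"]) (use 1 assms \<open>c = d\<close> open_Y0 in auto)
next
  case (2 s c)
  have z: "z \<in> DA s" "z \<noteq> 0" using assms 2 zero_notin_DA by auto
  have eq: "par (An s c) z = pt d w" using assms 2 by simp
  note * = An_norm_neq[OF 2(2,3) assms(5) z(1) eq assms(4)]
  have pm: "z \<noteq> 1" "z \<noteq> -1" using *(2) by auto
  consider "norm z > 1" | "norm z < 1" using *(2) by linarith
  then show ?thesis
  proof cases
    case a: 1
    have o: "open (DA s \<inter> {z. norm z > 1})"
      using open_DA[OF 2(2)] by (intro open_Int open_Collect_less continuous_intros)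
    obtain M \<rho> where M: "open M" "J s z \<in> M" "\<rho> holomorphic_on M"
      "\<And>w. w \<in> M \<Longrightarrow> \<rho> w \<in> DA s \<inter> {z. norm z > 1}" "\<And>w. w \<in> M \<Longrightarrow> J s (\<rho> w) = w"
      by (rule jk_local_inverse[OF l_nonzero[OF 2(2)] o _ _ pm, of "m s"])
        (use z a zero_notin_DA in auto)
    show ?thesis
      by (rule lifts_atI[of "M \<inter> Y0" _ _ _ \<rho>])
        (use M 2 assms(4) * a open_Y0 in \<open>auto elim: holomorphic_on_subset\<close>)
  next
    case b: 2
    have o: "open (DA s \<inter> {z. norm z < 1})"
      using open_DA[OF 2(2)] by (intro open_Int open_Collect_less continuous_intros)
    obtain M \<rho> where M: "open M" "J s z \<in> M" "\<rho> holomorphic_on M"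
      "\<And>w. w \<in> M \<Longrightarrow> \<rho> w \<in> DA s \<inter> {z. norm z < 1}" "\<And>w. w \<in> M \<Longrightarrow> J s (\<rho> w) = w"
      by (rule jk_local_inverse[OF l_nonzero[OF 2(2)] o _ _ pm, of "m s"])
        (use z b zero_notin_DA in auto)
    show ?thesis
    proof (rule lifts_atI)
      show "open (M \<inter> Y0)" using M open_Y0 by blast
      show "w \<in> M \<inter> Y0" using M *(1) assms(4) by blast
      show "\<rho> holomorphic_on M \<inter> Y0" using M(3) holomorphic_on_subset by blast
      fix v assume v: "v \<in> M \<inter> Y0"
      then show "\<rho> v \<in> dom j" using M(4)[of v] 2 by simp
      have "norm (\<rho> v) < 1" "J s (\<rho> v) = v" using M(4,5)[of v] v by auto
      then show "par (Sh d) v = par j (\<rho> v)" using *(4) b 2(1) by simp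
    qed simp
  qed
next
  case (3 c)
  have z: "z \<noteq> 0" using assms 3 infp_neq_pt by auto
  then have "pt d w = pt c (1 / z)" using assms(3) 3 by simp
  then have cd: "c = d" "1 / z = w" using pt_eq_Y0[OF assms(4,5) 3(2), of "1 / z"] by auto
  have "norm z < 1 / R0" using assms(2) 3 by simp
  then have "R0 < 1 / norm z" using R0_pos z by (simp add: field_simps)
  then have n: "R0 < norm w" using cd(2) by (metis norm_divide norm_one)
  have n': "norm (1 / v) < 1 / R0" if "norm v > R0" for v :: complex
    using R0_pos that by (simp add: norm_divide frac_less2)
  have nz: "v \<noteq> 0" if "norm v > R0" for v :: complex using that R0_pos by auto
  have o: "open (Y0 \<inter> {w. norm w > R0})"
    using open_Y0 by (intro open_Int open_Collect_less continuous_intros)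
  show ?thesis
    by (rule lifts_atI[OF o, where \<tau> = "\<lambda>z. 1 / z"])
      (use n 3 assms(4) cd(1) n' nz in \<open>auto intro!: holomorphic_intros\<close>)
qed

text \<open>A point over \<open>Y0\<close> allows a detour through its sheet. Otherwise the point
  lies on a slit or at infinity, and both charts are of the same kind: two charts meeting on a slit
  belong to that slit, since other slit charts avoid it, and they differ by the identity or by
  inversion.\<close>

lemma par_transition:
  assumes ij: "i \<in> Idx" "j \<in> Idx" and z: "z \<in> dom i" "par i z \<in> par j ` dom j"
  shows "lifts_at dom par (\<lambda>p. p) i j z"
proof (cases "\<exists>d\<in>E. \<exists>w\<in>Y0. par i z = pt d w")
  case True
  then obtain d w where d: "d \<in> E" "w \<in> Y0" "par i z = pt d w" by blast
  obtain z' where z': "z' \<in> dom j" "par j z' = pt d w" using z d by force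
  obtain N \<tau> where N: "open N" "z \<in> N" "N \<subseteq> dom i" "\<tau> holomorphic_on N" "\<And>v. v \<in> N \<Longrightarrow> \<tau> v \<in> Y0"
    "\<And>v. v \<in> N \<Longrightarrow> par i v = pt d (\<tau> v)"
    using lift_to_sheet[OF ij(1) z(1) d(3,2,1)] by (elim lifts_atE) auto
  have "\<tau> z = w" using N d pt_eq_Y0[of w d d "\<tau> z"] by metis
  obtain M \<rho> where M: "open M" "w \<in> M" "M \<subseteq> Y0" "\<rho> holomorphic_on M" "\<And>v. v \<in> M \<Longrightarrow> \<rho> v \<in> dom j"
    "\<And>v. v \<in> M \<Longrightarrow> pt d v = par j (\<rho> v)"
    using lift_from_sheet[OF ij(2) z' d(2,1)] by (elim lifts_atE) auto
  show ?thesis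
  proof (rule lifts_atI)
    show "open {w \<in> N. \<tau> w \<in> M}"
      using N M by (intro open_vimage_Collect holomorphic_on_imp_continuous_on) auto
    show "(\<rho> \<circ> \<tau>) holomorphic_on {w \<in> N. \<tau> w \<in> M}"
      using N(4) M(4) by (intro holomorphic_on_compose_gen[where t = M]) (auto elim: holomorphic_on_subset)
  qed (use N M \<open>\<tau> z = w\<close> in auto)
next
  case False
  obtain z' where z': "z' \<in> dom j" "par i z = par j z'" using z by blast
  show ?thesis
    using ij(1)
  proof (cases rule: Idx_cases)
    case (1 c)
    then show ?thesis using False z by auto
  next
    case (2 s c)
    then have zs: "z \<in> DA s" using z by simp
    have "J s z \<notin> Y0"
      using False 2 \<sigma>_in[OF 2(2,3)] par_An_cases[of s c z] by metis
    then have n: "J s z \<in> L s" using zs Ys_eq[OF 2(2)] by (auto simp: DA_iff)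
    show ?thesis
      using ij(2)
    proof (cases rule: Idx_cases)
      case (1 d)
      then show ?thesis using False z' by auto
    next
      case j: (2 t d)
      then have zt: "z' \<in> DA t" using z' by simp
      have "J s z = J t z'"
        using z'(2) par_An_cases[of s c z] par_An_cases[of t d z'] \<sigma>_in 2 j
        by (metis pt_eq_iff)
      then have "J s z \<in> Ys t" using zt by (simp add: DA_iff)
      then have "t = s" using n 2(2) by (auto simp: Ys_def)
      have "(d = c \<and> z' = z) \<or> (d = \<sigma> s c \<and> z' = 1 / z)"
        using par_An_eq[OF 2(2,3) j(3) zs] zt z'(2) 2(1) j(1) \<open>t = s\<close> by simp
      then show ?thesis
      proof
        assume "d = c \<and> z' = z"
        then show ?thesis
          by (intro lifts_atI[OF open_DA[OF 2(2)] zs, where \<tau> = "\<lambda>z. z"]) (use 2 j \<open>t = s\<close> in auto)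
      next
        assume *: "d = \<sigma> s c \<and> z' = 1 / z"
        have "par (An s c) v = par (An s d) (1 / v)" if "v \<in> DA s" for v
          using par_flip[OF 2(2) j(3), of v] that \<sigma>_\<sigma>[OF 2(2,3)] * by (simp add: DA_iff)
        then show ?thesis
          by (intro lifts_atI[OF open_DA[OF 2(2)] zs, where \<tau> = "\<lambda>z. 1 / z"])
            (use 2 j \<open>t = s\<close> zero_notin_DA in \<open>auto intro!: holomorphic_intros inverse_in_DA simp del: par.simps\<close>)
      qed
    next
      case j: (3 d)
      have "z' = 0" using False z' In_in_Y0[OF j(3), of z'] j by (cases "z' = 0") auto
      then show ?thesis using z' 2 j infp_neq_pt \<sigma>_in by (metis par_An_cases par.simps(3))
    qed
  next
    case (3 c)
    have z0: "z = 0" using False z In_in_Y0[OF 3(3), of z] 3 by (cases "z = 0") auto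
    show ?thesis
      using ij(2)
    proof (cases rule: Idx_cases)
      case (1 d)
      then show ?thesis using False z' by auto
    next
      case j: (2 t d)
      then show ?thesis using z' z0 3 infp_neq_pt \<sigma>_in by (metis par_An_cases par.simps(3))
    next
      case j: (3 d)
      have "z' = 0" using False z' In_in_Y0[OF j(3), of z'] j by (cases "z' = 0") auto
      then have "c = d" using z' z0 3 j infp_eq_iff by simp
      then show ?thesis
        by (intro lifts_atI[of "dom i" _ _ _ "\<lambda>z. z"]) (use 3 j z in auto)
    qed
  qed
qed

sublocale glued Idx dom par
  by unfold_locales (auto simp: open_dom inj_par par_transition)

end

section \<open>Topology of the covering\<close>

context slit_cover
begin

lemma countable_Idx: "countable Idx"
proof -
  have "{An s c | s c. s \<in> K \<and> c \<in> E} = (\<lambda>(s, c). An s c) ` (K \<times> E)" by auto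
  then show ?thesis unfolding Idx_def using countable_E E_inf by auto
qed

lemma par_cover:
  assumes "s \<in> K" "c \<in> E" "z \<in> Ys s"
  obtains \<zeta> where "\<zeta> \<in> DA s" "J s \<zeta> = z" "par (An s c) \<zeta> = pt c z" "norm \<zeta> \<ge> 1"
proof -
  obtain \<zeta> where \<zeta>: "\<zeta> \<noteq> 0" "J s \<zeta> = z" using jk_surj[OF l_nonzero[OF assms(1)]] by metis
  show ?thesis
  proof (cases "norm \<zeta> > 1 \<or> (norm \<zeta> = 1 \<and> Im \<zeta> \<ge> 0)")
    case True
    then show ?thesis using \<zeta> assms by (intro that[of \<zeta>]) (auto simp: DA_iff)
  next
    case False
    then have "norm (1 / \<zeta>) > 1 \<or> (norm (1 / \<zeta>) = 1 \<and> Im (1 / \<zeta>) \<ge> 0)"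
      using \<zeta>(1) norm_1_inverse_Im[of \<zeta>] by (auto simp: norm_divide less_divide_eq)
    then show ?thesis using \<zeta> assms
      by (intro that[of "1 / \<zeta>"]) (auto simp: DA_iff jk_inverse simp del: Im_divide)
  qed
qed

lemma Y_cases:
  assumes "z \<in> Y"
  obtains "z \<in> Y0" | s where "s \<in> K" "z \<in> L s" "z \<in> Ys s"
  using assms L_subset_Ys by (auto simp: Y0_def)

lemma pt_in_X: "c \<in> E \<Longrightarrow> z \<in> Y \<Longrightarrow> pt c z \<in> X"
proof (elim Y_cases)
  assume "c \<in> E" "z \<in> Y0"
  then show ?thesis using \<psi>_in_X[of "Sh c" z] by (simp add: Idx_intros)
next
  fix s assume *: "c \<in> E" "s \<in> K" "z \<in> Ys s"
  then obtain \<zeta> where "\<zeta> \<in> DA s" "par (An s c) \<zeta> = pt c z" using par_cover by metis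
  then show ?thesis using \<psi>_in_X[of "An s c" \<zeta>] * by (simp add: Idx_intros)
qed

lemma infp_in_X: "c \<in> E_inf \<Longrightarrow> infp c \<in> X"
  using \<psi>_in_X[of "In c" 0] R0_pos by (simp add: Idx_intros)

lemma X_cases:
  assumes "p \<in> X"
  obtains c z where "c \<in> E" "z \<in> Y" "p = pt c z" | c where "c \<in> E" "c \<in> E_inf" "p = infp c"
proof -
  obtain i z where i: "i \<in> Idx" "z \<in> dom i" "p = par i z" using assms by (auto simp: X_def)
  show ?thesis
    using i(1)
  proof (cases rule: Idx_cases)
    case (1 c)
    then show ?thesis using that(1) i Y0_subset by auto
  next
    case (2 s c)
    then have "J s z \<in> Y" using i Y0_subset by (auto simp: DA_iff)
    then show ?thesis using that(1) i par_An_cases[of s c z] 2 \<sigma>_in by metis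
  next
    case (3 c)
    show ?thesis
    proof (cases "z = 0")
      case True
      then show ?thesis using that(2) i 3 by simp
    next
      case False
      then have "1 / z \<in> Y" using In_in_Y0[OF 3(3), of z] i 3 Y0_subset by auto
      then show ?thesis using that(1)[of c "1 / z"] i 3 False by simp
    qed
  qed
qed

lemma Y_nonempty: "Y \<noteq> {}" using Y0_nonempty by auto

lemma X_nonempty: "X \<noteq> {}"
  using pt_in_X E_nonempty Y_nonempty by blast

text \<open>At \<open>infp c\<close> no such \<open>z\<close> exists and the value is arbitrary.
  Membership in \<open>tube UNIV\<close>, the set of finite points, is therefore the side condition
  for statements about \<open>proj\<close>.\<close>

definition proj :: "'a \<Rightarrow> complex" where "proj p = (THE z. \<exists>c\<in>E. p = pt c z)"

lemma proj_pt [simp]: "c \<in> E \<Longrightarrow> proj (pt c z) = z"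
  unfolding proj_def by (rule the_equality) (auto simp: pt_eq_iff)

definition tube :: "complex set \<Rightarrow> 'a set" where "tube V = {pt c z | c z. c \<in> E \<and> z \<in> Y \<and> z \<in> V}"

lemma pt_in_tube: "c \<in> E \<Longrightarrow> pt c z \<in> tube V \<longleftrightarrow> z \<in> Y \<and> z \<in> V"
  unfolding tube_def using pt_eq_iff by fastforce

lemma infp_notin_tube: "c \<in> E \<Longrightarrow> infp c \<notin> tube V"
  unfolding tube_def using infp_neq_pt by fastforce

lemma par_An_in_tube: "\<lbrakk>s \<in> K; c \<in> E; \<zeta> \<in> DA s\<rbrakk> \<Longrightarrow> par (An s c) \<zeta> \<in> tube V \<longleftrightarrow> J s \<zeta> \<in> V"
proof -
  assume *: "s \<in> K" "c \<in> E" "\<zeta> \<in> DA s"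
  then have "J s \<zeta> \<in> Y" using Y0_subset(2)[of s] by (auto simp: DA_iff)
  then show ?thesis
    using par_An_cases[of s c \<zeta>] pt_in_tube[OF *(2)] pt_in_tube[OF \<sigma>_in[OF *(1,2)]] by (elim disjE) simp_all
qed

lemma proj_par_An: "\<lbrakk>s \<in> K; c \<in> E\<rbrakk> \<Longrightarrow> proj (par (An s c) \<zeta>) = J s \<zeta>"
  using par_An_cases[of s c \<zeta>] \<sigma>_in by (metis proj_pt)

lemma openin_tube:
  assumes "open V"
  shows "openin T (tube V)"
  unfolding openin_T
proof (intro conjI ballI)
  show "tube V \<subseteq> X" using pt_in_X by (auto simp: tube_def)
  fix i assume "i \<in> Idx"
  then show "open {z \<in> dom i. par i z \<in> tube V}"
  proof (cases rule: Idx_cases)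
    case (1 c)
    then have "{z \<in> dom i. par i z \<in> tube V} = Y0 \<inter> V" using pt_in_tube Y0_subset by auto
    then show ?thesis using assms open_Y0 by auto
  next
    case (2 s c)
    then have "{z \<in> dom i. par i z \<in> tube V} = {\<zeta> \<in> DA s. J s \<zeta> \<in> V}"
      using par_An_in_tube[OF 2(2,3)] by (auto simp del: par.simps)
    then show ?thesis
      using assms open_DA[OF 2(2)] zero_notin_DA
      by (auto intro!: open_vimage_Collect holomorphic_on_imp_continuous_on holomorphic_on_jk)
  next
    case (3 c)
    have "{z \<in> dom i. par i z \<in> tube V} = {w \<in> ball 0 (1 / R0) - {0}. 1 / w \<in> V}"
      using 3 pt_in_tube infp_notin_tube In_in_Y0[OF 3(3)] Y0_subset by (auto split: if_splits)
    moreover have "open {w \<in> ball 0 (1 / R0) - {0}. 1 / w \<in> V}"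
      using assms by (intro open_vimage_Collect) (auto intro!: continuous_intros)
    ultimately show ?thesis by simp
  qed
qed

lemma separated_in_chart:
  assumes "i \<in> Idx" "z \<in> dom i" "w \<in> dom i" "par i z \<noteq> par i w"
  shows "\<exists>U V. openin T U \<and> openin T V \<and> par i z \<in> U \<and> par i w \<in> V \<and> disjnt U V"
proof -
  have "z \<noteq> w" using assms by auto
  then obtain A B where AB: "open A" "open B" "z \<in> A" "w \<in> B" "A \<inter> B = {}" using hausdorff by metis
  have "openin T (par i ` (A \<inter> dom i))" "openin T (par i ` (B \<inter> dom i))"
    using AB open_dom assms by (auto intro!: openin_\<psi>_image)
  moreover have "disjnt (par i ` (A \<inter> dom i)) (par i ` (B \<inter> dom i))"
    using AB inj_par[OF assms(1)] by (auto simp: disjnt_def inj_on_def)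
  ultimately show ?thesis using AB assms by (intro exI conjI) auto
qed

lemma separated_charts:
  assumes "i \<in> Idx" "j \<in> Idx" "z \<in> dom i" "w \<in> dom j" "par i ` dom i \<inter> par j ` dom j = {}"
  shows "\<exists>U V. openin T U \<and> openin T V \<and> par i z \<in> U \<and> par j w \<in> V \<and> disjnt U V"
  using assms open_dom
  by (intro exI[of _ "par i ` dom i"] exI[of _ "par j ` dom j"]) (auto intro!: openin_\<psi>_image simp: disjnt_def)

text \<open>Different projections are separated by tubes. Over one point of a slit, the two points
  lie in a common slit chart if \<open>d = \<sigma> s c\<close>, and otherwise in charts with
  disjoint images; over \<open>Y0\<close> the two sheets are disjoint.\<close>

lemma separated_pts:
  assumes "c \<in> E" "d \<in> E" "z \<in> Y" "w \<in> Y" "pt c z \<noteq> pt d w"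
  shows "\<exists>U V. openin T U \<and> openin T V \<and> pt c z \<in> U \<and> pt d w \<in> V \<and> disjnt U V"
proof (cases "z = w")
  case False
  then obtain A B where AB: "open A" "open B" "z \<in> A" "w \<in> B" "A \<inter> B = {}" using hausdorff by metis
  have "disjnt (tube A) (tube B)"
    using AB unfolding disjnt_iff by (auto simp: tube_def pt_eq_iff)
  then show ?thesis
    using openin_tube AB assms pt_in_tube by (intro exI[of _ "tube A"] exI[of _ "tube B"]) auto
next
  case True
  have "c \<noteq> d" using assms True by auto
  show ?thesis
    using assms(3)
  proof (cases rule: Y_cases)
    case 1
    have "par (Sh c) ` dom (Sh c) \<inter> par (Sh d) ` dom (Sh d) = {}"
      using pt_eq_Y0 assms \<open>c \<noteq> d\<close> by auto
    from separated_charts[OF _ _ _ _ this, of z w] show ?thesis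
      using assms True 1 by (simp add: Idx_intros)
  next
    case (2 s)
    obtain \<zeta> where \<zeta>: "\<zeta> \<in> DA s" "par (An s c) \<zeta> = pt c z" using par_cover[OF 2(1) assms(1) 2(3)] by metis
    obtain \<xi> where \<xi>: "\<xi> \<in> DA s" "par (An s d) \<xi> = pt d w"
      using par_cover[OF 2(1) assms(2) 2(3)] True by metis
    have i: "An s c \<in> Idx" "An s d \<in> Idx" using 2 assms by (auto simp: Idx_intros)
    show ?thesis
    proof (cases "d = \<sigma> s c")
      case d: True
      have "par (An s c) (1 / \<xi>) = pt d w"
        using par_flip[OF 2(1) assms(1)] \<xi> d by (auto simp: DA_iff simp del: par.simps)
      with separated_in_chart[OF i(1), of \<zeta> "1 / \<xi>"] show ?thesis
        using \<zeta> \<xi> inverse_in_DA assms(5) by (simp del: par.simps)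
    next
      case False
      have "par (An s c) ` dom (An s c) \<inter> par (An s d) ` dom (An s d) = {}"
        using par_An_eq[OF 2(1) assms(1,2)] False \<open>c \<noteq> d\<close> by (force simp del: par.simps)
      from separated_charts[OF i _ _ this, of \<zeta> \<xi>] show ?thesis
        using \<zeta> \<xi> by (simp del: par.simps)
    qed
  qed
qed

lemma separated_infp:
  assumes "c \<in> E" "d \<in> E" "d \<in> E_inf"
  shows "\<exists>U V. openin T U \<and> openin T V \<and> pt c z \<in> U \<and> infp d \<in> V \<and> disjnt U V"
proof -
  \<comment> \<open>Larger than \<open>norm z\<close>, so the tube over the ball of radius
    \<open>r\<close> contains \<open>pt c z\<close>; at least \<open>R0\<close>, so the ball of
    radius \<open>1 / r\<close> lies in the chart at infinity.\<close>
  define r where "r = max (norm z + 1) R0"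
  have r: "r > 0" "r \<ge> R0" "norm z < r" using R0_pos by (auto simp: r_def)
  have sub: "ball 0 (1 / r) \<subseteq> (ball 0 (1 / R0) :: complex set)"
    using r R0_pos by (intro subset_ball) (simp add: frac_le)
  have "openin T (par (In d) ` ball 0 (1 / r))"
    using assms sub by (intro openin_\<psi>_image) (auto simp: Idx_intros)
  moreover have "disjnt (tube (ball 0 r)) (par (In d) ` ball 0 (1 / r))"
  proof -
    have "par (In d) w \<notin> tube (ball 0 r)" if "w \<in> ball 0 (1 / r)" for w
    proof (cases "w = 0")
      case False
      then have "norm (1 / w) > r" using that r by (simp add: norm_divide field_simps)
      then show ?thesis using False assms pt_in_tube by auto
    qed (use infp_notin_tube assms in auto)
    then show ?thesis by (auto simp: disjnt_iff simp del: par.simps)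
  qed
  moreover have "infp d \<in> par (In d) ` ball 0 (1 / r)" using r by (intro image_eqI[of _ _ 0]) auto
  moreover have "pt c z \<in> tube (ball 0 r)" using assms closed_base(1)[OF assms(3)] r pt_in_tube by auto
  ultimately show ?thesis using openin_tube[OF open_ball] by blast
qed

lemma Hausdorff_T: "Hausdorff_space T"
  unfolding Hausdorff_space_def topspace_T
proof (intro allI impI, elim conjE)
  fix p q assume p: "p \<in> X" and q: "q \<in> X" and pq: "p \<noteq> q"
  show "\<exists>U V. openin T U \<and> openin T V \<and> p \<in> U \<and> q \<in> V \<and> disjnt U V"
    using p
  proof (cases rule: X_cases)
    case p: (1 c z)
    show ?thesis
      using q
    proof (cases rule: X_cases)
      case q: (1 d w)
      then show ?thesis using separated_pts p pq by auto
    next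
      case q: (2 d)
      then show ?thesis using separated_infp[of c d z] p by auto
    qed
  next
    case p: (2 c)
    show ?thesis
      using q
    proof (cases rule: X_cases)
      case q: (1 d w)
      then show ?thesis using separated_infp[of d c w] p by (metis disjnt_sym)
    next
      case q: (2 d)
      then have "c \<noteq> d" using p pq by auto
      then have "par (In c) ` dom (In c) \<inter> par (In d) ` dom (In d) = {}"
        using pt_eq_Y0 In_in_Y0[OF p(2)] infp_neq_pt infp_eq_iff p q
        by (auto simp: split: if_splits; metis)
      from separated_charts[OF _ _ _ _ this, of 0 0] show ?thesis
        using p q R0_pos by (simp add: Idx_intros)
    qed
  qed
qed

text \<open>Small radial displacements, less than 1 so that the inner point stays nonzero. An open
  condition at a point of a slit thus reaches both adjoining sheets, which is how facts over
  \<open>Y0\<close> are carried to the slits.\<close>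

lemma near_circle:
  assumes "open N" "\<zeta> \<in> N" "norm (\<zeta> :: complex) = 1"
  obtains \<xi> \<xi>' where "\<xi> \<in> N" "norm \<xi> > 1" "\<xi>' \<in> N" "norm \<xi>' < 1" "\<xi>' \<noteq> 0"
proof -
  obtain e where e: "e > 0" "ball \<zeta> e \<subseteq> N" using assms by (auto simp: open_contains_ball)
  define t where "t = min (e / 2) (1 / 2)"
  have t: "t > 0" "t < e" "t < 1" using e by (auto simp: t_def)
  have n: "norm ((1 + complex_of_real t) * \<zeta>) = 1 + t" "norm ((1 - complex_of_real t) * \<zeta>) = 1 - t"
    using assms(3) t norm_of_real[of "1 + t", where ?'a = complex] norm_of_real[of "1 - t", where ?'a = complex]
    by (simp_all add: norm_mult del: norm_of_real)
  have "dist \<zeta> ((1 + of_real t) * \<zeta>) < e" "dist \<zeta> ((1 - of_real t) * \<zeta>) < e"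
    using assms(3) t by (simp_all add: dist_norm algebra_simps norm_mult)
  then have "(1 + of_real t) * \<zeta> \<in> N" "(1 - of_real t) * \<zeta> \<in> N" using e(2) by auto
  moreover have "(1 - of_real t) * \<zeta> \<noteq> 0" using n(2) t by auto
  ultimately show ?thesis using that n t by (metis add_less_same_cancel1 less_add_same_cancel1 diff_less_eq)
qed

text \<open>A clopen set contains the part of a sheet over the connected \<open>Y0\<close> or misses
  it, as recorded by \<open>Q\<close>. Points on the circle of a slit chart force the same answer
  for \<open>c\<close> and \<open>\<sigma> s c\<close>, and \<open>\<sigma>_transitive\<close>
  spreads it to all sheets.\<close>

lemma connected_T: "connected_space T"
  unfolding connected_space_clopen_in
proof (intro allI impI, elim conjE)
  fix W assume W: "openin T W" "closedin T W"
  define G where "G i = {z \<in> dom i. par i z \<in> W}" for i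
  define H where "H i = {z \<in> dom i. par i z \<in> X - W}" for i
  have oG: "open (G i)" and oH: "open (H i)" if "i \<in> Idx" for i
    using W that openin_T unfolding G_def H_def closedin_def topspace_T by blast+
  have GH: "dom i = G i \<union> H i" "G i \<inter> H i = {}" if "i \<in> Idx" for i
    using that \<psi>_in_X by (auto simp: G_def H_def)
  define Q where "Q c \<longleftrightarrow> (\<forall>z\<in>Y0. pt c z \<in> W)" for c
  have sheet: "pt c z \<in> W \<longleftrightarrow> Q c" if "c \<in> E" "z \<in> Y0" for c z
  proof -
    have "G (Sh c) = {} \<or> H (Sh c) = {}"
      using connected_Y0 GH[of "Sh c"] oG[of "Sh c"] oH[of "Sh c"] that
      unfolding connected_def Y0_def[symmetric] by (simp add: Idx_intros) blast
    then show ?thesis using GH[of "Sh c"] that by (auto simp: Q_def G_def H_def Idx_intros)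
  qed
  have circle: "(par (An s c) \<zeta> \<in> W \<longleftrightarrow> Q c) \<and> (par (An s c) \<zeta> \<in> W \<longleftrightarrow> Q (\<sigma> s c))"
    if "s \<in> K" "c \<in> E" "norm \<zeta> = 1" for s c \<zeta>
  proof -
    have i: "An s c \<in> Idx" using that Idx_intros by auto
    have z: "\<zeta> \<in> dom (An s c)" and n1: "norm \<zeta> = 1" using circle_in_DA that by simp_all
    have *: "(par (An s c) \<xi> \<in> W \<longleftrightarrow> (if norm \<xi> > 1 then Q c else Q (\<sigma> s c)))"
      if "\<xi> \<in> DA s" "norm \<xi> \<noteq> 1" for \<xi>
      using sheet[of _ "J s \<xi>"] DA_J[of s \<xi>] that \<open>s \<in> K\<close> \<open>c \<in> E\<close> \<sigma>_in by auto
    show ?thesis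
    proof (cases "par (An s c) \<zeta> \<in> W")
      case True
      then obtain \<xi> \<xi>' where "\<xi> \<in> G (An s c)" "norm \<xi> > 1" "\<xi>' \<in> G (An s c)" "norm \<xi>' < 1"
        using near_circle[OF oG[OF i], of \<zeta>] z n1 unfolding G_def by blast
      then show ?thesis using *[of \<xi>] *[of \<xi>'] True by (auto simp: G_def simp del: par.simps)
    next
      case False
      then obtain \<xi> \<xi>' where "\<xi> \<in> H (An s c)" "norm \<xi> > 1" "\<xi>' \<in> H (An s c)" "norm \<xi>' < 1"
        using near_circle[OF oH[OF i], of \<zeta>] z n1 \<psi>_in_X[OF i z] unfolding H_def by blast
      then show ?thesis using *[of \<xi>] *[of \<xi>'] False by (auto simp: H_def simp del: par.simps)
    qed
  qed
  have inf: "infp c \<in> W \<longleftrightarrow> Q c" if "c \<in> E" "c \<in> E_inf" for c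
  proof -
    have i: "In c \<in> Idx" using that Idx_intros by auto
    have z: "0 \<in> dom (In c)" using R0_pos by auto
    have ex: "\<exists>w\<in>N. w \<noteq> 0" if "open N" "0 \<in> N" for N :: "complex set"
      using that by (metis finite_imp_not_open finite.emptyI finite_insert singletonI insertE subsetI finite_subset empty_iff)
    have *: "(par (In c) w \<in> W \<longleftrightarrow> Q c)" if "w \<in> ball 0 (1 / R0)" "w \<noteq> 0" for w
      using sheet[of c "1 / w"] In_in_Y0[of c w] that \<open>c \<in> E\<close> \<open>c \<in> E_inf\<close> by auto
    show ?thesis
    proof (cases "infp c \<in> W")
      case True
      then obtain w where "w \<in> G (In c)" "w \<noteq> 0" using ex[OF oG[OF i]] z by (auto simp: G_def)
      then show ?thesis using *[of w] True by (auto simp: G_def)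
    next
      case False
      then obtain w where "w \<in> H (In c)" "w \<noteq> 0"
        using ex[OF oH[OF i]] z \<psi>_in_X[OF i z] by (auto simp: H_def)
      then show ?thesis using *[of w] False by (auto simp: H_def)
    qed
  qed
  have all: "p \<in> W \<longleftrightarrow> (\<exists>c\<in>E. Q c)" "p \<in> W \<longleftrightarrow> (\<forall>c\<in>E. Q c)" if "p \<in> X" for p
  proof -
    have Qs: "Q c \<longleftrightarrow> Q (\<sigma> s c)" if "s \<in> K" "c \<in> E" for s c
      using circle[OF that, of 1] by (metis norm_one)
    have QQ: "Q c \<longleftrightarrow> Q d" if "c \<in> E" "d \<in> E" for c d
      using \<sigma>_transitive[of "\<lambda>e. Q e \<longleftrightarrow> Q c" c d] that Qs by blast
    have "\<exists>c\<in>E. p \<in> W \<longleftrightarrow> Q c"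
      using \<open>p \<in> X\<close>
    proof (cases rule: X_cases)
      case (1 c z)
      show ?thesis
        using 1(2)
      proof (cases rule: Y_cases)
        case (2 s)
        obtain \<zeta> where \<zeta>: "\<zeta> \<in> DA s" "J s \<zeta> = z" "par (An s c) \<zeta> = pt c z" using par_cover[OF 2(1) 1(1) 2(3)] by metis
        then have "norm \<zeta> = 1" using J_in_L_iff[OF 2(1)] 2(2) by (auto simp: DA_iff)
        then show ?thesis using circle[OF 2(1) 1(1)] \<zeta> 1 by metis
      qed (use sheet 1 in auto)
    qed (use inf in auto)
    then show "p \<in> W \<longleftrightarrow> (\<exists>c\<in>E. Q c)" "p \<in> W \<longleftrightarrow> (\<forall>c\<in>E. Q c)" using QQ by blast+
  qed
  have "W \<subseteq> X" using W openin_T by blast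
  then show "W = {} \<or> W = topspace T" using all by auto
qed

theorem riemann_surface_cover: "riemann_surface surf"
  using riemann_surface_surf X_nonempty connected_T Hausdorff_T countable_Idx by blast

text \<open>Finitely many compact pieces cover the surface: closed annuli around the slits, closed
  discs around the points at infinity, and what remains of each sheet.\<close>

theorem compact_T:
  assumes "E \<subseteq> E_inf" "finite E" "finite K"
  shows "compact_space T"
proof -
  have Y: "Y = UNIV" using closed_base(1) assms(1) E_nonempty by blast
  define An' :: "real \<Rightarrow> complex set" where "An' \<rho> = {\<zeta>. 1 / \<rho> \<le> norm \<zeta> \<and> norm \<zeta> \<le> \<rho>}" for \<rho>
  have "\<exists>\<rho>>1. An' \<rho> \<subseteq> DA s" if "s \<in> K" for s
  proof -
    have "sphere 0 1 \<subseteq> DA s" and oDA: "open (DA s)" using circle_in_DA open_DA that by auto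
    then obtain e where e: "e > 0" "(\<Union>x\<in>sphere 0 1. cball x e) \<subseteq> DA s"
      using compact_subset_open_imp_cball_epsilon_subset[OF compact_sphere oDA] by blast
    have "An' (1 + e) \<subseteq> DA s"
    proof
      fix \<zeta> assume "\<zeta> \<in> An' (1 + e)"
      then have \<zeta>: "1 / (1 + e) \<le> norm \<zeta>" "norm \<zeta> \<le> 1 + e" by (auto simp: An'_def)
      have "1 - e \<le> 1 / (1 + e)" using e(1) by (simp add: le_divide_eq algebra_simps)
      then have b: "\<bar>norm \<zeta> - 1\<bar> \<le> e" using \<zeta> by linarith
      have nz: "\<zeta> \<noteq> 0" using \<zeta>(1) e(1) by (auto simp: divide_le_0_iff)
      have "\<zeta> - \<zeta> / of_real (norm \<zeta>) = (\<zeta> / of_real (norm \<zeta>)) * of_real (norm \<zeta> - 1)"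
        using nz by (simp add: field_simps)
      then have "norm (\<zeta> - \<zeta> / of_real (norm \<zeta>)) = \<bar>norm \<zeta> - 1\<bar>"
        using nz by (simp add: norm_mult norm_divide del: of_real_diff)
      then have "\<zeta> \<in> cball (\<zeta> / of_real (norm \<zeta>)) e" using b by (simp add: dist_norm norm_minus_commute)
      moreover have "\<zeta> / of_real (norm \<zeta>) \<in> sphere 0 1" using nz by (simp add: norm_divide)
      ultimately show "\<zeta> \<in> DA s" using e(2) by blast
    qed
    then show ?thesis using e(1) by (intro exI[of _ "1 + e"]) auto
  qed
  then obtain \<rho> where \<rho>: "\<And>s. s \<in> K \<Longrightarrow> \<rho> s > 1" "\<And>s. s \<in> K \<Longrightarrow> An' (\<rho> s) \<subseteq> DA s" by metis
  \<comment> \<open>The image of the open annulus is a neighbourhood of the slit because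
    \<open>J s\<close> is open; removing these neighbourhoods from a closed ball leaves a compact
    subset of \<open>Y0\<close>.\<close>
  define V where "V s = J s ` {\<zeta>. 1 / \<rho> s < norm \<zeta> \<and> norm \<zeta> < \<rho> s}" for s
  have "open (V s)" if "s \<in> K" for s
  proof -
    have "open {\<zeta>::complex. 1 / \<rho> s < norm \<zeta> \<and> norm \<zeta> < \<rho> s}"
      by (intro open_Collect_conj open_Collect_less continuous_intros)
    then show ?thesis unfolding V_def using \<rho>(1)[OF that] by (intro open_jk_image l_nonzero that) auto
  qed
  then have C0: "compact (cball 0 (2 * R0) - (\<Union>s\<in>K. V s))" by (intro compact_diff) auto
  have LV: "L s \<subseteq> V s" if "s \<in> K" for s
    using \<rho>(1)[OF that] by (auto simp: slit_def V_def intro!: imageI)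
  have C0Y: "cball 0 (2 * R0) - (\<Union>s\<in>K. V s) \<subseteq> Y0"
    unfolding Y0_def using LV Y by auto
  have comp_img: "compactin T (par i ` C)" if "i \<in> Idx" "compact C" "C \<subseteq> dom i" for i C
    using that continuous_map_\<psi> by (intro image_compactin[of "top_of_set (dom i)"]) (auto simp: compactin_subtopology)
  have compA: "compact (An' (\<rho> s))" if "s \<in> K" for s
  proof -
    have "An' (\<rho> s) = cball 0 (\<rho> s) \<inter> {\<zeta>. 1 / \<rho> s \<le> norm \<zeta>}" by (auto simp: An'_def)
    moreover have "closed {\<zeta>::complex. 1 / \<rho> s \<le> norm \<zeta>}" by (intro closed_Collect_le continuous_intros)
    ultimately show ?thesis by (metis compact_Int_closed compact_cball)
  qed
  define \<C> where "\<C> = (\<lambda>c. par (Sh c) ` (cball 0 (2 * R0) - (\<Union>s\<in>K. V s))) ` E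
    \<union> (\<lambda>(s, c). par (An s c) ` An' (\<rho> s)) ` (K \<times> E) \<union> (\<lambda>c. par (In c) ` cball 0 (1 / (2 * R0))) ` E"
  have "compactin T (\<Union>\<C>)"
  proof (rule compactin_Union)
    show "finite \<C>" using assms by (auto simp: \<C>_def)
    have "cball 0 (1 / (2 * R0)) \<subseteq> (ball 0 (1 / R0) :: complex set)" using R0_pos by (auto simp: field_simps)
    then show "compactin T S" if "S \<in> \<C>" for S
      using that comp_img C0 C0Y compA \<rho>(2) assms(1)
      by (auto simp: \<C>_def Idx_intros simp del: par.simps)
  qed
  moreover have "X \<subseteq> \<Union>\<C>"
  proof
    fix p assume "p \<in> X"
    then show "p \<in> \<Union>\<C>"
    proof (cases rule: X_cases)
      case (1 c z)
      consider "norm z > 2 * R0" | s where "s \<in> K" "z \<in> V s" | "z \<in> cball 0 (2 * R0) - (\<Union>s\<in>K. V s)"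
        by fastforce
      then show ?thesis
      proof cases
        case a: 1
        then have "1 / z \<in> cball 0 (1 / (2 * R0))" "z \<noteq> 0"
          using R0_pos frac_le[of 1 1 "2 * R0" "norm z"] by (auto simp: norm_divide)
        then have "p \<in> par (In c) ` cball 0 (1 / (2 * R0))" using 1 by (intro image_eqI[of _ _ "1 / z"]) auto
        then show ?thesis using 1 by (auto simp: \<C>_def simp del: par.simps)
      next
        case b: (2 s)
        obtain \<zeta> where \<zeta>: "J s \<zeta> = z" "1 / \<rho> s < norm \<zeta>" "norm \<zeta> < \<rho> s" using b by (auto simp: V_def)
        have \<rho>s: "\<rho> s > 1" using \<rho>(1) b by simp
        then have nz: "\<zeta> \<noteq> 0" using \<zeta>(2) by (auto simp: divide_less_0_iff)
        have A: "\<zeta> \<in> An' (\<rho> s)" "1 / \<zeta> \<in> An' (\<rho> s)"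
          using \<zeta> nz \<rho>s by (auto simp: An'_def norm_divide field_simps)
        then have "\<zeta> \<in> DA s" using \<rho>(2) b by blast
        then have "z \<in> Ys s" using \<zeta> by (auto simp: DA_iff)
        then obtain \<xi> where \<xi>: "\<xi> \<in> DA s" "J s \<xi> = z" "par (An s c) \<xi> = pt c z"
          using par_cover[OF b(1) 1(1)] by metis
        then have "\<xi> = \<zeta> \<or> \<xi> = 1 / \<zeta>"
          using jk_eq_iff[OF l_nonzero[OF b(1)] nz, of \<xi> "m s"] \<zeta> by (auto simp: DA_iff)
        then have "pt c z \<in> par (An s c) ` An' (\<rho> s)" using A \<xi>(3) by (metis imageI)
        then show ?thesis using 1 b by (auto simp: \<C>_def simp del: par.simps)
      next
        case 3
        then have "p \<in> par (Sh c) ` (cball 0 (2 * R0) - (\<Union>s\<in>K. V s))" using 1 by auto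
        then show ?thesis using 1 by (auto simp: \<C>_def simp del: par.simps)
      qed
    next
      case (2 c)
      then have "p \<in> par (In c) ` cball 0 (1 / (2 * R0))" using R0_pos by (intro image_eqI[of _ _ 0]) auto
      then show ?thesis using 2 by (auto simp: \<C>_def simp del: par.simps)
    qed
  qed
  moreover have "\<Union>\<C> \<subseteq> X" using \<open>compactin T (\<Union>\<C>)\<close> compactin_subset_topspace by fastforce
  ultimately show ?thesis by (metis compact_space_def subset_antisym topspace_T)
qed

end

section \<open>Deck transformations\<close>

context slit_cover
begin

definition commuting :: "('e \<Rightarrow> 'e) \<Rightarrow> bool" where
  "commuting \<tau> \<longleftrightarrow> bij_betw \<tau> E E \<and> (\<forall>s\<in>K. \<forall>c\<in>E. \<tau> (\<sigma> s c) = \<sigma> s (\<tau> c))"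

lemma commutingD:
  assumes "commuting \<tau>"
  shows "c \<in> E \<Longrightarrow> \<tau> c \<in> E" "s \<in> K \<Longrightarrow> c \<in> E \<Longrightarrow> \<tau> (\<sigma> s c) = \<sigma> s (\<tau> c)" "inj_on \<tau> E" "\<tau> ` E = E"
  using assms by (auto simp: commuting_def bij_betw_def)

text \<open>The value does not depend on the representation of \<open>p\<close>, because a commuting
  permutation respects the identifications at the ends of slits (\<open>pt_commuting\<close>). The
  restriction to \<open>X\<close> makes the map extensional, as \<open>Bij\<close> demands.\<close>

definition deck :: "('e \<Rightarrow> 'e) \<Rightarrow> 'a \<Rightarrow> 'a" where
  "deck \<tau> = (\<lambda>p\<in>X. THE q. (\<exists>c\<in>E. \<exists>z. p = pt c z \<and> q = pt (\<tau> c) z) \<or> (\<exists>c\<in>E. p = infp c \<and> q = infp (\<tau> c)))"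

lemma deck_extensional: "deck \<tau> \<in> extensional X"
  by (simp add: deck_def)

lemma pt_commuting:
  assumes "commuting \<tau>" "c \<in> E" "d \<in> E" "pt c z = pt d w"
  shows "pt (\<tau> c) z = pt (\<tau> d) w"
proof -
  have "z = w" "c = d \<or> (\<exists>s\<in>K. (z = m s + l s \<or> z = m s - l s) \<and> d = \<sigma> s c)"
    using assms(2-4) by (auto simp: pt_eq_iff)
  then show ?thesis
    using commutingD(1,2)[OF assms(1)] assms(2,3) pt_end by metis
qed

lemma deck_pt:
  assumes "commuting \<tau>" "c \<in> E" "z \<in> Y"
  shows "deck \<tau> (pt c z) = pt (\<tau> c) z"
proof -
  have "(THE q. (\<exists>d\<in>E. \<exists>w. pt c z = pt d w \<and> q = pt (\<tau> d) w) \<or> (\<exists>d\<in>E. pt c z = infp d \<and> q = infp (\<tau> d)))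
    = pt (\<tau> c) z"
  proof (rule the_equality)
    fix q assume "(\<exists>d\<in>E. \<exists>w. pt c z = pt d w \<and> q = pt (\<tau> d) w) \<or> (\<exists>d\<in>E. pt c z = infp d \<and> q = infp (\<tau> d))"
    then show "q = pt (\<tau> c) z" using assms infp_neq_pt[OF _ assms(2), of _ z] pt_commuting[OF assms(1,2)] by metis
  qed (use assms in blast)
  then show ?thesis using pt_in_X[OF assms(2,3)] by (simp add: deck_def)
qed

lemma deck_infp:
  assumes "commuting \<tau>" "c \<in> E_inf"
  shows "deck \<tau> (infp c) = infp (\<tau> c)"
proof -
  have c: "c \<in> E" using E_inf assms by auto
  have "(THE q. (\<exists>d\<in>E. \<exists>w. infp c = pt d w \<and> q = pt (\<tau> d) w) \<or> (\<exists>d\<in>E. infp c = infp d \<and> q = infp (\<tau> d)))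
    = infp (\<tau> c)"
    by (rule the_equality) (use c infp_eq_iff infp_neq_pt in metis)+
  then show ?thesis using infp_in_X[OF assms(2)] by (simp add: deck_def)
qed

lemma E_inf_commuting: "commuting \<tau> \<Longrightarrow> c \<in> E_inf \<Longrightarrow> \<tau> c \<in> E_inf"
  using E_inf commutingD(1) by blast

lemma deck_par_An:
  assumes "commuting \<tau>" "s \<in> K" "c \<in> E" "\<zeta> \<in> DA s"
  shows "deck \<tau> (par (An s c) \<zeta>) = par (An s (\<tau> c)) \<zeta>"
proof -
  have "J s \<zeta> \<in> Y" using assms(4) Y0_subset by (auto simp: DA_iff)
  then show ?thesis
    using deck_pt[OF assms(1,3)] deck_pt[OF assms(1) \<sigma>_in[OF assms(2,3)]] commutingD(2)[OF assms(1-3)] by auto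
qed

fun relabel :: "('e \<Rightarrow> 'e) \<Rightarrow> 'e idx \<Rightarrow> 'e idx" where
  "relabel \<tau> (Sh c) = Sh (\<tau> c)"
| "relabel \<tau> (An s c) = An s (\<tau> c)"
| "relabel \<tau> (In c) = In (\<tau> c)"

text \<open>Between corresponding charts a deck transformation is the identity of the parameter and
  only the label of the sheet changes; holomorphy is then immediate.\<close>

lemma deck_par:
  assumes "commuting \<tau>" "i \<in> Idx" "z \<in> dom i"
  shows "deck \<tau> (par i z) = par (relabel \<tau> i) z" "relabel \<tau> i \<in> Idx" "dom (relabel \<tau> i) = dom i"
proof -
  have "deck \<tau> (par i z) = par (relabel \<tau> i) z \<and> relabel \<tau> i \<in> Idx \<and> dom (relabel \<tau> i) = dom i"
    using assms(2)
  proof (cases rule: Idx_cases)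
    case (1 c)
    then show ?thesis
      using assms deck_pt[OF assms(1)] Y0_subset commutingD(1)[OF assms(1)] by (auto simp: Idx_intros)
  next
    case (2 s c)
    then show ?thesis
      using assms deck_par_An[OF assms(1)] commutingD(1)[OF assms(1)] by (auto simp: Idx_intros simp del: par.simps)
  next
    case (3 c)
    then show ?thesis
      using assms deck_infp[OF assms(1)] deck_pt[OF assms(1)] In_in_Y0[OF 3(3), of z] Y0_subset
        E_inf_commuting[OF assms(1)] by (auto simp: Idx_intros)
  qed
  then show "deck \<tau> (par i z) = par (relabel \<tau> i) z" "relabel \<tau> i \<in> Idx" "dom (relabel \<tau> i) = dom i"
    by blast+
qed

lemma holomorphic_map_deck:
  assumes "commuting \<tau>" "\<And>p. p \<in> X \<Longrightarrow> g p = deck \<tau> p"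
  shows "holomorphic_map surf surf g"
proof (rule holomorphic_map_surfI)
  fix i z assume i: "i \<in> Idx" "z \<in> dom i"
  have "lifts_at dom par g i (relabel \<tau> i) z"
    by (rule lifts_atI[of "dom i" _ _ _ "\<lambda>z. z"])
      (use i deck_par[OF assms(1) i(1)] open_dom assms(2) \<psi>_in_X in auto)
  then show "\<exists>j\<in>Idx. lifts_at dom par g i j z" using deck_par[OF assms(1) i] by blast
qed

lemma commuting_inv:
  assumes "commuting \<tau>"
  shows "commuting (inv_into E \<tau>)"
  unfolding commuting_def
proof (intro conjI ballI)
  show "bij_betw (inv_into E \<tau>) E E" using assms bij_betw_inv_into by (auto simp: commuting_def)
  note t = commutingD[OF assms]
  fix s c assume *: "s \<in> K" "c \<in> E"
  then obtain d where d: "d \<in> E" "c = \<tau> d" using t(4) by blast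
  then show "inv_into E \<tau> (\<sigma> s c) = \<sigma> s (inv_into E \<tau> c)"
    using t(2)[OF *(1) d(1), symmetric] t(3) \<sigma>_in[OF *(1)] by simp
qed

lemma deck_in_X: "commuting \<tau> \<Longrightarrow> p \<in> X \<Longrightarrow> deck \<tau> p \<in> X"
  by (elim X_cases) (auto simp: deck_pt deck_infp pt_in_X infp_in_X E_inf_commuting commutingD(1))

lemma deck_deck:
  assumes "commuting \<tau>" "commuting \<rho>" "commuting \<nu>" "\<And>c. c \<in> E \<Longrightarrow> \<nu> c = \<tau> (\<rho> c)" "p \<in> X"
  shows "deck \<tau> (deck \<rho> p) = deck \<nu> p"
  using assms(5)
proof (cases rule: X_cases)
  case (1 c z)
  then show ?thesis using deck_pt assms(1-4) commutingD(1)[OF assms(2)] by simp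
next
  case (2 c)
  then show ?thesis using deck_infp assms(1-4) E_inf_commuting[OF assms(2)] by simp
qed

lemma deck_id:
  assumes "commuting \<tau>" "\<And>c. c \<in> E \<Longrightarrow> \<tau> c = c" "p \<in> X"
  shows "deck \<tau> p = p"
  using assms(3) by (elim X_cases) (auto simp: deck_pt deck_infp assms(1,2))

lemma deck_in_Aut:
  assumes "commuting \<tau>"
  shows "deck \<tau> \<in> carrier (Aut surf)"
proof -
  note t = commutingD[OF assms]
  let ?\<rho> = "inv_into E \<tau>"
  have r: "commuting ?\<rho>" using commuting_inv assms .
  have id: "commuting (\<lambda>c. c)" by (simp add: commuting_def bij_betw_def)
  have 1: "deck \<tau> (deck ?\<rho> p) = p" if "p \<in> X" for p
    using deck_deck[OF assms r id _ that] deck_id[OF id _ that] t(4) by (simp add: f_inv_into_f)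
  have 2: "deck ?\<rho> (deck \<tau> p) = p" if "p \<in> X" for p
    using deck_deck[OF r assms id _ that] deck_id[OF id _ that] t(3) by simp
  have inj: "inj_on (deck \<tau>) X" by (rule inj_on_inverseI[where g = "deck ?\<rho>"]) (rule 2)
  moreover have "deck \<tau> ` X = X"
  proof
    show "X \<subseteq> deck \<tau> ` X" using deck_in_X[OF r] 1 by (metis image_eqI subsetI)
  qed (use deck_in_X[OF assms] in auto)
  ultimately have "bij_betw (deck \<tau>) X X" by (simp add: bij_betw_def)
  moreover have "deck \<tau> \<in> extensional X" by (simp add: deck_def)
  moreover have "inv_into X (deck \<tau>) p = deck ?\<rho> p" if "p \<in> X" for p
    using inv_into_f_f[OF inj deck_in_X[OF r that]] 1[OF that] by simp
  ultimately show ?thesis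
    using holomorphic_map_deck[OF assms] holomorphic_map_deck[OF r]
    by (auto simp: Aut_def BijGroup_def Bij_def)
qed

lemma Aut_carrierD:
  assumes "g \<in> carrier (Aut surf)"
  shows "bij_betw g X X" "holomorphic_map surf surf g" "holomorphic_map surf surf (inv_into X g)"
    "g \<in> extensional X" "continuous_map T T g"
  using assms by (auto simp: Aut_def BijGroup_def Bij_def holomorphic_map_def)

text \<open>Since the surface is Hausdorff, continuous maps that agree at points arbitrarily close
  to \<open>z\<close> agree at \<open>z\<close>. This extends identities from \<open>Y0\<close> to
  slits and to infinity.\<close>

lemma continuous_agree:
  assumes "i \<in> Idx" "continuous_map (top_of_set (dom i)) T f" "continuous_map (top_of_set (dom i)) T g"
    and "z \<in> dom i" "\<And>N. open N \<Longrightarrow> z \<in> N \<Longrightarrow> N \<subseteq> dom i \<Longrightarrow> \<exists>w\<in>N. f w = g w"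
  shows "f z = g z"
proof (rule ccontr)
  assume ne: "f z \<noteq> g z"
  have "f z \<in> X" "g z \<in> X" using assms(2-4) by (auto simp: continuous_map_def)
  then obtain U V where UV: "openin T U" "openin T V" "f z \<in> U" "g z \<in> V" "disjnt U V"
    using Hausdorff_T ne unfolding Hausdorff_space_def by auto metis
  let ?N = "{w \<in> dom i. f w \<in> U} \<inter> {w \<in> dom i. g w \<in> V}"
  have "openin (top_of_set (dom i)) {w \<in> dom i. f w \<in> U}" "openin (top_of_set (dom i)) {w \<in> dom i. g w \<in> V}"
    using assms(2,3) UV by (auto simp: continuous_map_def)
  then have "open ?N" using open_dom[OF assms(1)] by (auto simp: openin_open_eq)
  moreover have "z \<in> ?N" "?N \<subseteq> dom i" using assms(4) UV by auto
  ultimately obtain w where "w \<in> ?N" "f w = g w" using assms(5) by blast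
  then show False using UV(5) by (auto simp: disjnt_iff)
qed

text \<open>The sets \<open>A d\<close> split the connected \<open>Y0\<close> into open parts, so
  each sheet goes to a single sheet \<open>\<tau> c\<close>. At a slit, continuity from outside the
  circle gives the label \<open>\<tau> c\<close> and from inside
  \<open>\<sigma> s (\<tau> (\<sigma> s c))\<close>; equality of the two is the commutation
  rule.\<close>

theorem unramified_is_deck:
  assumes g: "g \<in> carrier (Aut surf)"
    and pr: "\<And>c z. c \<in> E \<Longrightarrow> z \<in> Y0 \<Longrightarrow> \<exists>d\<in>E. g (pt c z) = pt d z"
  obtains \<tau> where "commuting \<tau>" "g = deck \<tau>"
proof -
  note gD = Aut_carrierD[OF g]
  have ginj: "g p = g q \<Longrightarrow> p = q" if "p \<in> X" "q \<in> X" for p q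
    using gD(1) that by (auto simp: bij_betw_def inj_on_def)
  have "\<exists>d\<in>E. \<forall>z\<in>Y0. g (pt c z) = pt d z" if c: "c \<in> E" for c
  proof -
    define A where "A d = {z \<in> Y0. g (pt c z) \<in> par (Sh d) ` Y0}" for d
    have oA: "open (A d)" if "d \<in> E" for d
    proof -
      have "openin T (par (Sh d) ` Y0)" using openin_\<psi>_image[of "Sh d" Y0] that open_Y0 by (simp add: Idx_intros)
      then have "openin T {p \<in> X. g p \<in> par (Sh d) ` Y0}" using gD(5) by (auto simp: continuous_map_def)
      then have "open {z \<in> dom (Sh c). par (Sh c) z \<in> {p \<in> X. g p \<in> par (Sh d) ` Y0}}"
        using openin_T c Idx_intros(1) by blast
      moreover have "{z \<in> dom (Sh c). par (Sh c) z \<in> {p \<in> X. g p \<in> par (Sh d) ` Y0}} = A d"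
        using pt_in_X[OF c] Y0_subset by (auto simp: A_def)
      ultimately show ?thesis by simp
    qed
    have A: "z \<in> A d \<longleftrightarrow> g (pt c z) = pt d z" if "d \<in> E" "z \<in> Y0" for d z
    proof -
      obtain e where e: "e \<in> E" "g (pt c z) = pt e z" using pr[OF c \<open>z \<in> Y0\<close>] by blast
      show ?thesis using that e pt_eq_Y0[OF that(2) e(1) that(1)] unfolding A_def by force
    qed
    obtain z0 where z0: "z0 \<in> Y0" using Y0_nonempty by (auto simp: Y0_def)
    obtain d where d: "d \<in> E" "g (pt c z0) = pt d z0" using pr c z0 by blast
    let ?B = "\<Union>e\<in>E - {d}. A e"
    have cov: "Y0 \<subseteq> A d \<union> ?B"
    proof
      fix z assume z: "z \<in> Y0"
      then obtain e where "e \<in> E" "g (pt c z) = pt e z" using pr c by blast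
      then show "z \<in> A d \<union> ?B" using A z by blast
    qed
    have dis: "A d \<inter> ?B \<inter> Y0 = {}"
    proof -
      have False if "z \<in> A d" "z \<in> A e" "e \<in> E - {d}" for z e
      proof -
        have z: "z \<in> Y0" using that(1) by (simp add: A_def)
        have "pt d z = pt e z" using A[OF d(1) z] A[of e z] that z by auto
        then show False using pt_eq_Y0[OF z d(1), of e z] that(3) by blast
      qed
      then show ?thesis by blast
    qed
    have "open ?B" using oA by auto
    then have "A d \<inter> Y0 = {} \<or> ?B \<inter> Y0 = {}"
      using connectedD[OF connected_Y0[folded Y0_def] oA[OF d(1)] _ dis cov] by blast
    then have "?B \<inter> Y0 = {}" using A[OF d(1) z0] d z0 by blast
    then have "\<forall>z\<in>Y0. g (pt c z) = pt d z" using cov A[OF d(1)] by blast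
    then show ?thesis using d by blast
  qed
  then obtain \<tau> where \<tau>: "\<And>c. c \<in> E \<Longrightarrow> \<tau> c \<in> E" "\<And>c z. c \<in> E \<Longrightarrow> z \<in> Y0 \<Longrightarrow> g (pt c z) = pt (\<tau> c) z" by metis
  have cont: "continuous_map (top_of_set (dom i)) T (\<lambda>z. g (par i z))" if "i \<in> Idx" for i
    using continuous_map_compose[OF continuous_map_\<psi>[OF that] gD(5)] by (simp add: o_def)
  have outer: "g (par (An s c) \<zeta>) = par (An s (\<tau> c)) \<zeta>" if "s \<in> K" "c \<in> E" and n1: "norm \<zeta> = 1" for s c \<zeta>
  proof (rule continuous_agree[where i = "An s c"])
    show "continuous_map (top_of_set (dom (An s c))) T (par (An s (\<tau> c)))"
      using continuous_map_\<psi>[of "An s (\<tau> c)"] that \<tau>(1) by (simp add: Idx_intros)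
    fix N assume N: "open N" "\<zeta> \<in> N" "N \<subseteq> dom (An s c)"
    then obtain \<xi> where \<xi>: "\<xi> \<in> N" "norm \<xi> > 1" using near_circle[OF N(1,2) n1] by metis
    then have "J s \<xi> \<in> Y0" using DA_J[OF that(1), of \<xi>] N by auto
    then show "\<exists>w\<in>N. g (par (An s c) w) = par (An s (\<tau> c)) w" using \<xi> \<tau>(2) that by (intro bexI[of _ \<xi>]) auto
  qed (use that cont[of "An s c"] Idx_intros circle_in_DA in \<open>auto simp del: par.simps\<close>)
  have inner: "g (par (An s c) \<zeta>) = par (An s (\<sigma> s (\<tau> (\<sigma> s c)))) \<zeta>" if "s \<in> K" "c \<in> E" and n1: "norm \<zeta> = 1" for s c \<zeta>
  proof (rule continuous_agree[where i = "An s c"])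
    show "continuous_map (top_of_set (dom (An s c))) T (par (An s (\<sigma> s (\<tau> (\<sigma> s c)))))"
      using continuous_map_\<psi>[of "An s (\<sigma> s (\<tau> (\<sigma> s c)))"] that \<tau>(1) \<sigma>_in by (simp add: Idx_intros)
    fix N assume N: "open N" "\<zeta> \<in> N" "N \<subseteq> dom (An s c)"
    then obtain \<xi> where \<xi>: "\<xi> \<in> N" "norm \<xi> < 1" using near_circle[OF N(1,2) n1] by metis
    then have "J s \<xi> \<in> Y0" using DA_J[OF that(1), of \<xi>] N by auto
    then show "\<exists>w\<in>N. g (par (An s c) w) = par (An s (\<sigma> s (\<tau> (\<sigma> s c)))) w"
      using \<xi> \<tau> that \<sigma>_in \<sigma>_\<sigma> by (intro bexI[of _ \<xi>]) auto
  qed (use that cont[of "An s c"] Idx_intros circle_in_DA in \<open>auto simp del: par.simps\<close>)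
  have comm: "\<tau> (\<sigma> s c) = \<sigma> s (\<tau> c)" if "s \<in> K" "c \<in> E" for s c
  proof -
    \<comment> \<open>A parameter on the circle different from \<open>1\<close> and
      \<open>-1\<close>, where \<open>par_An_eq_same\<close> identifies the sheets.\<close>
    have n: "norm \<i> = 1" by simp
    have "par (An s (\<tau> c)) \<i> = par (An s (\<sigma> s (\<tau> (\<sigma> s c)))) \<i>"
      using outer[OF that n] inner[OF that n] by metis
    then have "\<tau> c = \<sigma> s (\<tau> (\<sigma> s c)) \<or> \<i> = 1 \<or> \<i> = -1"
      using par_An_eq_same[OF that(1) _ _ circle_in_DA[OF that(1) n]] that \<tau>(1) \<sigma>_in by metis
    then have "\<tau> c = \<sigma> s (\<tau> (\<sigma> s c))" by (auto simp: complex_eq_iff)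
    then show ?thesis using \<sigma>_\<sigma> \<sigma>_in \<tau>(1) that by metis
  qed
  have pts: "g (pt c z) = pt (\<tau> c) z" if cE: "c \<in> E" and "z \<in> Y" for c z
    using that(2)
  proof (cases rule: Y_cases)
    case (2 s)
    obtain \<zeta> where \<zeta>: "\<zeta> \<in> DA s" "J s \<zeta> = z" "par (An s c) \<zeta> = pt c z" using par_cover[OF 2(1) cE 2(3)] by metis
    then have n: "norm \<zeta> = 1" using J_in_L_iff[OF 2(1)] 2(2) by (auto simp: DA_iff)
    have "par (An s (\<tau> c)) \<zeta> = pt (\<tau> c) z"
    proof (cases "Im \<zeta> \<ge> 0")
      case False
      then have "pt (\<sigma> s c) z = pt c z" using \<zeta> n by simp
      then have "z = m s + l s \<or> z = m s - l s"
        using pt_eq_Ys[OF 2(3,1) \<sigma>_in[OF 2(1) that(1)] that(1)] \<sigma>_neq[OF 2(1) that(1)] by auto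
      then show ?thesis using False n \<zeta>(2) pt_end[OF 2(1) \<tau>(1)[OF that(1)]] by simp
    qed (use n \<zeta> in simp)
    then show ?thesis using outer[OF 2(1) that(1) n] \<zeta> by simp
  qed (use \<tau> that in simp)
  have infs: "g (infp c) = infp (\<tau> c)" if c: "c \<in> E_inf" for c
  proof -
    have cE: "c \<in> E" "\<tau> c \<in> E_inf" using c E_inf \<tau>(1) by auto
    have "g (par (In c) 0) = par (In (\<tau> c)) 0"
    proof (rule continuous_agree[where i = "In c"])
      show "continuous_map (top_of_set (dom (In c))) T (par (In (\<tau> c)))"
        using continuous_map_\<psi>[of "In (\<tau> c)"] cE by (simp add: Idx_intros)
      fix N :: "complex set" assume N: "open N" "0 \<in> N" "N \<subseteq> dom (In c)"
      then have "N \<noteq> {0}" using finite_imp_not_open[of "{0}"] by auto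
      then obtain w where w: "w \<in> N" "w \<noteq> 0" using N(2) by blast
      then have "1 / w \<in> Y0" using In_in_Y0[OF c, of w] N by auto
      then show "\<exists>w\<in>N. g (par (In c) w) = par (In (\<tau> c)) w" using w \<tau>(2) cE by (intro bexI[of _ w]) auto
    qed (use c cE cont[of "In c"] Idx_intros R0_pos in \<open>auto simp del: par.simps\<close>)
    then show ?thesis by simp
  qed
  obtain z0 where z0: "z0 \<in> Y0" using Y0_nonempty by (auto simp: Y0_def)
  then have z0Y: "z0 \<in> Y" using Y0_subset by auto
  have "inj_on \<tau> E"
  proof (rule inj_onI)
    fix c d assume *: "c \<in> E" "d \<in> E" "\<tau> c = \<tau> d"
    then have "g (pt c z0) = g (pt d z0)" using \<tau>(2) z0 by simp
    then have "pt c z0 = pt d z0" using ginj pt_in_X * z0Y by metis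
    then show "c = d" using pt_eq_Y0 z0 * by metis
  qed
  moreover have "\<tau> ` E = E"
  proof
    show "E \<subseteq> \<tau> ` E"
    proof
      fix d assume d: "d \<in> E"
      then obtain p where p: "p \<in> X" "g p = pt d z0"
        using pt_in_X[OF d z0Y] gD(1) unfolding bij_betw_def by (metis imageE)
      show "d \<in> \<tau> ` E"
        using p(1)
      proof (cases rule: X_cases)
        case (1 c z)
        then have "pt d z0 = pt (\<tau> c) z" using pts p by simp
        then have "d = \<tau> c" using pt_eq_Y0[OF z0 d \<tau>(1)[OF 1(1)]] by simp
        then show ?thesis using 1 by blast
      next
        case (2 c)
        then have "infp (\<tau> c) = pt d z0" using infs p by simp
        then show ?thesis using infp_neq_pt[OF \<tau>(1)[OF 2(1)] d] by metis
      qed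
    qed
  qed (use \<tau>(1) in auto)
  ultimately have ct: "commuting \<tau>" unfolding commuting_def bij_betw_def using comm by blast
  moreover have "g = deck \<tau>"
  proof (rule extensionalityI[OF gD(4)])
    fix p assume "p \<in> X"
    then show "g p = deck \<tau> p"
      by (elim X_cases) (use pts infs deck_pt[OF ct] deck_infp[OF ct] in auto)
  qed (simp add: deck_def)
  ultimately show ?thesis using that by blast
qed

text \<open>Separates the combinatorial task from the analytic one: \<open>comm\<close> and
  \<open>surj\<close> identify the permutations commuting with the gluing as the
  \<open>\<theta> a\<close>, and \<open>rigid\<close> says that automorphisms preserve the
  projection over \<open>Y0\<close>.\<close>

theorem Aut_iso:
  fixes A :: "('g, 'h) monoid_scheme"
  assumes A: "group A"
    and comm: "\<And>a. a \<in> carrier A \<Longrightarrow> commuting (\<theta> a)"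
    and hom: "\<And>a b c. \<lbrakk>a \<in> carrier A; b \<in> carrier A; c \<in> E\<rbrakk> \<Longrightarrow> \<theta> (a \<otimes>\<^bsub>A\<^esub> b) c = \<theta> a (\<theta> b c)"
    and inj: "\<And>a b. \<lbrakk>a \<in> carrier A; b \<in> carrier A; \<forall>c\<in>E. \<theta> a c = \<theta> b c\<rbrakk> \<Longrightarrow> a = b"
    and surj: "\<And>\<tau>. commuting \<tau> \<Longrightarrow> \<exists>a\<in>carrier A. \<forall>c\<in>E. \<tau> c = \<theta> a c"
    and rigid: "\<And>g c z. \<lbrakk>g \<in> carrier (Aut surf); c \<in> E; z \<in> Y0\<rbrakk> \<Longrightarrow> \<exists>d\<in>E. g (pt c z) = pt d z"
  shows "Aut surf \<cong> A"
proof -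
  obtain z0 where z0: "z0 \<in> Y0" using Y0_nonempty by (auto simp: Y0_def)
  then have z0Y: "z0 \<in> Y" using Y0_subset by auto
  let ?\<Phi> = "\<lambda>a. deck (\<theta> a)"
  have mem: "?\<Phi> a \<in> carrier (Aut surf)" if "a \<in> carrier A" for a using deck_in_Aut comm that by blast
  have mult: "f \<otimes>\<^bsub>Aut surf\<^esub> g = compose X f g" if "f \<in> carrier (Aut surf)" "g \<in> carrier (Aut surf)" for f g
    using that by (auto simp: Aut_def BijGroup_def)
  have "?\<Phi> \<in> hom A (Aut surf)"
  proof (rule homI)
    fix a b assume ab: "a \<in> carrier A" "b \<in> carrier A"
    then have "a \<otimes>\<^bsub>A\<^esub> b \<in> carrier A" using A by (simp add: group.is_monoid monoid.m_closed)
    then have "deck (\<theta> a) (deck (\<theta> b) p) = deck (\<theta> (a \<otimes>\<^bsub>A\<^esub> b)) p" if "p \<in> X" for p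
      using deck_deck[OF comm[OF ab(1)] comm[OF ab(2)] comm _ that] hom[OF ab] by blast
    then have "deck (\<theta> (a \<otimes>\<^bsub>A\<^esub> b)) = compose X (deck (\<theta> a)) (deck (\<theta> b))"
      by (intro extensionalityI[where A = X]) (auto simp: deck_extensional compose_def)
    then show "?\<Phi> (a \<otimes>\<^bsub>A\<^esub> b) = ?\<Phi> a \<otimes>\<^bsub>Aut surf\<^esub> ?\<Phi> b" using mult mem ab by simp
  qed (use mem in auto)
  moreover have "bij_betw ?\<Phi> (carrier A) (carrier (Aut surf))"
    unfolding bij_betw_def
  proof
    show "inj_on ?\<Phi> (carrier A)"
    proof (rule inj_onI)
      fix a b assume ab: "a \<in> carrier A" "b \<in> carrier A" "deck (\<theta> a) = deck (\<theta> b)"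
      have "\<theta> a c = \<theta> b c" if "c \<in> E" for c
      proof -
        have "pt (\<theta> a c) z0 = pt (\<theta> b c) z0"
          using deck_pt[OF comm[OF ab(1)] that z0Y] deck_pt[OF comm[OF ab(2)] that z0Y] ab(3) by simp
        then show ?thesis using pt_eq_Y0 z0 commutingD(1)[OF comm] ab that by metis
      qed
      then show "a = b" using inj ab by blast
    qed
    show "?\<Phi> ` carrier A = carrier (Aut surf)"
    proof
      show "carrier (Aut surf) \<subseteq> ?\<Phi> ` carrier A"
      proof
        fix g assume g: "g \<in> carrier (Aut surf)"
        obtain \<tau> where \<tau>: "commuting \<tau>" "g = deck \<tau>" using unramified_is_deck[OF g rigid[OF g]] by blast
        obtain a where a: "a \<in> carrier A" "\<forall>c\<in>E. \<tau> c = \<theta> a c" using surj \<tau> by blast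
        have "deck \<tau> = deck (\<theta> a)"
        proof (rule extensionalityI[where A = X])
          fix p assume "p \<in> X"
          then show "deck \<tau> p = deck (\<theta> a) p"
            by (elim X_cases) (use a E_inf deck_pt deck_infp \<tau>(1) comm[OF a(1)] in auto)
        qed (simp_all add: deck_def)
        then show "g \<in> ?\<Phi> ` carrier A" using a \<tau> by blast
      qed
    qed (use mem in auto)
  qed
  ultimately have "?\<Phi> \<in> iso A (Aut surf)" by (simp add: iso_def)
  then have "A \<cong> Aut surf" by (auto simp: is_iso_def)
  then show ?thesis by (rule group.iso_sym[OF A])
qed

end

section \<open>Holomorphic functions and the branch points\<close>

context slit_cover
begin

text \<open>The alternative in \<open>par\<close> depends on \<open>\<zeta>\<close> alone, so one
  decision serves all sheets simultaneously. Expressions that combine several sheets rely on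
  this.\<close>

lemma par_uniform:
  assumes "s \<in> K"
  shows "(\<forall>c\<in>E. par (An s c) \<zeta> = pt c (J s \<zeta>)) \<or> (\<forall>c\<in>E. par (An s c) \<zeta> = pt (\<sigma> s c) (J s \<zeta>))"
  by (cases "norm \<zeta> > 1 \<or> (norm \<zeta> = 1 \<and> Im \<zeta> \<ge> 0)") simp_all

lemma par_cover_all:
  assumes "s \<in> K" "z \<in> Ys s"
  obtains \<zeta> where "\<zeta> \<in> DA s" "J s \<zeta> = z" "\<And>c. c \<in> E \<Longrightarrow> par (An s c) \<zeta> = pt c z"
proof -
  obtain \<zeta> where \<zeta>: "\<zeta> \<noteq> 0" "J s \<zeta> = z" using jk_surj[OF l_nonzero[OF assms(1)]] by metis
  then have DA: "\<zeta> \<in> DA s" using assms by (simp add: DA_iff)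
  from par_uniform[OF assms(1), of \<zeta>] show ?thesis
  proof
    assume "\<forall>c\<in>E. par (An s c) \<zeta> = pt c (J s \<zeta>)"
    then show ?thesis using that[OF DA \<zeta>(2)] \<zeta>(2) by blast
  next
    assume *: "\<forall>c\<in>E. par (An s c) \<zeta> = pt (\<sigma> s c) (J s \<zeta>)"
    have "par (An s c) (1 / \<zeta>) = pt c z" if "c \<in> E" for c
      using par_flip[OF assms(1) that \<zeta>(1)] * \<sigma>_in[OF assms(1) that] \<sigma>_\<sigma>[OF assms(1) that] \<zeta>(2) by simp
    then show ?thesis using that[OF inverse_in_DA[OF DA]] jk_inverse \<zeta>(2) by metis
  qed
qed

lemma endpoint_iff: "\<lbrakk>s \<in> K; \<zeta> \<noteq> 0\<rbrakk> \<Longrightarrow> J s \<zeta> = m s + l s \<or> J s \<zeta> = m s - l s \<longleftrightarrow> \<zeta> = 1 \<or> \<zeta> = -1"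
  using jk_end_iff l_nonzero by blast

lemma open_DA_part:
  assumes "s \<in> K" "open V"
  shows "open {\<zeta> \<in> DA s. J s \<zeta> \<in> V}"
  by (intro open_vimage_Collect holomorphic_on_imp_continuous_on holomorphic_on_jk open_DA assms zero_notin_DA)

text \<open>Away from the branch points a local inverse of \<^term>\<open>J s\<close> gives holomorphy; at the branch
  points \<open>\<Phi>\<close> is continuous because \<^term>\<open>J s\<close> is open, so the singularity is removable.\<close>

lemma holomorphic_descends:
  assumes V: "open V" "V \<subseteq> Y" and \<Phi>: "\<Phi> holomorphic_on V \<inter> Y0"
    and \<Phi>J: "\<And>s. s \<in> K \<Longrightarrow> (\<lambda>\<zeta>. \<Phi> (J s \<zeta>)) holomorphic_on {\<zeta> \<in> DA s. J s \<zeta> \<in> V}"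
  shows "\<Phi> holomorphic_on V"
proof (rule holomorphic_on_locallyI)
  fix z assume z: "z \<in> V"
  then have "z \<in> Y" using V by blast
  then show "\<exists>N \<tau>. open N \<and> z \<in> N \<and> \<tau> holomorphic_on N \<and> (\<forall>w\<in>N \<inter> V. \<Phi> w = \<tau> w)"
  proof (cases rule: Y_cases)
    case 1
    then show ?thesis using z V(1) open_Y0 \<Phi> by (intro exI[of _ "V \<inter> Y0"] exI[of _ \<Phi>]) auto
  next
    case (2 s)
    note s = 2(1)
    let ?D = "{\<zeta> \<in> DA s. J s \<zeta> \<in> V}"
    let ?S = "V \<inter> Ys s"
    let ?B = "{m s + l s, m s - l s}"
    have oS: "open ?S" using V(1) open_Ys by blast
    have cover: "\<exists>\<zeta>. \<zeta> \<in> ?D \<and> J s \<zeta> = w" if "w \<in> ?S" for w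
      using par_cover_all[OF s, of w] that by (metis (mono_tags, lifting) IntE mem_Collect_eq)
    have hol: "\<Phi> holomorphic_on ?S - ?B"
    proof (rule holomorphic_on_locallyI)
      fix w assume w: "w \<in> ?S - ?B"
      then obtain \<zeta> where \<zeta>: "\<zeta> \<in> ?D" "J s \<zeta> = w" using cover by blast
      then have pm: "\<zeta> \<noteq> 1" "\<zeta> \<noteq> -1" using w by auto
      obtain M \<rho> where M: "open M" "J s \<zeta> \<in> M" "\<rho> holomorphic_on M" "\<And>v. v \<in> M \<Longrightarrow> \<rho> v \<in> ?D"
        "\<And>v. v \<in> M \<Longrightarrow> J s (\<rho> v) = v"
        by (rule jk_local_inverse[OF l_nonzero[OF s] open_DA_part[OF s V(1)] _ \<zeta>(1) pm, of "m s"])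
          (use zero_notin_DA in auto)
      have "((\<lambda>\<zeta>. \<Phi> (J s \<zeta>)) \<circ> \<rho>) holomorphic_on M"
        using M(3,4) \<Phi>J[OF s] by (intro holomorphic_on_compose_gen[where t = ?D]) auto
      then show "\<exists>N \<tau>. open N \<and> w \<in> N \<and> \<tau> holomorphic_on N \<and> (\<forall>v\<in>N \<inter> (?S - ?B). \<Phi> v = \<tau> v)"
        using M \<zeta> by (intro exI[of _ M] exI[of _ "(\<lambda>\<zeta>. \<Phi> (J s \<zeta>)) \<circ> \<rho>"]) auto
    qed
    have cont: "continuous_on ?S \<Phi>"
      unfolding continuous_on_open_vimage[OF oS]
    proof (intro allI impI)
      fix B :: "complex set" assume B: "open B"
      have eq: "\<Phi> -` B \<inter> ?S = J s ` {\<zeta> \<in> ?D. \<Phi> (J s \<zeta>) \<in> B}"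
      proof
        show "\<Phi> -` B \<inter> ?S \<subseteq> J s ` {\<zeta> \<in> ?D. \<Phi> (J s \<zeta>) \<in> B}"
        proof
          fix w assume w: "w \<in> \<Phi> -` B \<inter> ?S"
          then obtain \<zeta> where "\<zeta> \<in> ?D" "J s \<zeta> = w" using cover by blast
          then show "w \<in> J s ` {\<zeta> \<in> ?D. \<Phi> (J s \<zeta>) \<in> B}" using w by (intro image_eqI[of _ _ \<zeta>]) auto
        qed
      qed (auto simp: DA_iff)
      have "open {\<zeta> \<in> ?D. \<Phi> (J s \<zeta>) \<in> B}"
        using open_DA_part[OF s V(1)] holomorphic_on_imp_continuous_on[OF \<Phi>J[OF s]] B by (rule open_vimage_Collect)
      then show "open (\<Phi> -` B \<inter> ?S)"
        unfolding eq using zero_notin_DA by (intro open_jk_image l_nonzero s) auto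
    qed
    have "\<Phi> holomorphic_on ?S"
      using no_isolated_singularity[OF cont hol oS] by simp
    then show ?thesis using oS z 2 by (intro exI[of _ ?S] exI[of _ \<Phi>]) auto
  qed
qed

definition holo_over :: "complex set \<Rightarrow> ('a \<Rightarrow> complex) \<Rightarrow> bool" where
  "holo_over V u \<longleftrightarrow> (\<forall>c\<in>E. (\<lambda>z. u (pt c z)) holomorphic_on V \<inter> Y0) \<and>
     (\<forall>s\<in>K. \<forall>c\<in>E. (\<lambda>\<zeta>. u (par (An s c) \<zeta>)) holomorphic_on {\<zeta> \<in> DA s. J s \<zeta> \<in> V})"

lemma holo_overD:
  assumes "holo_over V u" "c \<in> E"
  shows "(\<lambda>z. u (pt c z)) holomorphic_on V \<inter> Y0"
    "s \<in> K \<Longrightarrow> (\<lambda>\<zeta>. u (par (An s c) \<zeta>)) holomorphic_on {\<zeta> \<in> DA s. J s \<zeta> \<in> V}"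
  using assms by (auto simp: holo_over_def simp del: par.simps)

lemma holo_over_subset: "holo_over V u \<Longrightarrow> W \<subseteq> V \<Longrightarrow> holo_over W u"
  unfolding holo_over_def by (blast intro: holomorphic_on_subset)

text \<open>Agreement over \<open>Y0\<close> passes to the slits by continuity in a slit chart, both
  sides of whose circle lie over \<open>Y0\<close>. The common value is then a function on the base,
  to which \<open>holomorphic_descends\<close> applies.\<close>

lemma sheets_agree:
  assumes V: "open V" "V \<subseteq> Y" and u: "holo_over V u"
    and eq: "\<And>c d z. \<lbrakk>c \<in> E; d \<in> E; z \<in> V \<inter> Y0\<rbrakk> \<Longrightarrow> u (pt c z) = u (pt d z)"
  shows "\<lbrakk>c \<in> E; d \<in> E; z \<in> V\<rbrakk> \<Longrightarrow> u (pt c z) = u (pt d z)"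
    and "c \<in> E \<Longrightarrow> (\<lambda>z. u (pt c z)) holomorphic_on V"
proof -
  show all: "u (pt c z) = u (pt d z)" if cd: "c \<in> E" "d \<in> E" and z: "z \<in> V" for c d z
  proof -
    have "z \<in> Y" using z V by blast
    then show ?thesis
    proof (cases rule: Y_cases)
      case (2 s)
      note s = 2(1)
      let ?D = "{\<zeta> \<in> DA s. J s \<zeta> \<in> V}"
      obtain \<zeta> where \<zeta>: "\<zeta> \<in> DA s" "J s \<zeta> = z" "\<And>c. c \<in> E \<Longrightarrow> par (An s c) \<zeta> = pt c z"
        using par_cover_all[OF s 2(3)] by metis
      have n: "norm \<zeta> = 1" using J_in_L_iff[OF s] 2(2) \<zeta> by (auto simp: DA_iff)
      let ?F = "\<lambda>\<zeta>. u (par (An s c) \<zeta>) - u (par (An s d) \<zeta>)"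
      have "continuous_on ?D ?F"
        using holo_overD(2)[OF u _ s] cd by (intro continuous_on_diff holomorphic_on_imp_continuous_on) auto
      then have "open {\<xi> \<in> ?D. ?F \<xi> \<in> - {0}}"
        by (intro open_vimage_Collect open_DA_part s V) auto
      moreover have "?F \<xi> = 0" if "\<xi> \<in> ?D" "norm \<xi> \<noteq> 1" for \<xi>
      proof -
        have "J s \<xi> \<in> V \<inter> Y0" using DA_J[OF s] that by auto
        then show ?thesis
          using par_An_cases[of s c \<xi>] par_An_cases[of s d \<xi>] eq cd \<sigma>_in[OF s]
          by (metis (no_types, lifting) right_minus_eq)
      qed
      ultimately have "\<zeta> \<notin> {\<xi> \<in> ?D. ?F \<xi> \<in> - {0}}"
        using near_circle[of "{\<xi> \<in> ?D. ?F \<xi> \<in> - {0}}" \<zeta>] n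
        by (metis (no_types, lifting) ComplD mem_Collect_eq order_less_irrefl singletonI)
      then show ?thesis using \<zeta> z cd by auto
    next
      case 1
      then show ?thesis using eq[OF cd] z by blast
    qed
  qed
  show "(\<lambda>z. u (pt c z)) holomorphic_on V" if c: "c \<in> E" for c
  proof (rule holomorphic_descends[OF V holo_overD(1)[OF u c]])
    fix s assume s: "s \<in> K"
    show "(\<lambda>\<zeta>. u (pt c (J s \<zeta>))) holomorphic_on {\<zeta> \<in> DA s. J s \<zeta> \<in> V}"
    proof (rule holomorphic_transform[OF holo_overD(2)[OF u c s]])
      fix \<zeta> assume \<zeta>: "\<zeta> \<in> {\<zeta> \<in> DA s. J s \<zeta> \<in> V}"
      show "u (par (An s c) \<zeta>) = u (pt c (J s \<zeta>))"
        using par_An_cases[of s c \<zeta>] all[OF \<sigma>_in[OF s c] c, of "J s \<zeta>"] \<zeta> by auto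
    qed
  qed
qed

section \<open>Biholomorphic self-maps of the covering\<close>

lemma holomorphic_map_cong:
  assumes "holomorphic_map surf surf g" "\<And>p. p \<in> X \<Longrightarrow> g' p = g p"
  shows "holomorphic_map surf surf g'"
proof (rule holomorphic_map_surfI)
  fix i z assume i: "i \<in> Idx" "z \<in> dom i"
  have "g (par i z) \<in> X"
    using assms(1) \<psi>_in_X[OF i] by (auto simp: holomorphic_map_def continuous_map_def)
  then obtain j w where j: "j \<in> Idx" "w \<in> dom j" "g (par i z) = par j w" by (auto simp: X_def)
  then have "lifts_at dom par g i j z" using holomorphic_map_surfD[OF assms(1) i(1) j(1) i(2)] by auto
  then have "lifts_at dom par g' i j z"
    unfolding lifts_at_def using assms(2) \<psi>_in_X[OF i(1)] by (metis subsetD)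
  then show "\<exists>j\<in>Idx. lifts_at dom par g' i j z" using j by blast
qed

text \<open>Membership in the carrier of \<open>Aut surf\<close> without extensionality. The inverse
  given by \<open>inv_into\<close> need not be extensional, and the arguments below apply to both
  \<open>g\<close> and its inverse.\<close>

definition biholo :: "('a \<Rightarrow> 'a) \<Rightarrow> bool" where
  "biholo g \<longleftrightarrow> bij_betw g X X \<and> holomorphic_map surf surf g \<and> holomorphic_map surf surf (inv_into X g)"

lemma Aut_biholo: "g \<in> carrier (Aut surf) \<Longrightarrow> biholo g"
  using Aut_carrierD by (simp add: biholo_def)

lemma biholo_in_X: "biholo g \<Longrightarrow> p \<in> X \<Longrightarrow> g p \<in> X"
  by (auto simp: biholo_def bij_betw_def)

lemma biholo_inj: "biholo g \<Longrightarrow> p \<in> X \<Longrightarrow> q \<in> X \<Longrightarrow> g p = g q \<Longrightarrow> p = q"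
  by (auto simp: biholo_def bij_betw_def inj_on_def)

text \<open>The double inverse is known to agree with \<open>g\<close> only on \<open>X\<close>, so
  its holomorphy goes through \<open>holomorphic_map_cong\<close>.\<close>

lemma biholo_inv:
  assumes "biholo g"
  shows "biholo (inv_into X g)" "\<And>p. p \<in> X \<Longrightarrow> inv_into X g (g p) = p" "\<And>p. p \<in> X \<Longrightarrow> g (inv_into X g p) = p"
proof -
  have b: "bij_betw g X X" using assms by (simp add: biholo_def)
  show 1: "\<And>p. p \<in> X \<Longrightarrow> inv_into X g (g p) = p" "\<And>p. p \<in> X \<Longrightarrow> g (inv_into X g p) = p"
    using b by (auto simp: bij_betw_inv_into_left bij_betw_inv_into_right)
  have b': "bij_betw (inv_into X g) X X" using bij_betw_inv_into[OF b] .
  have "inv_into X (inv_into X g) p = g p" if "p \<in> X" for p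
    using inv_into_f_f[of "inv_into X g" X "g p"] b' 1 that biholo_in_X[OF assms] by (auto simp: bij_betw_def)
  then have "holomorphic_map surf surf (inv_into X (inv_into X g))"
    using holomorphic_map_cong assms by (auto simp: biholo_def)
  then show "biholo (inv_into X g)" using b' assms by (simp add: biholo_def)
qed

text \<open>Injectivity of the lift is the part used later: it makes derivatives nonzero, and hence
  poles simple.\<close>

lemma biholo_lift:
  assumes "biholo g" "i \<in> Idx" "z \<in> dom i" "j \<in> Idx" "w \<in> dom j" "g (par i z) = par j w"
  obtains N \<tau> where "open N" "z \<in> N" "N \<subseteq> dom i" "\<tau> holomorphic_on N" "\<And>v. v \<in> N \<Longrightarrow> \<tau> v \<in> dom j"
    "\<And>v. v \<in> N \<Longrightarrow> g (par i v) = par j (\<tau> v)" "\<tau> z = w" "inj_on \<tau> N"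
proof -
  have l: "lifts_at dom par g i j z"
    using holomorphic_map_surfD[of g i j z] assms by (auto simp: biholo_def)
  obtain N \<tau> where N: "open N" "z \<in> N" "N \<subseteq> dom i" "\<tau> holomorphic_on N" "\<And>v. v \<in> N \<Longrightarrow> \<tau> v \<in> dom j"
    "\<And>v. v \<in> N \<Longrightarrow> g (par i v) = par j (\<tau> v)" "\<tau> z = w"
    using lifts_at_value[OF l assms(4-6)] by blast
  have "inj_on \<tau> N"
  proof (rule inj_onI)
    fix v v' assume v: "v \<in> N" "v' \<in> N" "\<tau> v = \<tau> v'"
    then have "g (par i v) = g (par i v')" using N by simp
    then have "par i v = par i v'"
      using biholo_inj[OF assms(1)] \<psi>_in_X[OF assms(2)] N(3) v by (meson subsetD)
    then show "v = v'" using inj_par[OF assms(2)] N(3) v by (meson inj_onD subsetD)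
  qed
  then show ?thesis using that N by blast
qed

text \<open>A chart without a point at infinity; there the projection is the identity or
  \<open>J s\<close>, so it is holomorphic.\<close>

lemma finite_chart:
  assumes "c \<in> E" "z \<in> Y"
  obtains j w where "j \<in> Idx" "w \<in> dom j" "par j w = pt c z" "(\<lambda>v. proj (par j v)) holomorphic_on dom j"
    "\<And>v. v \<in> dom j \<Longrightarrow> par j v \<in> tube UNIV"
  using assms(2)
proof (cases rule: Y_cases)
  case 1
  show ?thesis
  proof (rule that[of "Sh c" z])
    show "(\<lambda>v. proj (par (Sh c) v)) holomorphic_on dom (Sh c)" using assms by (simp add: holomorphic_on_ident)
  qed (use 1 assms Y0_subset in \<open>auto simp: Idx_intros pt_in_tube\<close>)
next
  case (2 s)
  obtain \<zeta> where \<zeta>: "\<zeta> \<in> DA s" "par (An s c) \<zeta> = pt c z" using par_cover[OF 2(1) assms(1) 2(3)] by metis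
  show ?thesis
  proof (rule that[of "An s c" \<zeta>])
    show "(\<lambda>v. proj (par (An s c) v)) holomorphic_on dom (An s c)"
      unfolding proj_par_An[OF 2(1) assms(1)] using zero_notin_DA by (auto intro: holomorphic_on_jk)
  qed (use 2 \<zeta> assms par_An_in_tube in \<open>auto simp: Idx_intros simp del: par.simps\<close>)
qed

lemma tube_UNIV_cases:
  assumes "p \<in> tube V"
  obtains c z where "c \<in> E" "z \<in> Y" "z \<in> V" "p = pt c z"
  using assms by (auto simp: tube_def)

lemma proj_biholo_holomorphic:
  assumes g: "biholo g" and i: "i \<in> Idx" and S: "S \<subseteq> dom i" "\<And>z. z \<in> S \<Longrightarrow> g (par i z) \<in> tube UNIV"
  shows "(\<lambda>z. proj (g (par i z))) holomorphic_on S"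
proof (rule holomorphic_on_locallyI)
  fix z assume z: "z \<in> S"
  then obtain d w where d: "d \<in> E" "w \<in> Y" "g (par i z) = pt d w" using S(2) tube_UNIV_cases by metis
  obtain j v where j: "j \<in> Idx" "v \<in> dom j" "par j v = pt d w" "(\<lambda>v. proj (par j v)) holomorphic_on dom j"
    using finite_chart[OF d(1,2)] by metis
  have zi: "z \<in> dom i" using z S by blast
  obtain N \<tau> where N: "open N" "z \<in> N" "N \<subseteq> dom i" "\<tau> holomorphic_on N" "\<And>v. v \<in> N \<Longrightarrow> \<tau> v \<in> dom j"
    "\<And>v. v \<in> N \<Longrightarrow> g (par i v) = par j (\<tau> v)"
    using biholo_lift[OF g i zi j(1,2)] d j by metis
  have "((\<lambda>v. proj (par j v)) \<circ> \<tau>) holomorphic_on N"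
    using N(4,5) j(4) by (intro holomorphic_on_compose_gen[where t = "dom j"]) auto
  then show "\<exists>N \<tau>. open N \<and> z \<in> N \<and> \<tau> holomorphic_on N \<and> (\<forall>w\<in>N \<inter> S. proj (g (par i w)) = \<tau> w)"
    using N by (intro exI[of _ N] exI[of _ "(\<lambda>v. proj (par j v)) \<circ> \<tau>"]) auto
qed

lemma holo_over_biholo:
  assumes g: "biholo g" and V: "V \<subseteq> Y" "\<And>c z. \<lbrakk>c \<in> E; z \<in> V\<rbrakk> \<Longrightarrow> g (pt c z) \<in> tube UNIV"
  shows "holo_over V (\<lambda>p. proj (g p))"
  unfolding holo_over_def
proof (intro conjI ballI)
  fix c assume c: "c \<in> E"
  show "(\<lambda>z. proj (g (pt c z))) holomorphic_on V \<inter> Y0"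
    using proj_biholo_holomorphic[OF g, of "Sh c" "V \<inter> Y0"] V c by (simp add: Idx_intros)
  fix s assume s: "s \<in> K"
  have "g (par (An s c) z) \<in> tube UNIV" if "J s z \<in> V" for z
    using par_An_cases[of s c z] V(2) c \<sigma>_in[OF s c] that by metis
  then show "(\<lambda>\<zeta>. proj (g (par (An s c) \<zeta>))) holomorphic_on {\<zeta> \<in> DA s. J s \<zeta> \<in> V}"
    using s c by (intro proj_biholo_holomorphic[OF g]) (auto simp: Idx_intros simp del: par.simps)
qed

text \<open>Near a point that is not a branch point, \<^const>\<open>proj\<close> is injective (apart from its junk value
  at a point at infinity).\<close>

lemma unbranched_chart:
  assumes "p \<in> X" "\<And>c z s. \<lbrakk>c \<in> E; s \<in> K; p = pt c z\<rbrakk> \<Longrightarrow> z \<noteq> m s + l s \<and> z \<noteq> m s - l s"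
  obtains j w N where "j \<in> Idx" "w \<in> dom j" "par j w = p" "open N" "w \<in> N"
    "inj_on (\<lambda>v. proj (par j v)) (N \<inter> dom j - {w})"
  using assms(1)
proof (cases rule: X_cases)
  case (1 c z)
  show ?thesis
    using 1(2)
  proof (cases rule: Y_cases)
    case a: 1
    show ?thesis
      by (rule that[of "Sh c" z UNIV]) (use a 1 in \<open>auto simp: Idx_intros inj_on_def\<close>)
  next
    case b: (2 s)
    obtain \<zeta> where \<zeta>: "\<zeta> \<in> DA s" "J s \<zeta> = z" "par (An s c) \<zeta> = pt c z"
      using par_cover[OF b(1) 1(1) b(3)] by metis
    then have nz: "\<zeta> \<noteq> 0" by (auto simp: DA_iff)
    have "\<not> (\<zeta> = 1 \<or> \<zeta> = -1)" using endpoint_iff[OF b(1) nz] assms(2)[OF 1(1) b(1) 1(3)] \<zeta>(2) by blast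
    then have "\<zeta>\<^sup>2 \<noteq> 1" by (auto simp: power2_eq_1_iff)
    then have ne: "\<zeta> \<noteq> 1 / \<zeta>" using nz by (auto simp: power2_eq_square field_simps)
    then obtain A B where AB: "open A" "open B" "\<zeta> \<in> A" "1 / \<zeta> \<in> B" "A \<inter> B = {}" using hausdorff by metis
    \<comment> \<open>Disjointness of \<open>A\<close> and \<open>B\<close> prevents
      \<open>\<xi>\<close> and \<open>1 / \<xi>\<close> from both lying in this neighbourhood, so
      \<open>J s\<close> is injective on it.\<close>
    let ?N = "A \<inter> {\<xi> \<in> - {0}. 1 / \<xi> \<in> B}"
    have oN: "open ?N"
      using AB by (intro open_Int open_vimage_Collect) (auto intro!: continuous_intros)
    have inj: "\<xi> = \<xi>'" if "\<xi> \<in> ?N" "\<xi>' \<in> ?N" "J s \<xi> = J s \<xi>'" for \<xi> \<xi>'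
    proof -
      have "\<xi>' = \<xi> \<or> \<xi>' = 1 / \<xi>" using jk_eq_iff[OF l_nonzero[OF b(1)], of \<xi> \<xi>' "m s"] that by auto
      then show ?thesis using that AB(5) by auto
    qed
    show ?thesis
    proof (rule that[of "An s c" \<zeta> ?N])
      show "inj_on (\<lambda>v. proj (par (An s c) v)) (?N \<inter> dom (An s c) - {\<zeta>})"
        unfolding proj_par_An[OF b(1) 1(1)] by (rule inj_onI) (rule inj; blast)
      show "open ?N" by (rule oN)
      show "An s c \<in> Idx" using b 1 Idx_intros by blast
      show "\<zeta> \<in> dom (An s c)" "par (An s c) \<zeta> = p" using \<zeta> 1(3) by auto
      show "\<zeta> \<in> ?N" using AB nz by blast
    qed
  qed
next
  case (2 c)
  show ?thesis
    by (rule that[of "In c" 0 UNIV]) (use 2 R0_pos in \<open>auto simp: Idx_intros inj_on_def\<close>)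
qed

text \<open>The two points \<open>\<zeta>\<close> and \<open>1 / \<zeta>\<close> near a branch point have the same projection, hence so do their
  images under an automorphism that descends to the base; so the image point is again branched.\<close>

lemma branch_point_image:
  assumes g: "biholo g" and s: "s \<in> K" and c: "c \<in> E" and b: "b = m s + l s \<or> b = m s - l s"
    and B: "open B" "b \<in> B"
    and H: "\<And>d z. \<lbrakk>d \<in> E; z \<in> B; z \<noteq> b; z \<in> Y\<rbrakk> \<Longrightarrow> proj (g (pt d z)) = H z"
  obtains d t w where "d \<in> E" "t \<in> K" "w = m t + l t \<or> w = m t - l t" "g (pt c b) = pt d w"
proof (rule ccontr)
  assume no: "\<not> thesis"
  note out = that
  have nb: "z \<noteq> m t + l t \<and> z \<noteq> m t - l t" if "d \<in> E" "t \<in> K" "g (pt c b) = pt d z" for d z t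
    using out[OF that(1,2) _ that(3)] no by blast
  have bL: "b \<in> L s" using b ends_in_L by blast
  then have bY: "b \<in> Y" "b \<in> Ys s" using L_subset_Ys[OF s] Y0_subset by auto
  obtain \<zeta> where \<zeta>: "\<zeta> \<in> DA s" "J s \<zeta> = b" "par (An s c) \<zeta> = pt c b" using par_cover[OF s c bY(2)] by metis
  have \<zeta>1: "\<zeta> = 1 \<or> \<zeta> = -1" using endpoint_iff[OF s, of \<zeta>] \<zeta> b by (auto simp: DA_iff)
  have i: "An s c \<in> Idx" using s c by (simp add: Idx_intros)
  have pX: "g (pt c b) \<in> X" using biholo_in_X[OF g] pt_in_X[OF c bY(1)] .
  obtain j w N' where j: "j \<in> Idx" "w \<in> dom j" "par j w = g (pt c b)" "open N'" "w \<in> N'"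
    "inj_on (\<lambda>v. proj (par j v)) (N' \<inter> dom j - {w})"
    by (rule unbranched_chart[OF pX nb])
  have z: "\<zeta> \<in> dom (An s c)" using \<zeta> by simp
  obtain N \<tau> where N: "open N" "\<zeta> \<in> N" "N \<subseteq> dom (An s c)" "\<tau> holomorphic_on N" "\<And>v. v \<in> N \<Longrightarrow> \<tau> v \<in> dom j"
    "\<And>v. v \<in> N \<Longrightarrow> g (par (An s c) v) = par j (\<tau> v)" "\<tau> \<zeta> = w" "inj_on \<tau> N"
    using biholo_lift[OF g i z j(1,2)] \<zeta>(3) j(3) by metis
  let ?M = "{v \<in> N. \<tau> v \<in> N'} \<inter> {v \<in> DA s. J s v \<in> B}"
  have oM: "open ?M"
    using open_vimage_Collect[OF N(1) holomorphic_on_imp_continuous_on[OF N(4)] j(4)] open_DA_part[OF s B(1)]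
    by (rule open_Int)
  \<comment> \<open>Made symmetric under inversion, so that \<open>\<xi>\<close> and
    \<open>1 / \<xi>\<close> are both available.\<close>
  let ?M' = "?M \<inter> {v \<in> - {0}. 1 / v \<in> ?M}"
  have oM': "open ?M'"
    by (rule open_Int[OF oM open_vimage_Collect[OF _ _ oM]]) (auto intro!: continuous_intros)
  have \<zeta>inv: "1 / \<zeta> = \<zeta>" using \<zeta>1 by auto
  have "\<zeta> \<in> ?M" using N j \<zeta> B by auto
  then have "\<zeta> \<in> ?M'" using \<zeta>inv zero_notin_DA by auto
  moreover have "norm \<zeta> = 1" using \<zeta>1 by auto
  ultimately obtain \<xi> where \<xi>: "\<xi> \<in> ?M'" "norm \<xi> > 1" using near_circle[OF oM', of \<zeta>] by blast
  then have nz: "\<xi> \<noteq> 0" and \<xi>': "\<xi> \<in> ?M" "1 / \<xi> \<in> ?M" by auto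
  have "norm (1 / \<xi>) < 1" using \<xi>(2) by (simp add: norm_divide divide_less_eq)
  then have ne: "1 / \<xi> \<noteq> \<xi>" "\<xi> \<noteq> \<zeta>" "1 / \<xi> \<noteq> \<zeta>" using \<xi>(2) \<open>norm \<zeta> = 1\<close> by auto
  have val: "proj (par j (\<tau> v)) = H (J s v)" if "v \<in> ?M" "v \<noteq> \<zeta>" for v
  proof -
    have v: "v \<in> N" "v \<in> DA s" "J s v \<in> B" using that by auto
    have "v \<noteq> 0" "J s v \<in> Y" using v Y0_subset by (auto simp: DA_iff)
    have "J s v \<noteq> b" using that(2) jk_eq_iff[OF l_nonzero[OF s] _ \<open>v \<noteq> 0\<close>, of \<zeta> "m s"] \<zeta> \<zeta>inv
      by (auto simp: DA_iff)
    then have "proj (g (par (An s c) v)) = H (J s v)"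
      using par_An_cases[of s c v] H[OF c] H[OF \<sigma>_in[OF s c]] v \<open>J s v \<in> Y\<close> by metis
    then show ?thesis using N(6)[OF v(1)] by simp
  qed
  have tw: "\<tau> v \<in> N' \<inter> dom j - {w}" if "v \<in> ?M" "v \<noteq> \<zeta>" for v
  proof -
    have v: "v \<in> N" "\<tau> v \<in> N'" using that(1) by auto
    have "\<tau> v \<noteq> w" using inj_onD[OF N(8) _ v(1) N(2)] N(7) that(2) by auto
    then show ?thesis using v N(5) by auto
  qed
  have "proj (par j (\<tau> \<xi>)) = proj (par j (\<tau> (1 / \<xi>)))"
    using val[OF \<xi>'(1) ne(2)] val[OF \<xi>'(2) ne(3)] jk_inverse by simp
  then have "\<tau> \<xi> = \<tau> (1 / \<xi>)"
    using inj_onD[OF j(6) _ tw[OF \<xi>'(1) ne(2)] tw[OF \<xi>'(2) ne(3)]] by blast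
  then show False using inj_onD[OF N(8), of \<xi> "1 / \<xi>"] \<xi>' ne(1) by auto
qed

end

section \<open>Rigidity over the punctured disc\<close>

text \<open>Distances of the ends of slits from their punctures. Ratios of consecutive terms tend to
  0, so two sequences of such distances with a positive limit ratio must eventually coincide. The
  shift by 2 gives \<open>eta n \<le> 1 / 2\<close>, which keeps slits at different punctures
  apart.\<close>

definition eta :: "nat \<Rightarrow> real" where "eta n = 1 / fact (n + 2)"

lemma eta_pos: "eta n > 0" by (simp add: eta_def)

lemma eta_less: "n < k \<Longrightarrow> eta k \<le> eta n / (real n + 3)"
proof -
  assume "n < k"
  then have "(fact (n + 3) :: real) \<le> fact (k + 2)" by (intro fact_mono) auto
  moreover have "fact (n + 3) = (real n + 3) * fact (n + 2)"
    using fact_Suc[of "n + 2", where ?'a = real] by (simp add: numeral_3_eq_3)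
  ultimately have "(real n + 3) * fact (n + 2) \<le> (fact (k + 2) :: real)" by simp
  then show ?thesis unfolding eta_def by (simp add: frac_le mult.commute)
qed

lemma eta_antimono: "n < k \<Longrightarrow> eta k < eta n"
proof -
  assume "n < k"
  then have "eta k \<le> eta n / (real n + 3)" by (rule eta_less)
  also have "\<dots> < eta n" using eta_pos[of n] by (simp add: divide_less_eq)
  finally show ?thesis .
qed

lemma eta_le_half: "eta n \<le> 1 / 2"
proof -
  have "eta 0 = 1 / 2" by (simp add: eta_def)
  then show ?thesis using eta_antimono[of 0 n] by (cases "n = 0") auto
qed

lemma eta_less_half: "0 < n \<Longrightarrow> eta n < 1 / 2"
  using eta_antimono[of 0 n] eta_le_half[of 0] by simp

lemma eta_tendsto_0: "eta \<longlonglongrightarrow> 0"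
proof (rule tendsto_sandwich[of "\<lambda>_. 0" _ _ "\<lambda>n. inverse (real (Suc n))"])
  have "eta n \<le> inverse (real (Suc n))" for n
  proof -
    have "real (n + 2) \<le> real (fact (n + 2))" using fact_ge_self[of "n + 2"] of_nat_le_iff by blast
    then have "real (n + 2) \<le> fact (n + 2)" by (simp only: of_nat_fact)
    then have "real (Suc n) \<le> fact (n + 2)" by (simp del: fact_Suc)
    then show ?thesis unfolding eta_def inverse_eq_divide by (intro frac_le) auto
  qed
  then show "\<forall>\<^sub>F n in sequentially. eta n \<le> inverse (real (Suc n))" by simp
qed (simp_all add: less_imp_le[OF eta_pos] LIMSEQ_inverse_real_of_nat del: of_nat_Suc)

lemma nat_eq_if_close: "\<bar>real a - real b\<bar> < 1 \<Longrightarrow> a = b"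
  by linarith

text \<open>Only finitely many arguments of an injective function have values below a given
  bound.\<close>

lemma inj_nat_filterlim:
  assumes "inj (f :: nat \<Rightarrow> nat)"
  shows "filterlim f sequentially sequentially"
  unfolding filterlim_at_top
proof
  fix n
  have "finite (f -` {..<n})" by (intro finite_vimageI assms) simp
  moreover have "f -` {..<n} = {k. \<not> n \<le> f k}" by auto
  ultimately show "eventually (\<lambda>k. n \<le> f k) sequentially"
    by (simp add: cofinite_eq_sequentially[symmetric] eventually_cofinite)
qed

text \<open>Slit \<open>s\<close> lies to the right of the puncture \<open>s mod N\<close>, which
  also determines its type, so the slits of each type accumulate at their own puncture. All
  punctures share the one sequence \<open>eta\<close>, each index being used once; hence the
  distance of an end from its puncture identifies it.\<close>

locale punctured_cover = slit_cover E UNIV \<sigma> m l Y "{}" R0 pt infp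
  for E :: "'e set" and \<sigma> m l Y R0 and pt :: "'e \<Rightarrow> complex \<Rightarrow> 'a" and infp +
  fixes N :: nat
  assumes N_pos: "N > 0"
    and Y_eq: "Y = ball 0 (real N + 1) - of_nat ` {..<N}"
    and upper_end: "m s + l s = of_real (real (s mod N) + eta (2 * s))"
    and lower_end: "m s - l s = of_real (real (s mod N) + eta (2 * s + 1))"
    and L_eq: "slit (m s) (l s) = of_real ` {real (s mod N) + eta (2 * s + 1)..real (s mod N) + eta (2 * s)}"
    and \<sigma>_periodic: "\<sigma> s = \<sigma> (s mod N)"
begin

definition V :: "nat \<Rightarrow> complex set" where "V t = ball (of_nat t) (1 / 2) - {of_nat t}"

lemma V_subset: "t < N \<Longrightarrow> V t \<subseteq> Y"
proof
  fix z assume t: "t < N" and "z \<in> V t"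
  then have z: "norm (of_nat t - z) < 1 / 2" "z \<noteq> of_nat t" by (auto simp: V_def dist_norm)
  have "norm z \<le> norm (of_nat t :: complex) + norm (of_nat t - z)"
    by (metis norm_minus_commute norm_triangle_sub)
  then have "norm z < real N + 1" using z t by simp
  moreover have "z \<noteq> of_nat k" for k
  proof
    assume zk: "z = of_nat k"
    have "norm (of_nat t - of_nat k :: complex) = \<bar>real t - real k\<bar>"
      by (metis norm_of_real of_real_diff of_real_of_nat_eq)
    then have "\<bar>real t - real k\<bar> < 1" using z zk by simp
    then show False using nat_eq_if_close z zk by blast
  qed
  ultimately show "z \<in> Y" by (auto simp: Y_eq)
qed

lemma open_V: "open (V t)" by (auto simp: V_def)

text \<open>A slit reaches at most 1/2 to the right of its puncture, so it stays outside the open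
  disc of radius 1/2 about any other. The extreme case is \<open>eta 0 = 1 / 2\<close>.\<close>

lemma L_V:
  assumes "z \<in> L s" "z \<in> V t"
  shows "s mod N = t"
proof -
  obtain x where x: "z = of_real x" "real (s mod N) + eta (2 * s + 1) \<le> x" "x \<le> real (s mod N) + eta (2 * s)"
    using assms(1) by (auto simp: L_eq)
  have "dist (of_nat t) z = \<bar>real t - x\<bar>"
    unfolding x(1) dist_norm by (metis norm_of_real of_real_diff of_real_of_nat_eq)
  then have "\<bar>real t - x\<bar> < 1 / 2" using assms(2) by (simp add: V_def)
  then show ?thesis using x(2,3) eta_pos[of "2 * s + 1"] eta_le_half[of "2 * s"] by linarith
qed

text \<open>Crossing a slit of type \<open>t\<close> exchanges \<open>c\<close> and
  \<open>\<sigma> t c\<close>, so their difference changes only its sign and its square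
  \<open>\<Phi>\<close> is single-valued on \<open>V t\<close>. Being bounded, \<open>\<Phi>\<close>
  extends over the puncture, where its zeros accumulate. The resulting equality spreads over the
  connected \<open>Y0\<close>, and to all sheets by \<open>\<sigma>_transitive\<close>.\<close>

lemma bounded_sheets_agree:
  assumes u: "holo_over Y u" and M: "\<And>c z. \<lbrakk>c \<in> E; z \<in> Y\<rbrakk> \<Longrightarrow> norm (u (pt c z)) \<le> M"
  shows "\<lbrakk>c \<in> E; d \<in> E; z \<in> Y0\<rbrakk> \<Longrightarrow> u (pt c z) = u (pt d z)"
proof -
  have sw: "u (pt c z) = u (pt (\<sigma> t c) z)" if t: "t < N" and c: "c \<in> E" and z: "z \<in> Y0" for t c z
  proof -
    have d: "\<sigma> t c \<in> E" using \<sigma>_in c by blast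
    define \<Phi> where "\<Phi> z = (u (pt c z) - u (pt (\<sigma> t c) z))\<^sup>2" for z
    have uV: "holo_over (V t) u" using holo_over_subset[OF u V_subset[OF t]] .
    have \<Phi>0: "\<Phi> holomorphic_on V t \<inter> Y0"
      unfolding \<Phi>_def using holo_overD(1)[OF uV] c d by (intro holomorphic_intros) auto
    have hol: "\<Phi> holomorphic_on V t"
    proof (rule holomorphic_descends[OF open_V V_subset[OF t] \<Phi>0])
      fix s
      let ?D = "{\<zeta> \<in> DA s. J s \<zeta> \<in> V t}"
      show "(\<lambda>\<zeta>. \<Phi> (J s \<zeta>)) holomorphic_on ?D"
      proof (cases "s mod N = t")
        case True
        then have \<sigma>s: "\<sigma> s = \<sigma> t" using \<sigma>_periodic by metis
        have "(\<lambda>\<zeta>. (u (par (An s c) \<zeta>) - u (par (An s (\<sigma> t c)) \<zeta>))\<^sup>2) holomorphic_on ?D"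
          using holo_overD(2)[OF uV _ UNIV_I] c d by (intro holomorphic_intros) auto
        then show ?thesis
        proof (rule holomorphic_transform)
          fix \<zeta> assume "\<zeta> \<in> ?D"
          have e: "\<sigma> s (\<sigma> t c) = c" using \<sigma>_\<sigma>[OF UNIV_I c] \<sigma>s by metis
          from par_uniform[OF UNIV_I, of s \<zeta>]
          show "(u (par (An s c) \<zeta>) - u (par (An s (\<sigma> t c)) \<zeta>))\<^sup>2 = \<Phi> (J s \<zeta>)"
            using c d e \<sigma>s by (elim disjE) (simp_all add: \<Phi>_def power2_commute del: par.simps)
        qed
      next
        case False
        have "J s \<zeta> \<in> V t \<inter> Y0" if "\<zeta> \<in> ?D" for \<zeta>
          using that L_V[of "J s \<zeta>" s t] False Ys_eq[OF UNIV_I] by (auto simp: DA_iff)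
        moreover have "J s holomorphic_on ?D" using zero_notin_DA by (intro holomorphic_on_jk) auto
        ultimately have "(\<Phi> \<circ> J s) holomorphic_on ?D"
          using \<Phi>0 by (intro holomorphic_on_compose_gen[where t = "V t \<inter> Y0"]) auto
        then show ?thesis by (simp add: o_def)
      qed
    qed
    have bd: "norm (\<Phi> z) \<le> (2 * M)\<^sup>2" if "z \<in> V t" for z
    proof -
      have "norm (u (pt c z) - u (pt (\<sigma> t c) z)) \<le> 2 * M"
        using norm_triangle_ineq4[of "u (pt c z)" "u (pt (\<sigma> t c) z)"] M[of c z] M[of "\<sigma> t c" z] c d that V_subset[OF t]
        by force
      then have "(norm (u (pt c z) - u (pt (\<sigma> t c) z)))\<^sup>2 \<le> (2 * M)\<^sup>2" by (rule power_mono) simp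
      then show ?thesis by (simp only: \<Phi>_def norm_power)
    qed
    have "of_nat t \<in> interior (ball (of_nat t :: complex) (1 / 2))" by simp
    moreover have "eventually (\<lambda>z. norm (\<Phi> z) \<le> (2 * M)\<^sup>2) (at (of_nat t))"
      unfolding eventually_at using bd by (intro exI[of _ "1 / 2"]) (auto simp: V_def dist_commute)
    ultimately obtain F where F: "F holomorphic_on ball (of_nat t) (1 / 2)" "\<And>z. z \<in> V t \<Longrightarrow> F z = \<Phi> z"
      using holomorphic_on_extend_bounded[of \<Phi> "ball (of_nat t) (1 / 2)" "of_nat t"] hol
      unfolding V_def[symmetric] by blast
    \<comment> \<open>Upper ends of the slits of type \<open>t\<close>. Starting at
      \<open>Suc k\<close> makes the index of \<open>eta\<close> positive, so the distance is
      strictly below 1/2 and \<open>b k\<close> lies in \<open>V t\<close>.\<close>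
    define b where "b k = (of_real (real t + eta (2 * (t + Suc k * N))) :: complex)" for k
    have bV: "b k \<in> V t" for k
    proof -
      have "2 * (t + Suc k * N) > 0" using N_pos by simp
      then have "eta (2 * (t + Suc k * N)) < 1 / 2" "eta (2 * (t + Suc k * N)) > 0"
        using eta_less_half eta_pos by blast+
      moreover have "b k - of_nat t = of_real (eta (2 * (t + Suc k * N)))" by (simp add: b_def)
      moreover have "dist (of_nat t) (b k) = norm (b k - of_nat t)" by (simp add: dist_norm norm_minus_commute)
      ultimately show ?thesis by (auto simp: V_def)
    qed
    have b0: "F (b k) = 0" for k
    proof -
      let ?s = "t + Suc k * N"
      have s: "?s mod N = t" using t by (simp only: mod_mult_self1 mod_less)
      have "b k = m ?s + l ?s" unfolding upper_end s b_def by simp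
      then have "pt (\<sigma> ?s c) (b k) = pt c (b k)" using pt_end[OF UNIV_I c] by metis
      then have "\<Phi> (b k) = 0" using \<sigma>_periodic[of ?s] s by (simp add: \<Phi>_def)
      then show ?thesis using F(2) bV by simp
    qed
    have bt: "b \<longlonglongrightarrow> of_nat t"
    proof -
      have "filterlim (\<lambda>k. 2 * (t + Suc k * N)) sequentially sequentially"
        using N_pos by (intro filterlim_subseq) (auto simp: strict_mono_Suc_iff)
      from filterlim_compose[OF eta_tendsto_0 this]
      have "(\<lambda>k. real t + eta (2 * (t + Suc k * N))) \<longlonglongrightarrow> real t + 0" by (intro tendsto_intros)
      then have "b \<longlonglongrightarrow> of_real (real t + 0)" unfolding b_def by (intro tendsto_of_real)
      then show ?thesis by simp
    qed
    have lim: "of_nat t islimpt range b"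
      unfolding islimpt_sequential using bt bV by (intro exI[of _ b]) (auto simp: V_def)
    have "range b \<subseteq> ball (of_nat t) (1 / 2)" using bV by (auto simp: V_def)
    then have F0: "F w = 0" if "w \<in> ball (of_nat t) (1 / 2)" for w
      using analytic_continuation[OF F(1) open_ball connected_ball _ _ lim _ that] b0 by auto
    have eqV: "u (pt c w) = u (pt (\<sigma> t c) w)" if "w \<in> V t \<inter> Y0" for w
      using F0[of w] F(2)[of w] that by (auto simp: \<Phi>_def V_def)
    have hol0: "(\<lambda>z. u (pt c z)) holomorphic_on Y0" "(\<lambda>z. u (pt (\<sigma> t c) z)) holomorphic_on Y0"
      using holo_overD(1)[OF u] c d Y0_subset(1) by (simp_all add: Int_absorb1)
    have "V t \<inter> Y0 \<noteq> {}"
    proof -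
      \<comment> \<open>To the left of the puncture, where no slit of type \<open>t\<close>
        lies.\<close>
      let ?w = "of_real (real t - 1 / 4) :: complex"
      have "?w - of_nat t = of_real (- 1 / 4)" by simp
      then have "dist (of_nat t) ?w = 1 / 4" by (metis abs_divide abs_minus_cancel abs_numeral abs_one dist_commute dist_norm norm_of_real)
      then have w: "?w \<in> V t" by (auto simp: V_def)
      moreover have "?w \<notin> L s" for s
      proof
        assume *: "?w \<in> L s"
        then have "s mod N = t" using L_V w by blast
        then show False using * eta_pos[of "2 * s + 1"] by (auto simp: L_eq simp del: of_real_diff)
      qed
      ultimately show ?thesis using V_subset[OF t] by (auto simp: Y0_def)
    qed
    then show ?thesis
      using analytic_continuation_open[of "V t \<inter> Y0" Y0, OF _ open_Y0 _ connected_Y0[folded Y0_def] _ hol0 eqV z]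
        open_V open_Y0 by blast
  qed
  have one: "u (pt c z) = u (pt d z)" if "c \<in> E" "d \<in> E" "z \<in> Y0" for c d z
  proof (rule \<sigma>_transitive[of "\<lambda>d. u (pt c z) = u (pt d z)" c d])
    fix s e assume e: "e \<in> E" "u (pt c z) = u (pt e z)"
    have "s mod N < N" using N_pos by simp
    then show "u (pt c z) = u (pt (\<sigma> s e) z)" using sw[OF _ e(1) that(3)] e(2) \<sigma>_periodic by metis
  qed (use that in auto)
  then show "\<lbrakk>c \<in> E; d \<in> E; z \<in> Y0\<rbrakk> \<Longrightarrow> u (pt c z) = u (pt d z)" by blast
qed

text \<open>The surface has no points at infinity and its base is bounded, so
  \<open>proj \<circ> g\<close> is a bounded function holomorphic in all charts, and
  \<open>bounded_sheets_agree\<close> makes it independent of the sheet.\<close>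

lemma biholo_descends:
  assumes g: "biholo g"
  obtains H where "H holomorphic_on Y"
    "\<And>c z. \<lbrakk>c \<in> E; z \<in> Y\<rbrakk> \<Longrightarrow> \<exists>d\<in>E. g (pt c z) = pt d (H z) \<and> H z \<in> Y"
proof -
  have tube: "p \<in> tube UNIV" if "p \<in> X" for p
    using that by (cases rule: X_cases) (auto simp: pt_in_tube)
  have t: "g (pt c z) \<in> tube UNIV" if "c \<in> E" "z \<in> Y" for c z
    using tube biholo_in_X[OF g] pt_in_X that by blast
  let ?u = "\<lambda>p. proj (g p)"
  have u: "holo_over Y ?u" using holo_over_biholo[OF g order_refl] t by blast
  have val: "\<exists>d\<in>E. g (pt c z) = pt d (?u (pt c z)) \<and> ?u (pt c z) \<in> Y" if "c \<in> E" "z \<in> Y" for c z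
    using tube_UNIV_cases[OF t[OF that]] by (metis proj_pt)
  have bd: "norm (?u (pt c z)) \<le> real N + 1" if "c \<in> E" "z \<in> Y" for c z
    using val[OF that] by (auto simp: Y_eq)
  have agree0: "?u (pt c z) = ?u (pt d z)" if "c \<in> E" "d \<in> E" "z \<in> Y \<inter> Y0" for c d z
    using bounded_sheets_agree[OF u bd] that by blast
  obtain c0 where c0: "c0 \<in> E" using E_nonempty by blast
  show ?thesis
  proof (rule that[of "\<lambda>z. ?u (pt c0 z)"])
    show "(\<lambda>z. ?u (pt c0 z)) holomorphic_on Y" by (rule sheets_agree(2)[OF open_Y order_refl u agree0 c0])
    show "\<exists>d\<in>E. g (pt c z) = pt d (?u (pt c0 z)) \<and> ?u (pt c0 z) \<in> Y" if "c \<in> E" "z \<in> Y" for c z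
      using val[OF that] sheets_agree(1)[OF open_Y order_refl u agree0 that(1) c0 that(2)] by simp
  qed
qed

definition branch :: "nat \<Rightarrow> complex" where "branch n = of_real (real (n div 2 mod N) + eta n)"

lemma branch_ends: "branch (2 * s) = m s + l s" "branch (2 * s + 1) = m s - l s"
  by (simp_all add: branch_def upper_end lower_end)

lemma branch_end: "branch n = m (n div 2) + l (n div 2) \<or> branch n = m (n div 2) - l (n div 2)"
  using branch_ends[of "n div 2"] by (cases "even n") (auto elim!: evenE oddE)

text \<open>The distance to the puncture on the left is positive and at most 1/2, so the point
  determines the puncture, then the distance, and by strict monotonicity of \<open>eta\<close> the
  index.\<close>

lemma branch_inj: "inj branch"
proof (rule injI)
  fix n k assume "branch n = branch k"
  then have eq: "real (n div 2 mod N) + eta n = real (k div 2 mod N) + eta k"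
    unfolding branch_def using of_real_eq_iff by blast
  then have "\<bar>real (n div 2 mod N) - real (k div 2 mod N)\<bar> < 1"
    using eta_pos[of n] eta_pos[of k] eta_le_half[of n] eta_le_half[of k] by linarith
  then have "n div 2 mod N = k div 2 mod N" by (rule nat_eq_if_close)
  then have "eta n = eta k" using eq by simp
  then show "n = k" using eta_antimono[of n k] eta_antimono[of k n] by (cases n k rule: linorder_cases) auto
qed

lemma branch_in_Y: "branch n \<in> Y"
  using branch_end[of n] ends_in_L[of "n div 2"] slit_in_Y[OF UNIV_I, of "n div 2"] by (metis subsetD)

text \<open>The branch points near the puncture \<open>0\<close> decrease faster than any geometric sequence; the
  derivative of an automorphism of the base at the puncture is finite and nonzero, so it has to fix
  almost all of them.\<close>

theorem punctured_rigid:
  assumes g: "biholo g" and cz: "c \<in> E" "z \<in> Y0"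
  shows "\<exists>d\<in>E. g (pt c z) = pt d z"
proof -
  obtain H where H: "H holomorphic_on Y" "\<And>c z. \<lbrakk>c \<in> E; z \<in> Y\<rbrakk> \<Longrightarrow> \<exists>d\<in>E. g (pt c z) = pt d (H z) \<and> H z \<in> Y"
    using biholo_descends[OF g] by metis
  obtain K where K: "\<And>c z. \<lbrakk>c \<in> E; z \<in> Y\<rbrakk> \<Longrightarrow> \<exists>d\<in>E. inv_into X g (pt c z) = pt d (K z) \<and> K z \<in> Y"
    using biholo_descends[OF biholo_inv(1)[OF g]] by metis
  have KH: "K (H z) = z" if zY: "z \<in> Y" for z
  proof -
    obtain d where d: "d \<in> E" "g (pt c z) = pt d (H z)" "H z \<in> Y" using H(2)[OF cz(1) zY] by blast
    obtain e where e: "e \<in> E" "inv_into X g (pt d (H z)) = pt e (K (H z))" using K d by blast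
    then have "pt c z = pt e (K (H z))" using biholo_inv(2)[OF g pt_in_X[OF cz(1) zY]] d by simp
    then show ?thesis using pt_eq_iff[OF cz(1) e(1)] by simp
  qed
  have HY: "H z \<in> Y" if "z \<in> Y" for z using H(2) cz that by blast
  have Hinj: "inj_on H Y" by (rule inj_on_inverseI[where g = K]) (rule KH)
  have "\<exists>k. H (branch n) = branch k" for n
  proof -
    obtain d t w where "d \<in> E" "w = m t + l t \<or> w = m t - l t" "g (pt c (branch n)) = pt d w"
    proof (rule branch_point_image[OF g UNIV_I cz(1) branch_end[of n] open_UNIV UNIV_I])
      show "proj (g (pt d z)) = H z" if "d \<in> E" "z \<in> Y" for d z using H(2)[OF that] by auto
    qed blast
    moreover obtain e where "e \<in> E" "g (pt c (branch n)) = pt e (H (branch n))"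
      using H(2)[OF cz(1) branch_in_Y] by blast
    ultimately have "H (branch n) = m t + l t \<or> H (branch n) = m t - l t" by (metis pt_eq_iff)
    then show ?thesis using branch_ends by metis
  qed
  then obtain q where q: "\<And>n. H (branch n) = branch (q n)" by metis
  have qinj: "inj q"
    by (rule injI) (metis q Hinj branch_in_Y branch_inj inj_onD injD)
  let ?B = "ball (0::complex) (1 / 2)"
  have V0: "V 0 = ?B - {0}" by (simp add: V_def)
  have V0Y: "?B - {0} \<subseteq> Y" using V_subset[OF N_pos] V0 by simp
  have bd: "norm (H z) \<le> real N + 1" if "z \<in> Y" for z using HY[OF that] by (auto simp: Y_eq)
  have "0 \<in> interior ?B" by simp
  moreover have "eventually (\<lambda>z. norm (H z) \<le> real N + 1) (at 0)"
    unfolding eventually_at using bd V0Y by (intro exI[of _ "1 / 2"]) auto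
  ultimately obtain F where F: "F holomorphic_on ?B" "\<And>z. z \<in> ?B - {0} \<Longrightarrow> F z = H z"
    using holomorphic_on_extend_bounded[of H ?B 0] holomorphic_on_subset[OF H(1) V0Y] by blast
  \<comment> \<open>Indices of the upper ends at the puncture \<open>0\<close>. Slit
    \<open>0\<close> is left out because its upper end \<open>1 / 2\<close> is on the boundary of
    the disc.\<close>
  define r where "r k = 2 * (Suc k * N)" for k
  have r0: "r k div 2 mod N = 0" "r k > 0" for k using N_pos by (simp_all add: r_def)
  have r_mono: "strict_mono r" using N_pos by (auto simp: strict_mono_Suc_iff r_def)
  have br: "branch (r k) = of_real (eta (r k))" for k by (simp add: branch_def r0)
  have brB: "branch (r k) \<in> ?B - {0}" for k
    using eta_pos[of "r k"] eta_less_half[OF r0(2), of k] by (simp add: br)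
  have Fb: "F (branch (r k)) = branch (q (r k))" for k using F(2)[OF brB] q by simp
  have er: "(\<lambda>k. eta (r k)) \<longlonglongrightarrow> 0"
    using filterlim_compose[OF eta_tendsto_0 filterlim_subseq[OF r_mono]] .
  have b0: "(\<lambda>k. branch (r k)) \<longlonglongrightarrow> 0" using tendsto_of_real[OF er, where ?'a = complex] by (simp add: br)
  have contF: "isCont F 0"
    using continuous_on_interior[OF holomorphic_on_imp_continuous_on[OF F(1)]] by simp
  have bq: "(\<lambda>k. branch (q (r k))) \<longlonglongrightarrow> F 0"
    using isCont_tendsto_compose[OF contF b0] by (simp add: Fb)
  have qr: "filterlim (\<lambda>k. q (r k)) sequentially sequentially"
    using inj_compose[OF qinj strict_mono_imp_inj_on[OF r_mono]] by (intro inj_nat_filterlim) (simp add: o_def)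
  have eq: "(\<lambda>k. eta (q (r k))) \<longlonglongrightarrow> 0" using filterlim_compose[OF eta_tendsto_0 qr] .
  define ty where "ty k = q (r k) div 2 mod N" for k
  have "(\<lambda>k. branch (q (r k)) - of_real (eta (q (r k)))) \<longlonglongrightarrow> F 0 - of_real 0"
    using bq eq by (intro tendsto_diff tendsto_of_real)
  then have tyl: "(\<lambda>k. of_nat (ty k)) \<longlonglongrightarrow> F 0" by (simp add: branch_def ty_def)
  \<comment> \<open>A convergent sequence of integers is eventually constant: the images of these
    branch points finally belong to one puncture, and this puncture is \<open>F 0\<close>.\<close>
  have "Cauchy (\<lambda>k. of_nat (ty k) :: complex)" using tyl LIMSEQ_imp_Cauchy by blast
  then obtain k0 where k0: "\<And>i j. i \<ge> k0 \<Longrightarrow> j \<ge> k0 \<Longrightarrow> dist (of_nat (ty i) :: complex) (of_nat (ty j)) < 1"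
    unfolding Cauchy_def using zero_less_one by blast
  define t where "t = ty k0"
  have ty: "ty k = t" if "k \<ge> k0" for k
  proof -
    have "dist (of_nat (ty k) :: complex) (of_nat t) = \<bar>real (ty k) - real t\<bar>"
      unfolding dist_norm by (metis norm_of_real of_real_diff of_real_of_nat_eq)
    then have "\<bar>real (ty k) - real t\<bar> < 1" using k0[OF that, of k0] by (simp add: t_def)
    then show ?thesis by linarith
  qed
  have F0: "F 0 = of_nat t"
  proof (rule LIMSEQ_unique[OF tyl])
    have "eventually (\<lambda>k. of_nat (ty k) = (of_nat t :: complex)) sequentially"
      using ty by (auto simp: eventually_sequentially)
    then show "(\<lambda>k. of_nat (ty k)) \<longlonglongrightarrow> (of_nat t :: complex)" by (rule tendsto_eventually)
  qed
  have "t < N" using N_pos by (simp add: t_def ty_def)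
  then have tY: "of_nat t \<notin> Y" by (auto simp: Y_eq)
  \<comment> \<open>Injectivity survives the extension since \<open>F 0\<close> is a puncture and
    all other values lie in \<open>Y\<close>. It yields the nonzero derivative.\<close>
  have "inj_on F ?B"
  proof (rule inj_onI)
    fix a b assume ab: "a \<in> ?B" "b \<in> ?B" "F a = F b"
    have "F w \<in> Y" if "w \<in> ?B - {0}" for w using F(2)[OF that] HY V0Y that by auto
    then have "a = 0 \<longleftrightarrow> b = 0" using ab F0 tY by (metis DiffI singletonD)
    moreover have "a = b" if "a \<noteq> 0" "b \<noteq> 0"
      using that ab F(2) V0Y Hinj by (metis DiffI inj_onD singletonD subsetD)
    ultimately show "a = b" by metis
  qed
  then have dF: "deriv F 0 \<noteq> 0" using holomorphic_injective_imp_regular[OF F(1) open_ball] by simp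
  have "(F has_field_derivative deriv F 0) (at 0)"
    using holomorphic_derivI[OF F(1) open_ball] by simp
  then have "((\<lambda>h. (F h - F 0) / h) \<longlongrightarrow> deriv F 0) (at 0)" by (simp add: DERIV_def)
  moreover have "filterlim (\<lambda>k. branch (r k)) (at 0) sequentially"
    using b0 brB by (auto simp: filterlim_at)
  ultimately have "(\<lambda>k. (F (branch (r k)) - F 0) / branch (r k)) \<longlonglongrightarrow> deriv F 0"
    by (rule filterlim_compose)
  then have "(\<lambda>k. norm ((F (branch (r k)) - F 0) / branch (r k))) \<longlonglongrightarrow> norm (deriv F 0)" by (rule tendsto_norm)
  moreover have "eventually (\<lambda>k. norm ((F (branch (r k)) - F 0) / branch (r k)) = eta (q (r k)) / eta (r k)) sequentially"
    unfolding eventually_sequentially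
  proof (intro exI[of _ k0] allI impI)
    fix k assume "k0 \<le> k"
    then have "branch (q (r k)) = of_nat t + of_real (eta (q (r k)))"
      using ty[of k] by (simp add: branch_def ty_def)
    then have "F (branch (r k)) - F 0 = of_real (eta (q (r k)))" unfolding Fb F0 by simp
    then show "norm ((F (branch (r k)) - F 0) / branch (r k)) = eta (q (r k)) / eta (r k)"
      using eta_pos[of "r k"] eta_pos[of "q (r k)"] by (simp add: br norm_divide)
  qed
  ultimately have ratio: "(\<lambda>k. eta (q (r k)) / eta (r k)) \<longlonglongrightarrow> norm (deriv F 0)"
    by (rule Lim_transform_eventually)
  define \<delta> where "\<delta> = norm (deriv F 0)"
  have \<delta>: "\<delta> > 0" using dF by (simp add: \<delta>_def)
  have "eventually (\<lambda>k. eta (q (r k)) / eta (r k) > \<delta> / 2) sequentially"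
    using order_tendstoD(1)[OF ratio, of "\<delta> / 2"] \<delta> by (simp add: \<delta>_def)
  moreover have "eventually (\<lambda>k. eta (q (r k)) / eta (r k) < 2 * \<delta>) sequentially"
    using order_tendstoD(2)[OF ratio, of "2 * \<delta>"] \<delta> by (simp add: \<delta>_def)
  moreover have "eventually (\<lambda>k. real (r k) > 2 / \<delta> + 2 * \<delta>) sequentially"
    using filterlim_compose[OF filterlim_real_sequentially filterlim_subseq[OF r_mono]]
    by (simp add: filterlim_at_top_dense)
  moreover have "eventually (\<lambda>k. real (q (r k)) > 2 * \<delta>) sequentially"
    using filterlim_compose[OF filterlim_real_sequentially qr] by (simp add: filterlim_at_top_dense)
  ultimately have "eventually (\<lambda>k. q (r k) = r k) sequentially"
  proof eventually_elim
    case (elim k)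
    have er: "eta (r k) > 0" using eta_pos .
    \<comment> \<open>With a larger index of the image the ratio of the distances would be at most
      \<open>1 / (r k + 3)\<close>, below half of its limit; with a smaller one it would be at least
      \<open>q (r k) + 3\<close>, above twice the limit.\<close>
    have "\<not> r k < q (r k)"
    proof
      assume "r k < q (r k)"
      then have "eta (q (r k)) / eta (r k) \<le> 1 / (real (r k) + 3)"
        using eta_less[of "r k" "q (r k)"] er by (simp add: divide_le_eq mult.commute)
      also have "\<dots> < \<delta> / 2"
      proof -
        have "2 / \<delta> < real (r k) + 3" using elim(3) \<delta> by linarith
        then have "2 < \<delta> * (real (r k) + 3)" using \<delta> by (simp add: divide_less_eq mult.commute)
        then show ?thesis by (simp add: divide_less_eq less_divide_eq)
      qed
      finally show False using elim(1) by linarith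
    qed
    moreover have "\<not> q (r k) < r k"
    proof
      assume "q (r k) < r k"
      then have "eta (r k) * (real (q (r k)) + 3) \<le> eta (q (r k))"
        using eta_less[of "q (r k)" "r k"] by (simp add: le_divide_eq)
      then have "real (q (r k)) + 3 \<le> eta (q (r k)) / eta (r k)"
        using er by (simp add: le_divide_eq mult.commute)
      then show False using elim(2,4) by linarith
    qed
    ultimately show ?case by linarith
  qed
  then obtain k1 where k1: "\<And>k. k \<ge> k1 \<Longrightarrow> q (r k) = r k" by (auto simp: eventually_sequentially)
  let ?b = "\<lambda>k. branch (r (k + k1))"
  have "?b \<longlonglongrightarrow> 0" using LIMSEQ_ignore_initial_segment[OF b0] .
  then have lim: "0 islimpt range ?b"
    unfolding islimpt_sequential using brB by (intro exI[of _ ?b]) auto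
  have id0: "F w - w = 0" if "w \<in> ?B" for w
  proof (rule analytic_continuation[OF _ open_ball connected_ball _ _ lim _ that])
    show "(\<lambda>w. F w - w) holomorphic_on ?B" using F(1) by (intro holomorphic_intros)
    show "F v - v = 0" if "v \<in> range ?b" for v using that Fb k1 by auto
  qed (use brB in auto)
  have "H z = z"
  proof (rule analytic_continuation_open[of "V 0 \<inter> Y0" Y0])
    have "of_real (- 1 / 4) \<in> V 0" by (simp add: V0)
    moreover have "of_real (- 1 / 4) \<notin> L s" for s
    proof
      assume "of_real (- 1 / 4) \<in> L s"
      then obtain x where "(of_real (- 1 / 4) :: complex) = of_real x" "x > 0"
        unfolding L_eq using eta_pos[of "2 * s + 1"] by (force intro: order_less_le_trans)
      then show False by (simp only: of_real_eq_iff)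
    qed
    ultimately show "V 0 \<inter> Y0 \<noteq> {}" using V_subset[OF N_pos] by (auto simp: Y0_def)
    show "H w = w" if "w \<in> V 0 \<inter> Y0" for w using id0[of w] F(2)[of w] that V0 by auto
    show "H holomorphic_on Y0" using H(1) Y0_subset holomorphic_on_subset by blast
    show "(\<lambda>z. z) holomorphic_on Y0" by (rule holomorphic_on_ident)
  qed (use open_V open_Y0 connected_Y0 cz in \<open>auto simp: Y0_def[symmetric]\<close>)
  then show ?thesis using H(2)[of c z] cz Y0_subset by auto
qed

end

section \<open>Sheets of meromorphic functions on the compact covering\<close>

lemma tendsto_imp_eventually_bounded:
  assumes "((f :: 'b \<Rightarrow> complex) \<longlongrightarrow> L) F"
  shows "\<exists>C. \<forall>\<^sub>F x in F. norm (f x) \<le> C"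
proof -
  have "\<forall>\<^sub>F x in F. norm (f x) < norm L + 1"
    using order_tendstoD(2)[OF tendsto_norm[OF assms], of "norm L + 1"] by simp
  then have "\<forall>\<^sub>F x in F. norm (f x) \<le> norm L + 1" by (rule eventually_mono) simp
  then show ?thesis by blast
qed

text \<open>Holomorphic functions on a connected open set form an integral domain: if the whole
  product vanished, the new factor would vanish on the open set where the remaining product does
  not.\<close>

lemma prod_not_identically_zero:
  assumes "finite I" "open S" "connected S" "S \<noteq> {}"
    and "\<And>i. i \<in> I \<Longrightarrow> f i holomorphic_on S" "\<And>i. i \<in> I \<Longrightarrow> \<exists>z\<in>S. f i z \<noteq> (0::complex)"
  shows "\<exists>z\<in>S. (\<Prod>i\<in>I. f i z) \<noteq> 0"
  using assms(1,5,6)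
proof (induction I rule: finite_induct)
  case empty
  then show ?case using assms(4) by auto
next
  case (insert i I)
  let ?p = "\<lambda>z. \<Prod>i\<in>I. f i z"
  obtain a where a: "a \<in> S" "?p a \<noteq> 0" using insert by (meson insertI2)
  have hp: "?p holomorphic_on S" using insert.prems by (intro holomorphic_intros) auto
  have hf: "f i holomorphic_on S" using insert.prems by auto
  let ?U = "{z \<in> S. ?p z \<in> - {0}}"
  have U: "open ?U" using hp assms(2) by (intro open_vimage_Collect holomorphic_on_imp_continuous_on) auto
  show ?case
  proof (rule ccontr)
    assume "\<not> ?thesis"
    then have "f i z = 0" if "z \<in> ?U" for z using that insert.hyps by auto
    then have "f i z = 0" if "z \<in> S" for z
      using analytic_continuation_open[OF U assms(2) _ assms(3) _ hf holomorphic_on_const[of 0], of z] a that by auto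
    then show False using insert.prems(2) by auto
  qed
qed

context slit_cover
begin

text \<open>\<open>J s\<close> is open and so maps neighbourhoods to neighbourhoods, even at a
  branch point, where it is not injective.\<close>

lemma eventually_at_J:
  assumes "s \<in> K" "\<zeta>0 \<in> DA s" "\<forall>\<^sub>F \<zeta> in at \<zeta>0. Q (J s \<zeta>)"
  shows "\<forall>\<^sub>F z in at (J s \<zeta>0). Q z"
proof -
  obtain S where S: "open S" "\<zeta>0 \<in> S" "\<And>\<zeta>. \<zeta> \<in> S \<Longrightarrow> \<zeta> \<noteq> \<zeta>0 \<Longrightarrow> Q (J s \<zeta>)"
    using assms(3) by (auto simp: eventually_at_topological)
  have "open (J s ` (S - {0}))" using S(1) by (intro open_jk_image l_nonzero assms(1)) auto
  moreover have "J s \<zeta>0 \<in> J s ` (S - {0})" using S(2) assms(2) by (auto simp: DA_iff)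
  moreover have "\<forall>z\<in>J s ` (S - {0}). z \<noteq> J s \<zeta>0 \<longrightarrow> Q z" using S(3) by auto
  ultimately show ?thesis unfolding eventually_at_topological by blast
qed

text \<open>An injective lift into the chart at infinity has a simple zero at \<open>v\<close>; its
  reciprocal is \<open>proj \<circ> g\<close> in this chart, which therefore has a simple
  pole.\<close>

lemma pole_chart:
  assumes g: "biholo g" and i: "i \<in> Idx" "v \<in> dom i" and d: "d \<in> E_inf" "g (par i v) = infp d"
  obtains \<tau> D where "(\<tau> has_field_derivative D) (at v)" "D \<noteq> 0" "\<tau> v = 0"
    "\<forall>\<^sub>F x in at v. \<tau> x \<noteq> 0 \<and> proj (g (par i x)) = 1 / \<tau> x"
proof -
  have dE: "d \<in> E" using d E_inf by auto
  have z0: "0 \<in> dom (In d)" using R0_pos by simp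
  have eq: "g (par i v) = par (In d) 0" using d by simp
  obtain N \<tau> where lift: "open N" "v \<in> N" "N \<subseteq> dom i" "\<tau> holomorphic_on N"
    "\<And>x. x \<in> N \<Longrightarrow> \<tau> x \<in> dom (In d)" "\<And>x. x \<in> N \<Longrightarrow> g (par i x) = par (In d) (\<tau> x)"
    "\<tau> v = 0" "inj_on \<tau> N"
    using biholo_lift[OF g i Idx_intros(3)[OF d(1)] z0 eq] by metis
  note N = lift(1,2,4,6,7,8)
  show ?thesis
  proof (rule that)
    show "(\<tau> has_field_derivative deriv \<tau> v) (at v)" using holomorphic_derivI[OF N(3,1,2)] .
    show "deriv \<tau> v \<noteq> 0" using holomorphic_injective_imp_regular[OF N(3,1,6,2)] .
    show "\<tau> v = 0" by (rule N)
    have "\<forall>x\<in>N. x \<noteq> v \<longrightarrow> \<tau> x \<noteq> 0 \<and> proj (g (par i x)) = 1 / \<tau> x"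
    proof (intro ballI impI)
      fix x assume x: "x \<in> N" "x \<noteq> v"
      then have "\<tau> x \<noteq> 0" using inj_onD[OF N(6) _ x(1) N(2)] N(5) by auto
      then show "\<tau> x \<noteq> 0 \<and> proj (g (par i x)) = 1 / \<tau> x" using N(4)[OF x(1)] dE by simp
    qed
    then show "\<forall>\<^sub>F x in at v. \<tau> x \<noteq> 0 \<and> proj (g (par i x)) = 1 / \<tau> x"
      unfolding eventually_at_topological using N(1,2) by blast
  qed
qed

lemma biholo_tends_to_infinity:
  assumes g: "biholo g" and i: "i \<in> Idx" "v \<in> dom i" and d: "d \<in> E_inf" "g (par i v) = infp d"
  shows "filterlim (\<lambda>x. proj (g (par i x))) at_infinity (at v)"
proof -
  obtain \<tau> D where \<tau>: "(\<tau> has_field_derivative D) (at v)" "\<tau> v = 0"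
    "\<forall>\<^sub>F x in at v. \<tau> x \<noteq> 0 \<and> proj (g (par i x)) = 1 / \<tau> x"
    using pole_chart[OF assms] by blast
  have "(\<tau> \<longlongrightarrow> 0) (at v)" using DERIV_isCont[OF \<tau>(1)] \<tau>(2) by (simp add: isCont_def)
  then have "filterlim \<tau> (at 0) (at v)" using \<tau>(3) by (auto simp: filterlim_at elim: eventually_mono)
  then have "filterlim (\<lambda>x. inverse (\<tau> x)) at_infinity (at v)"
    by (rule filterlim_compose[OF filterlim_inverse_at_infinity])
  then show ?thesis
    by (rule filterlim_mono_eventually[OF _ order_refl order_refl])
      (use \<tau>(3) in \<open>auto elim!: eventually_mono simp: inverse_eq_divide\<close>)
qed

lemma biholo_tendsto:
  assumes g: "biholo g" and i: "i \<in> Idx" "v \<in> dom i" and d: "d \<in> E" "w \<in> Y" "g (par i v) = pt d w"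
  shows "((\<lambda>x. proj (g (par i x))) \<longlongrightarrow> w) (at v)"
proof -
  obtain j z where j: "j \<in> Idx" "z \<in> dom j" "par j z = pt d w" "\<And>v. v \<in> dom j \<Longrightarrow> par j v \<in> tube UNIV"
    using finite_chart[OF d(1,2)] by metis
  have eq: "g (par i v) = par j z" using j d by simp
  obtain N \<tau> where lift: "open N" "v \<in> N" "N \<subseteq> dom i" "\<tau> holomorphic_on N"
    "\<And>x. x \<in> N \<Longrightarrow> \<tau> x \<in> dom j" "\<And>x. x \<in> N \<Longrightarrow> g (par i x) = par j (\<tau> x)"
    "\<tau> v = z" "inj_on \<tau> N"
    using biholo_lift[OF g i j(1,2) eq] by metis
  note N = lift(1,2,3,5,6)
  have "(\<lambda>x. proj (g (par i x))) holomorphic_on N"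
    using proj_biholo_holomorphic[OF g i(1) N(3)] N(4,5) j(4) by metis
  then have "isCont (\<lambda>x. proj (g (par i x))) v"
    using continuous_on_interior[OF holomorphic_on_imp_continuous_on] N(1,2) interior_open by metis
  then show ?thesis using d by (simp add: isCont_def)
qed

text \<open>In every chart, including those at slits and at infinity, poles are at most simple
  because \<open>g\<close> is injective. This bounds pole orders independently of
  \<open>g\<close>.\<close>

lemma biholo_simple_pole:
  assumes g: "biholo g" and i: "i \<in> Idx" "v \<in> dom i"
  shows "\<exists>L. ((\<lambda>x. proj (g (par i x)) * (x - v)) \<longlongrightarrow> L) (at v)"
proof -
  have "g (par i v) \<in> X" using biholo_in_X[OF g \<psi>_in_X[OF i]] .
  then show ?thesis
  proof (cases rule: X_cases)
    case (1 d w)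
    have "((\<lambda>x. proj (g (par i x)) * (x - v)) \<longlongrightarrow> w * (v - v)) (at v)"
      by (intro tendsto_intros biholo_tendsto[OF g i 1])
    then show ?thesis by blast
  next
    case (2 d)
    obtain \<tau> D where \<tau>: "(\<tau> has_field_derivative D) (at v)" "D \<noteq> 0" "\<tau> v = 0"
      "\<forall>\<^sub>F x in at v. \<tau> x \<noteq> 0 \<and> proj (g (par i x)) = 1 / \<tau> x"
      by (rule pole_chart[OF g i 2(2,3)])
    have "((\<lambda>x. (\<tau> x - \<tau> v) / (x - v)) \<longlongrightarrow> D) (at v)" using \<tau>(1) by (simp add: has_field_derivative_iff)
    then have "((\<lambda>x. inverse ((\<tau> x - \<tau> v) / (x - v))) \<longlongrightarrow> inverse D) (at v)" using \<tau>(2) by (rule tendsto_inverse)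
    moreover have "\<forall>\<^sub>F x in at v. inverse ((\<tau> x - \<tau> v) / (x - v)) = proj (g (par i x)) * (x - v)"
      using \<tau>(4) by (rule eventually_mono) (simp add: \<tau>(3))
    ultimately have "((\<lambda>x. proj (g (par i x)) * (x - v)) \<longlongrightarrow> inverse D) (at v)" by (rule Lim_transform_eventually)
    then show ?thesis by blast
  qed
qed

lemma finite_J_fibres:
  assumes "s \<in> K" "finite q"
  shows "finite {\<zeta>. \<zeta> \<noteq> 0 \<and> J s \<zeta> \<in> q}"
proof -
  have "finite {\<zeta>. \<zeta> \<noteq> 0 \<and> J s \<zeta> = a}" for a
  proof -
    obtain \<xi> where \<xi>: "\<xi> \<noteq> 0" "J s \<xi> = a" by (rule jk_surj[OF l_nonzero[OF assms(1)]])
    have "{\<zeta>. \<zeta> \<noteq> 0 \<and> J s \<zeta> = a} \<subseteq> {\<xi>, 1 / \<xi>}"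
    proof
      fix \<zeta> assume "\<zeta> \<in> {\<zeta>. \<zeta> \<noteq> 0 \<and> J s \<zeta> = a}"
      then have "\<zeta> \<noteq> 0" "J s \<xi> = J s \<zeta>" using \<xi>(2) by auto
      then show "\<zeta> \<in> {\<xi>, 1 / \<xi>}" using jk_eq_iff[OF l_nonzero[OF assms(1)] \<xi>(1)] by blast
    qed
    then show ?thesis by (rule finite_subset) simp
  qed
  moreover have "{\<zeta>. \<zeta> \<noteq> 0 \<and> J s \<zeta> \<in> q} = (\<Union>a\<in>q. {\<zeta>. \<zeta> \<noteq> 0 \<and> J s \<zeta> = a})" by auto
  ultimately show ?thesis using assms(2) by auto
qed

text \<open>Analytic continuation through the slit: near the parameter \<open>1\<close> the two
  functions agree outside the unit circle, hence also inside it, which lies on the sheets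
  \<open>\<sigma> s c\<close> and \<open>\<sigma> s d\<close>. Removing the finitely many parameters
  over \<open>q\<close> keeps the domains connected.\<close>

lemma monodromy_invariant:
  assumes s: "s \<in> K" and c: "c \<in> E" and d: "d \<in> E" and q: "finite q" and u: "holo_over (Y - q) u"
    and eq: "\<And>z. z \<in> Y0 - q \<Longrightarrow> u (pt c z) = u (pt d z)" and z: "z \<in> Y0 - q"
  shows "u (pt (\<sigma> s c) z) = u (pt (\<sigma> s d) z)"
proof -
  have eqS: "(Y - q) \<inter> Y0 = Y0 - q" using Y0_subset by auto
  have oS: "open (Y0 - q)" using open_Y0 q by (simp add: finite_imp_closed open_Diff)
  have cS: "connected (Y0 - q)"
    using connected_Y0 open_Y0 q by (intro connected_open_diff_countable) (auto simp: Y0_def[symmetric] countable_finite)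
  obtain e where e: "e > 0" "ball 1 e \<subseteq> DA s"
    using open_DA[OF s] circle_in_DA[OF s, of 1] by (auto simp: open_contains_ball)
  let ?f = "{\<zeta>. \<zeta> \<noteq> 0 \<and> J s \<zeta> \<in> q}"
  have ff: "finite ?f" by (rule finite_J_fibres[OF s q])
  let ?B = "ball 1 e - ?f"
  have oB: "open ?B" using ff by (simp add: finite_imp_closed open_Diff)
  have cB: "connected ?B" using ff by (intro connected_open_diff_countable) (auto simp: countable_finite)
  have BD: "?B \<subseteq> {\<zeta> \<in> DA s. J s \<zeta> \<in> Y - q}" using e Y0_subset by (auto simp: DA_iff subset_iff)
  have ne: "W - ?f \<noteq> {}" if "open W" "W \<noteq> {}" for W
    using that ff finite_imp_not_open finite_subset by (metis Diff_eq_empty_iff)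
  let ?B1 = "?B \<inter> {\<zeta>. norm \<zeta> > 1}" and ?B2 = "?B \<inter> {\<zeta>. norm \<zeta> < 1}"
  have o1: "open ?B1" by (intro open_Int oB open_Collect_less continuous_intros)
  have o2: "open ?B2" by (intro open_Int oB open_Collect_less continuous_intros)
  obtain \<xi> \<xi>' :: complex where "\<xi> \<in> ball 1 e" "norm \<xi> > 1" "\<xi>' \<in> ball 1 e" "norm \<xi>' < 1"
    using near_circle[OF open_ball, of 1 1 e] e(1) by (metis centre_in_ball norm_one)
  then have "ball 1 e \<inter> {\<zeta>::complex. norm \<zeta> > 1} \<noteq> {}" "ball 1 e \<inter> {\<zeta>::complex. norm \<zeta> < 1} \<noteq> {}" by auto
  moreover have "open (ball 1 e \<inter> {\<zeta>::complex. norm \<zeta> > 1})" "open (ball 1 e \<inter> {\<zeta>::complex. norm \<zeta> < 1})"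
    by (intro open_Int open_ball open_Collect_less continuous_intros)+
  ultimately have n1: "?B1 \<noteq> {}" and n2: "?B2 \<noteq> {}" using ne by (simp_all add: Diff_Int_distrib2 Int_Diff) blast+
  let ?F = "\<lambda>d \<zeta>. u (par (An s d) \<zeta>)"
  have hol: "?F c holomorphic_on ?B" "?F d holomorphic_on ?B"
    using holo_overD(2)[OF u _ s] c d BD holomorphic_on_subset by blast+
  have B0: "J s \<zeta> \<in> Y0 - q" if "\<zeta> \<in> ?B" "norm \<zeta> \<noteq> 1" for \<zeta>
    using DA_J[OF s, of \<zeta>] that BD by blast
  have "?F c \<zeta> = ?F d \<zeta>" if "\<zeta> \<in> ?B1" for \<zeta>
    using eq[OF B0[of \<zeta>]] that by auto
  then have FB: "?F c \<zeta> = ?F d \<zeta>" if "\<zeta> \<in> ?B" for \<zeta>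
    using analytic_continuation_open[OF o1 oB n1 cB _ hol _ that] by blast
  have oJ: "open (J s ` ?B2)" using o2 BD zero_notin_DA by (intro open_jk_image l_nonzero s) blast+
  have JS: "J s ` ?B2 \<subseteq> Y0 - q" using B0 by fastforce
  have hS: "(\<lambda>z. u (pt e z)) holomorphic_on Y0 - q" if "e \<in> E" for e
    using holo_overD(1)[OF u that] by (simp add: eqS)
  show ?thesis
  proof (rule analytic_continuation_open[OF oJ oS _ cS JS hS hS _ z])
    show "J s ` ?B2 \<noteq> {}" using n2 by blast
    fix w assume "w \<in> J s ` ?B2"
    then obtain \<zeta> where \<zeta>: "\<zeta> \<in> ?B" "norm \<zeta> < 1" "w = J s \<zeta>" by blast
    then show "u (pt (\<sigma> s c) w) = u (pt (\<sigma> s d) w)" using FB[OF \<zeta>(1)] by simp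
  qed (use \<sigma>_in[OF s] c d in auto)
qed

end

text \<open>Let \<open>n = card E\<close>. At most \<open>n\<^sup>2\<close> differences are
  multiplied, and their product has order at most \<open>n\<^sup>2\<close> at infinity and at each
  of at most \<open>n\<close> base points of poles. Clearing the poles gives a polynomial of degree
  at most \<open>n\<^sup>2 + n\<^sup>2 * n\<close>; the last summand \<open>n\<close> allows for
  branch points that are themselves base points of poles.\<close>

locale closed_cover = slit_cover E K \<sigma> m l UNIV E R0 pt infp
  for E :: "'e set" and K \<sigma> m l R0 and pt :: "'e \<Rightarrow> complex \<Rightarrow> 'a" and infp +
  assumes finite_E: "finite E" and finite_K: "finite K"
    and many_branch_points: "s \<in> K \<Longrightarrow> \<exists>Z. finite Z \<and> card Z > (card E)\<^sup>2 + (card E)\<^sup>2 * card E + card E \<and>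
       (\<forall>b\<in>Z. \<exists>t\<in>K. \<sigma> t = \<sigma> s \<and> (b = m t + l t \<or> b = m t - l t))"
begin

definition poles :: "('a \<Rightarrow> 'a) \<Rightarrow> complex set" where
  "poles g = {z. \<exists>c\<in>E. g (pt c z) \<in> infp ` E}"

text \<open>By injectivity each of the \<open>card E\<close> points at infinity has a single
  preimage, so it accounts for at most one base point.\<close>

lemma finite_poles:
  assumes "biholo g"
  shows "finite (poles g)" "card (poles g) \<le> card E"
proof -
  have sub: "poles g \<subseteq> (\<lambda>d. proj (inv_into X g (infp d))) ` E"
  proof
    fix z assume "z \<in> poles g"
    then obtain c d where cd: "c \<in> E" "d \<in> E" "g (pt c z) = infp d" by (auto simp: poles_def)
    then have "inv_into X g (infp d) = pt c z" using biholo_inv(2)[OF assms pt_in_X[OF cd(1) UNIV_I]] by metis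
    then show "z \<in> (\<lambda>d. proj (inv_into X g (infp d))) ` E" using cd by (intro image_eqI[of _ _ d]) auto
  qed
  show "finite (poles g)" using finite_subset[OF sub] finite_E by blast
  show "card (poles g) \<le> card E"
    using card_mono[OF _ sub] card_image_le[OF finite_E] finite_E by (meson finite_imageI le_trans)
qed

lemma not_pole:
  assumes "biholo g" "c \<in> E" "z \<notin> poles g"
  shows "g (pt c z) \<in> tube UNIV"
proof -
  have "g (pt c z) \<in> X" using biholo_in_X[OF assms(1) pt_in_X[OF assms(2) UNIV_I]] .
  then show ?thesis
    by (cases rule: X_cases) (use assms in \<open>auto simp: poles_def pt_in_tube\<close>)
qed

text \<open>If the sheets \<open>c\<close> and \<open>\<sigma> s c\<close> of \<open>proj \<circ> g\<close> differed, the product of all nonzero differences of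
  sheets would be a nonzero rational function on the sphere. Its number of poles is bounded in terms
  of the degree of the covering only, but it vanishes at all branch points of type \<open>s\<close>.\<close>

lemma sheets_agree_closed:
  assumes g: "biholo g" and c: "c \<in> E" and d: "d \<in> E" and z: "z \<in> Y0 - poles g"
  shows "proj (g (pt c z)) = proj (g (pt d z))"
proof -
  define u where "u p = proj (g p)" for p
  define q where "q = poles g"
  define V where "V = UNIV - q"
  have fq: "finite q" using finite_poles(1)[OF g] by (simp add: q_def)
  have oV: "open V" using fq by (simp add: V_def finite_imp_closed open_Diff)
  have VS: "V \<inter> Y0 = Y0 - q" by (auto simp: V_def)
  have oS: "open (Y0 - q)" using open_Y0 fq by (simp add: finite_imp_closed open_Diff)
  have cS: "connected (Y0 - q)"
    using connected_Y0 open_Y0 fq by (intro connected_open_diff_countable) (auto simp: Y0_def[symmetric] countable_finite)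
  have nS: "Y0 - q \<noteq> {}" using z by (auto simp: q_def)
  have uV: "holo_over V u"
    unfolding u_def using not_pole[OF g] by (intro holo_over_biholo[OF g]) (auto simp: V_def q_def)
  define eqv where "eqv c d \<longleftrightarrow> (\<forall>z\<in>Y0 - q. u (pt c z) = u (pt d z))" for c d
  define \<Delta> where "\<Delta> = {x \<in> E \<times> E. \<not> eqv (fst x) (snd x)}"
  define M where "M = card \<Delta>"
  have f\<Delta>: "finite \<Delta>" using finite_E by (auto simp: \<Delta>_def)
  have \<Delta>E: "fst x \<in> E" "snd x \<in> E" if "x \<in> \<Delta>" for x using that by (auto simp: \<Delta>_def)
  have ME: "M \<le> (card E)\<^sup>2"
    unfolding M_def power2_eq_square card_cartesian_product[symmetric]
    using finite_E by (intro card_mono) (auto simp: \<Delta>_def)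
  have inv: "eqv (\<sigma> s c) (\<sigma> s d)" if "s \<in> K" "c \<in> E" "d \<in> E" "eqv c d" for s c d
    unfolding eqv_def using monodromy_invariant[OF that(1-3) fq uV[unfolded V_def]] that(4) eqv_def by blast
  define swap where "swap s x = (\<sigma> s (fst x), \<sigma> s (snd x))" for s and x :: "'e \<times> 'e"
  have swap: "bij_betw (swap s) \<Delta> \<Delta>" if s: "s \<in> K" for s
  proof -
    have sub: "swap s ` \<Delta> \<subseteq> \<Delta>"
    proof
      fix y assume "y \<in> swap s ` \<Delta>"
      then obtain x where x: "x \<in> \<Delta>" "y = swap s x" by blast
      have "\<not> eqv (\<sigma> s (fst x)) (\<sigma> s (snd x))"
      proof
        assume "eqv (\<sigma> s (fst x)) (\<sigma> s (snd x))"
        then have "eqv (fst x) (snd x)"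
          using inv[OF s \<sigma>_in[OF s \<Delta>E(1)[OF x(1)]] \<sigma>_in[OF s \<Delta>E(2)[OF x(1)]]] \<sigma>_\<sigma>[OF s] \<Delta>E[OF x(1)] by simp
        then show False using x(1) by (simp add: \<Delta>_def)
      qed
      then show "y \<in> \<Delta>" using x \<Delta>E[OF x(1)] \<sigma>_in[OF s] by (simp add: \<Delta>_def swap_def)
    qed
    show ?thesis
      by (rule bij_betw_byWitness[where f' = "swap s", OF _ _ sub sub])
        (use \<Delta>E \<sigma>_\<sigma>[OF s] in \<open>auto simp: swap_def\<close>)
  qed
  \<comment> \<open>Crossing a slit \<open>s\<close> replaces each pair in \<open>\<Delta>\<close>
    by its image under \<open>swap s\<close>, which only permutes the factors. Hence the product is
    single-valued across the slits.\<close>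
  define P where "P z = (\<Prod>x\<in>\<Delta>. u (pt (fst x) z) - u (pt (snd x) z))" for z
  have PJ: "P (J s \<zeta>) = (\<Prod>x\<in>\<Delta>. u (par (An s (fst x)) \<zeta>) - u (par (An s (snd x)) \<zeta>))" if s: "s \<in> K" for s \<zeta>
    using par_uniform[OF s, of \<zeta>]
  proof
    assume *: "\<forall>c\<in>E. par (An s c) \<zeta> = pt c (J s \<zeta>)"
    show ?thesis unfolding P_def by (rule prod.cong) (use * \<Delta>E in \<open>auto simp del: par.simps\<close>)
  next
    assume *: "\<forall>c\<in>E. par (An s c) \<zeta> = pt (\<sigma> s c) (J s \<zeta>)"
    have "P (J s \<zeta>) = (\<Prod>x\<in>\<Delta>. u (pt (fst (swap s x)) (J s \<zeta>)) - u (pt (snd (swap s x)) (J s \<zeta>)))"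
      unfolding P_def by (rule prod.reindex_bij_betw[OF swap[OF s], symmetric])
    also have "\<dots> = (\<Prod>x\<in>\<Delta>. u (par (An s (fst x)) \<zeta>) - u (par (An s (snd x)) \<zeta>))"
      by (rule prod.cong) (use * \<Delta>E in \<open>auto simp: swap_def simp del: par.simps\<close>)
    finally show ?thesis .
  qed
  have factor_hol: "(\<lambda>z. u (pt (fst x) z) - u (pt (snd x) z)) holomorphic_on Y0 - q" if "x \<in> \<Delta>" for x
    using holo_overD(1)[OF uV] \<Delta>E[OF that] VS by (intro holomorphic_intros) auto
  have PV: "P holomorphic_on V"
  proof (rule holomorphic_descends[OF oV])
    show "P holomorphic_on V \<inter> Y0" unfolding VS P_def using factor_hol by (rule holomorphic_on_prod)
    fix s assume s: "s \<in> K"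
    show "(\<lambda>\<zeta>. P (J s \<zeta>)) holomorphic_on {\<zeta> \<in> DA s. J s \<zeta> \<in> V}"
      unfolding PJ[OF s] using holo_overD(2)[OF uV _ s] \<Delta>E by (intro holomorphic_on_prod holomorphic_intros) auto
  qed auto
  have "\<exists>z\<in>Y0 - q. P z \<noteq> 0"
    unfolding P_def
  proof (rule prod_not_identically_zero[OF f\<Delta> oS cS nS factor_hol])
    fix x assume "x \<in> \<Delta>"
    then have "\<not> eqv (fst x) (snd x)" by (simp add: \<Delta>_def)
    then show "\<exists>z\<in>Y0 - q. u (pt (fst x) z) - u (pt (snd x) z) \<noteq> 0" by (auto simp: eqv_def)
  qed
  then obtain w0 where w0: "w0 \<in> Y0 - q" "P w0 \<noteq> 0" by blast
  \<comment> \<open>Each of the \<open>M\<close> factors has at most a simple pole, cancelled by one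
    factor \<open>v - v0\<close>. The function \<open>f\<close> selects the slit charts or the
    charts at infinity.\<close>
  have swap_lim: "\<exists>L. ((\<lambda>v. (\<Prod>x\<in>\<Delta>. u (par (f (fst x)) v) - u (par (f (snd x)) v)) * (v - v0) ^ M) \<longlongrightarrow> L) (at v0)"
    if f: "\<And>c. c \<in> E \<Longrightarrow> f c \<in> Idx \<and> v0 \<in> dom (f c)" for f v0
  proof -
    have "\<forall>c\<in>E. \<exists>L. ((\<lambda>v. u (par (f c) v) * (v - v0)) \<longlongrightarrow> L) (at v0)"
      unfolding u_def using biholo_simple_pole[OF g] f by blast
    then obtain L where L: "\<And>c. c \<in> E \<Longrightarrow> ((\<lambda>v. u (par (f c) v) * (v - v0)) \<longlongrightarrow> L c) (at v0)" by metis
    have "((\<lambda>v. \<Prod>x\<in>\<Delta>. u (par (f (fst x)) v) * (v - v0) - u (par (f (snd x)) v) * (v - v0))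
        \<longlongrightarrow> (\<Prod>x\<in>\<Delta>. L (fst x) - L (snd x))) (at v0)"
      using L \<Delta>E by (intro tendsto_prod tendsto_diff) auto
    moreover have "(\<Prod>x\<in>\<Delta>. u (par (f (fst x)) v) * (v - v0) - u (par (f (snd x)) v) * (v - v0)) =
        (\<Prod>x\<in>\<Delta>. u (par (f (fst x)) v) - u (par (f (snd x)) v)) * (v - v0) ^ M" for v
      by (simp add: left_diff_distrib[symmetric] prod.distrib M_def)
    ultimately show ?thesis by auto
  qed
  have main: "eqv c (\<sigma> s c)" if s: "s \<in> K" and cE: "c \<in> E" for s c
  proof (rule ccontr)
    assume neq: "\<not> eqv c (\<sigma> s c)"
    \<comment> \<open>The estimate in the parameter \<open>v\<close> transfers to the base
      coordinate because the difference quotient of \<open>J t\<close> has a finite limit. At a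
      branch point this limit is 0, which does no harm.\<close>
    have near: "\<exists>C. \<forall>\<^sub>F z in at a. norm (P z * (z - a) ^ M) \<le> C" for a
    proof -
      obtain t where t: "t \<in> K" "a \<in> Ys t"
        using Y_cases[OF UNIV_I, of a] Ys_eq[OF s] s by (metis UnI1)
      obtain \<zeta>0 where \<zeta>0: "\<zeta>0 \<in> DA t" "J t \<zeta>0 = a" using par_cover_all[OF t] by metis
      have nz: "\<zeta>0 \<noteq> 0" using \<zeta>0 by (auto simp: DA_iff)
      have "\<exists>L. ((\<lambda>v. (\<Prod>x\<in>\<Delta>. u (par (An t (fst x)) v) - u (par (An t (snd x)) v)) * (v - \<zeta>0) ^ M) \<longlongrightarrow> L) (at \<zeta>0)"
        using t \<zeta>0 by (intro swap_lim) (auto simp: Idx_intros)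
      then obtain L where "((\<lambda>v. P (J t v) * (v - \<zeta>0) ^ M) \<longlongrightarrow> L) (at \<zeta>0)" unfolding PJ[OF t(1), symmetric] by blast
      moreover have "((\<lambda>v. (J t v - J t \<zeta>0) / (v - \<zeta>0)) \<longlongrightarrow> l t * (1 - 1 / \<zeta>0\<^sup>2) / 2) (at \<zeta>0)"
        using jk_has_field_derivative[OF nz, of "m t" "l t"] by (simp add: has_field_derivative_iff)
      ultimately have "((\<lambda>v. P (J t v) * (v - \<zeta>0) ^ M * ((J t v - J t \<zeta>0) / (v - \<zeta>0)) ^ M)
          \<longlongrightarrow> L * (l t * (1 - 1 / \<zeta>0\<^sup>2) / 2) ^ M) (at \<zeta>0)"
        by (intro tendsto_mult tendsto_power)
      then obtain C where C: "\<forall>\<^sub>F v in at \<zeta>0. norm (P (J t v) * (v - \<zeta>0) ^ M * ((J t v - J t \<zeta>0) / (v - \<zeta>0)) ^ M) \<le> C"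
        using tendsto_imp_eventually_bounded by blast
      have "\<forall>\<^sub>F v in at \<zeta>0. v \<noteq> \<zeta>0" by (simp add: eventually_at_filter)
      with C have "\<forall>\<^sub>F v in at \<zeta>0. norm (P (J t v) * (J t v - a) ^ M) \<le> C"
        by eventually_elim (simp add: \<zeta>0(2) power_divide)
      then have "\<forall>\<^sub>F z in at (J t \<zeta>0). norm (P z * (z - a) ^ M) \<le> C" by (rule eventually_at_J[OF t(1) \<zeta>0(1)])
      then show ?thesis using \<zeta>0(2) by auto
    qed
    have "\<exists>L. ((\<lambda>v. (\<Prod>x\<in>\<Delta>. u (par (In (fst x)) v) - u (par (In (snd x)) v)) * (v - 0) ^ M) \<longlongrightarrow> L) (at 0)"
      using R0_pos by (intro swap_lim) (auto simp: Idx_intros)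
    then obtain C0 where "\<forall>\<^sub>F v in at 0. norm ((\<Prod>x\<in>\<Delta>. u (par (In (fst x)) v) - u (par (In (snd x)) v)) * v ^ M) \<le> C0"
      using tendsto_imp_eventually_bounded by fastforce
    moreover have "\<forall>\<^sub>F v in at 0. v \<noteq> (0::complex)" by (simp add: eventually_at_filter)
    ultimately have "\<forall>\<^sub>F v in at 0. norm (P (1 / v) * v ^ M) \<le> C0"
      by eventually_elim (simp add: P_def)
    then obtain r where r: "r > 0" "\<And>v. v \<noteq> 0 \<Longrightarrow> norm v < r \<Longrightarrow> norm (P (1 / v) * v ^ M) \<le> C0"
      by (auto simp: eventually_at)
    have far: "norm (P z) \<le> C0 * norm z ^ M" if "norm z > 1 / r" for z
    proof -
      have z: "z \<noteq> 0" using that r(1) by auto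
      have "norm (1 / z) < r" using that r(1) z by (simp add: norm_divide field_simps)
      then have "norm (P z * (1 / z) ^ M) \<le> C0" using r(2)[of "1 / z"] z by simp
      then show ?thesis using z by (simp add: norm_mult norm_power norm_divide power_divide field_simps)
    qed
    \<comment> \<open>The denominator: it clears the poles of \<open>P\<close>, whose order at each
      point of \<open>q\<close> is at most \<open>M\<close>.\<close>
    define Q where "Q z = (\<Prod>a\<in>q. (z - a) ^ M)" for z
    have Qhol: "Q holomorphic_on S" for S unfolding Q_def by (intro holomorphic_intros)
    have "(\<lambda>z. P z * Q z) holomorphic_on UNIV - q"
      using PV Qhol by (intro holomorphic_intros) (simp_all add: V_def)
    moreover have "(\<lambda>z. P z * Q z) \<in> O[at a](\<lambda>_. 1)" if a: "a \<in> q" for a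
    proof -
      have Qa: "Q z = (z - a) ^ M * (\<Prod>b\<in>q - {a}. (z - b) ^ M)" for z
        unfolding Q_def using a fq by (simp add: prod.remove)
      have "((\<lambda>z. \<Prod>b\<in>q - {a}. (z - b) ^ M) \<longlongrightarrow> (\<Prod>b\<in>q - {a}. (a - b) ^ M)) (at a)"
        by (intro tendsto_intros)
      then obtain C1 where C1: "\<forall>\<^sub>F z in at a. norm (\<Prod>b\<in>q - {a}. (z - b) ^ M) \<le> C1"
        using tendsto_imp_eventually_bounded by blast
      obtain C2 where C2: "\<forall>\<^sub>F z in at a. norm (P z * (z - a) ^ M) \<le> C2" using near by blast
      from C1 C2 have "\<forall>\<^sub>F z in at a. norm (P z * Q z) \<le> C2 * C1 * norm (1::complex)"
      proof eventually_elim
        case (elim z)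
        have "norm (P z * Q z) = norm (P z * (z - a) ^ M) * norm (\<Prod>b\<in>q - {a}. (z - b) ^ M)"
          unfolding Qa by (simp only: norm_mult mult.assoc)
        also have "\<dots> \<le> C2 * C1" using elim by (intro mult_mono) (auto intro: order_trans[OF norm_ge_zero])
        finally show ?case by simp
      qed
      then show ?thesis by (rule bigoI)
    qed
    ultimately obtain F where F: "F holomorphic_on UNIV" "\<And>z. z \<notin> q \<Longrightarrow> F z = P z * Q z"
      using removable_singularities[OF fq, of UNIV "\<lambda>z. P z * Q z"] by auto
    \<comment> \<open>Growth of order \<open>M\<close> at infinity from \<open>P\<close>, and the
      degree of \<open>Q\<close>.\<close>
    define D where "D = M + M * card q"
    have "bounded q" using fq finite_imp_bounded by blast
    then obtain R1 where R1: "\<And>a. a \<in> q \<Longrightarrow> norm a \<le> R1" by (auto simp: bounded_iff)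
    define A where "A = max (1 / r + 1) (max 1 (R1 + 1))"
    have growth: "norm (F z) \<le> C0 * 2 ^ (M * card q) * norm z ^ D" if "A \<le> norm z" for z
    proof -
      have zA: "norm z > 1 / r" "norm z > R1" "norm z \<ge> 1" using that by (auto simp: A_def)
      then have zq: "z \<notin> q" using R1 by force
      have "norm (Q z) = (\<Prod>a\<in>q. norm (z - a) ^ M)" by (simp add: Q_def prod_norm[symmetric] norm_power)
      also have "\<dots> \<le> (\<Prod>a\<in>q. (2 * norm z) ^ M)"
      proof (rule prod_mono)
        fix a assume "a \<in> q"
        then have "norm (z - a) \<le> 2 * norm z" using norm_triangle_ineq4[of z a] R1[of a] zA by linarith
        then show "0 \<le> norm (z - a) ^ M \<and> norm (z - a) ^ M \<le> (2 * norm z) ^ M"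
            using power_mono[of "norm (z - a)" "2 * norm z" M] by simp
      qed
      also have "\<dots> = 2 ^ (M * card q) * norm z ^ (M * card q)"
        by (simp add: power_mult_distrib power_mult prod_constant)
      finally have "norm (P z) * norm (Q z) \<le> C0 * norm z ^ M * (2 ^ (M * card q) * norm z ^ (M * card q))"
        using far[OF zA(1)] by (intro mult_mono) (auto intro: order_trans[OF norm_ge_zero])
      then show ?thesis using F(2)[OF zq] by (simp add: norm_mult D_def power_add mult_ac)
    qed
    define co where "co k = (deriv ^^ k) F 0 / fact k" for k
    have poly: "F z = (\<Sum>k\<le>D. co k * z ^ k)" for z
      unfolding co_def by (rule Liouville_polynomial[OF F(1) growth])
    have Dle: "D \<le> (card E)\<^sup>2 + (card E)\<^sup>2 * card E"
      unfolding D_def using ME finite_poles(2)[OF g] by (intro add_mono mult_mono) (auto simp: q_def)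
    obtain Z where Z: "finite Z" "card Z > (card E)\<^sup>2 + (card E)\<^sup>2 * card E + card E"
      "\<And>b. b \<in> Z \<Longrightarrow> \<exists>t\<in>K. \<sigma> t = \<sigma> s \<and> (b = m t + l t \<or> b = m t - l t)"
      using many_branch_points[OF s] by blast
    have zero: "F b = 0" if b: "b \<in> Z - q" for b
    proof -
      obtain t where t: "t \<in> K" "\<sigma> t = \<sigma> s" "b = m t + l t \<or> b = m t - l t" using Z(3) b by blast
      have "pt (\<sigma> s c) b = pt c b" using pt_end[OF t(1) cE t(3)] t(2) by simp
      moreover have "(c, \<sigma> s c) \<in> \<Delta>" using neq cE \<sigma>_in[OF s cE] by (simp add: \<Delta>_def)
      ultimately have "P b = 0" unfolding P_def using f\<Delta> by (intro prod_zero bexI[of _ "(c, \<sigma> s c)"]) auto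
      then show ?thesis using F(2) b by simp
    qed
    \<comment> \<open>\<open>F\<close> is known to equal \<open>P * Q\<close> only off
      \<open>q\<close>, so branch points in \<open>q\<close> are discarded; there are at most
      \<open>card E\<close> of them.\<close>
    have cardZ: "card (Z - q) > D"
    proof -
      have "card Z - card q \<le> card (Z - q)" by (rule diff_card_le_card_Diff[OF fq])
      moreover have "card q \<le> card E" using finite_poles(2)[OF g] by (simp add: q_def)
      ultimately show ?thesis using Z(2) Dle by linarith
    qed
    have "co k = 0" if "k \<le> D" for k
    proof (rule ccontr)
      assume "co k \<noteq> 0"
      then have "\<exists>k\<le>D. co k \<noteq> 0" using that by blast
      from polyfun_rootbound[OF this]
      have fin: "finite {z. (\<Sum>i\<le>D. co i * z ^ i) = 0}" "card {z. (\<Sum>i\<le>D. co i * z ^ i) = 0} \<le> D" by auto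
      moreover have "Z - q \<subseteq> {z. (\<Sum>i\<le>D. co i * z ^ i) = 0}" using zero poly by auto
      ultimately show False using card_mono[OF fin(1)] cardZ by (meson leD le_trans)
    qed
    then have "F w0 = 0" using poly by simp
    moreover have "Q w0 \<noteq> 0" using w0(1) fq by (auto simp: Q_def)
    ultimately show False using F(2)[of w0] w0 by auto
  qed
  have "eqv c d"
  proof (rule \<sigma>_transitive[of "eqv c" c d])
    fix s e assume "s \<in> K" "e \<in> E" "eqv c e"
    then show "eqv c (\<sigma> s e)" using main[of s e] unfolding eqv_def by metis
  qed (use c d in \<open>auto simp: eqv_def\<close>)
  then show ?thesis using z by (auto simp: eqv_def u_def q_def)
qed

end

section \<open>Rigidity over the sphere\<close>

lemma eventually_not_in_finite:
  assumes "finite F"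
  shows "\<forall>\<^sub>F x in at (a::complex). x \<notin> F"
proof -
  have "open (- (F - {a}))" by (rule open_Compl[OF finite_imp_closed[OF finite_Diff[OF assms]]])
  then show ?thesis unfolding eventually_at_topological by (intro exI[of _ "- (F - {a})"]) auto
qed

lemma eventually_far:
  assumes "finite F"
  shows "\<forall>\<^sub>F w in at (0::complex). w \<noteq> 0 \<and> 1 / w \<notin> F"
proof -
  have "\<forall>\<^sub>F w in at (0::complex). w \<notin> insert 0 ((\<lambda>a. 1 / a) ` F)"
    using assms by (intro eventually_not_in_finite) auto
  then show ?thesis by (rule eventually_mono) force
qed

lemma linear_growth_imp_affine:
  assumes "F holomorphic_on UNIV" "\<And>z. A \<le> norm z \<Longrightarrow> norm (F z) \<le> B * norm z"
  shows "\<exists>a b. \<forall>z. F z = a * z + b"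
proof -
  have "F z = (\<Sum>k\<le>1. (deriv ^^ k) F 0 / fact k * z ^ k)" for z
    using assms by (intro Liouville_polynomial[of F A B]) auto
  moreover have "(\<Sum>k\<le>1. (deriv ^^ k) F 0 / fact k * z ^ k) = deriv F 0 * z + F 0" for z by simp
  ultimately have "F z = deriv F 0 * z + F 0" for z by metis
  then show ?thesis by blast
qed

lemma bounded_at_infinity:
  fixes f :: "complex \<Rightarrow> complex"
  assumes "((\<lambda>w. f (1 / w)) \<longlongrightarrow> k) (at 0)"
  shows "\<exists>A B. \<forall>z. A \<le> norm z \<longrightarrow> norm (f z) \<le> B"
proof -
  obtain B where "\<forall>\<^sub>F w in at 0. norm (f (1 / w)) \<le> B" using tendsto_imp_eventually_bounded[OF assms] by blast
  then obtain r where r: "r > 0" "\<And>w. w \<noteq> 0 \<Longrightarrow> norm w < r \<Longrightarrow> norm (f (1 / w)) \<le> B"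
    by (auto simp: eventually_at)
  have "norm (f z) \<le> B" if "1 / r + 1 \<le> norm z" for z
  proof -
    have "1 / r > 0" using r(1) by simp
    then have "norm z > 1 / r" "norm z > 0" using that by linarith+
    then have "norm (1 / z) < r" using r(1) by (simp add: norm_divide field_simps)
    then show ?thesis using r(2)[of "1 / z"] \<open>norm z > 0\<close> by simp
  qed
  then show ?thesis by blast
qed

context slit_cover
begin

definition branch_set :: "complex set" where
  "branch_set = {b. \<exists>s\<in>K. b = m s + l s \<or> b = m s - l s}"

end

text \<open>\<open>mobius_rigid\<close> isolates what the placement of the slits has to achieve: the
  only Moebius transformation mapping the finite branch set into itself is the identity.\<close>

locale rigid_closed_cover = closed_cover +
  assumes K_nonempty: "K \<noteq> {}"
    and mobius_rigid: "\<And>a b c d. \<lbrakk>a * d \<noteq> b * c;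
      \<And>z. z \<in> branch_set \<Longrightarrow> c * z + d \<noteq> 0 \<and> (a * z + b) / (c * z + d) \<in> branch_set\<rbrakk> \<Longrightarrow> c = 0 \<and> b = 0 \<and> a = d"
begin

lemma closed_descends:
  assumes g: "biholo g"
  obtains H where "H holomorphic_on - poles g"
    "\<And>c z. \<lbrakk>c \<in> E; z \<notin> poles g\<rbrakk> \<Longrightarrow> \<exists>d\<in>E. g (pt c z) = pt d (H z)"
proof -
  let ?V = "UNIV - poles g"
  let ?u = "\<lambda>p. proj (g p)"
  have oV: "open ?V" using finite_poles(1)[OF g] by (simp add: finite_imp_closed open_Diff)
  have t: "g (pt c z) \<in> tube UNIV" if "c \<in> E" "z \<in> ?V" for c z using not_pole[OF g] that by blast
  have u: "holo_over ?V ?u" using holo_over_biholo[OF g subset_UNIV] t by blast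
  have val: "\<exists>d\<in>E. g (pt c z) = pt d (?u (pt c z))" if "c \<in> E" "z \<in> ?V" for c z
    using tube_UNIV_cases[OF t[OF that]] by (metis proj_pt)
  have agree0: "?u (pt c z) = ?u (pt d z)" if "c \<in> E" "d \<in> E" "z \<in> ?V \<inter> Y0" for c d z
    using sheets_agree_closed[OF g] that by blast
  obtain c0 where c0: "c0 \<in> E" using E_nonempty by blast
  show ?thesis
  proof (rule that[of "\<lambda>z. ?u (pt c0 z)"])
    show "(\<lambda>z. ?u (pt c0 z)) holomorphic_on - poles g"
      using sheets_agree(2)[OF oV subset_UNIV u agree0 c0] by (simp add: Compl_eq_Diff_UNIV)
    show "\<exists>d\<in>E. g (pt c z) = pt d (?u (pt c0 z))" if "c \<in> E" "z \<notin> poles g" for c z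
      using val[of c z] sheets_agree(1)[OF oV subset_UNIV u agree0 that(1) c0, of z] that by auto
  qed
qed

lemma some_chart: obtains s where "s \<in> K" "z \<in> Ys s"
  using Y_cases[OF UNIV_I, of z] Ys_eq K_nonempty by (metis UnI1 ex_in_conv)

text \<open>Away from the poles \<open>proj \<circ> g\<close> does not depend on the sheet, so it
  cannot tend to infinity on one sheet and to a finite value on another.\<close>

lemma pole_fibre:
  assumes g: "biholo g" and z: "z \<in> poles g" and c: "c \<in> E"
  shows "g (pt c z) \<in> infp ` E"
proof (rule ccontr)
  assume no: "g (pt c z) \<notin> infp ` E"
  obtain H where H: "\<And>c z. \<lbrakk>c \<in> E; z \<notin> poles g\<rbrakk> \<Longrightarrow> \<exists>d\<in>E. g (pt c z) = pt d (H z)"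
    using closed_descends[OF g] by metis
  obtain s where s: "s \<in> K" "z \<in> Ys s" by (rule some_chart)
  obtain \<zeta> where \<zeta>: "\<zeta> \<in> DA s" "J s \<zeta> = z" "\<And>c. c \<in> E \<Longrightarrow> par (An s c) \<zeta> = pt c z"
    using par_cover_all[OF s] by metis
  obtain c1 d where c1: "c1 \<in> E" "d \<in> E" "g (pt c1 z) = infp d" using z by (auto simp: poles_def)
  have "g (pt c z) \<in> X" using biholo_in_X[OF g pt_in_X[OF c UNIV_I]] .
  then obtain e w where e: "e \<in> E" "g (pt c z) = pt e w" using no by (cases rule: X_cases) auto
  have 1: "filterlim (\<lambda>x. proj (g (par (An s c1) x))) at_infinity (at \<zeta>)"
    using \<zeta> c1 s by (intro biholo_tends_to_infinity[OF g, of _ _ d]) (auto simp: Idx_intros simp del: par.simps)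
  have 2: "((\<lambda>x. proj (g (par (An s c) x))) \<longlongrightarrow> w) (at \<zeta>)"
    using \<zeta> c e s by (intro biholo_tendsto[OF g, of _ _ e]) (auto simp: Idx_intros simp del: par.simps)
  have "\<forall>\<^sub>F x in at \<zeta>. x \<notin> insert 0 {x. x \<noteq> 0 \<and> J s x \<in> poles g}"
    using finite_J_fibres[OF s(1) finite_poles(1)[OF g]] by (intro eventually_not_in_finite) auto
  then have "\<forall>\<^sub>F x in at \<zeta>. proj (g (par (An s c1) x)) = proj (g (par (An s c) x))"
  proof (rule eventually_mono)
    fix x assume "x \<notin> insert 0 {x. x \<noteq> 0 \<and> J s x \<in> poles g}"
    then have "J s x \<notin> poles g" by auto
    then have "proj (g (pt d (J s x))) = H (J s x)" if "d \<in> E" for d using H[OF that] by fastforce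
    then show "proj (g (par (An s c1) x)) = proj (g (par (An s c) x))"
      using par_An_cases[of s c1 x] par_An_cases[of s c x] c c1(1) \<sigma>_in[OF s(1)] by metis
  qed
  then have "filterlim (\<lambda>x. proj (g (par (An s c) x))) at_infinity (at \<zeta>)"
    by (rule filterlim_mono_eventually[OF 1 order_refl order_refl])
  then show False using 2 not_tendsto_and_filterlim_at_infinity trivial_limit_at by blast
qed

text \<open>The inverse of \<open>g\<close> descends as well, so its projections on different sheets
  have the same limit at infinity. One sheet gives the limit \<open>z\<close>, and then all
  do.\<close>

lemma inverse_at_infinity:
  assumes g: "biholo g" and z: "z \<in> poles g" and d: "d \<in> E"
  shows "\<exists>e\<in>E. inv_into X g (infp d) = pt e z"
proof -
  let ?g = "inv_into X g"
  note g' = biholo_inv(1)[OF g]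
  obtain H where H: "\<And>c z. \<lbrakk>c \<in> E; z \<notin> poles ?g\<rbrakk> \<Longrightarrow> \<exists>d\<in>E. ?g (pt c z) = pt d (H z)"
    using closed_descends[OF g'] by metis
  obtain c d0 where c: "c \<in> E" "d0 \<in> E" "g (pt c z) = infp d0" using z by (auto simp: poles_def)
  then have g0: "?g (infp d0) = pt c z" using biholo_inv(2)[OF g pt_in_X[OF c(1) UNIV_I]] by metis
  have z0: "0 \<in> dom (In e)" for e using R0_pos by simp
  have 1: "((\<lambda>x. proj (?g (par (In d0) x))) \<longlongrightarrow> z) (at 0)"
    using c g0 z0 by (intro biholo_tendsto[OF g', of _ _ c]) (auto simp: Idx_intros)
  have ev: "\<forall>\<^sub>F x in at 0. proj (?g (par (In d0) x)) = proj (?g (par (In d) x))"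
    using eventually_far[OF finite_poles(1)[OF g']]
  proof (rule eventually_mono)
    fix w assume w: "w \<noteq> (0::complex) \<and> 1 / w \<notin> poles ?g"
    then have "proj (?g (pt d (1 / w))) = H (1 / w)" if "d \<in> E" for d using H[OF that, of "1 / w"] by fastforce
    then show "proj (?g (par (In d0) w)) = proj (?g (par (In d) w))" using w c(2) d by simp
  qed
  then have 2: "((\<lambda>x. proj (?g (par (In d) x))) \<longlongrightarrow> z) (at 0)" by (rule Lim_transform_eventually[OF 1])
  have "?g (infp d) \<in> X" using biholo_in_X[OF g' infp_in_X[OF d]] .
  then show ?thesis
  proof (cases rule: X_cases)
    case (1 e w)
    have "((\<lambda>x. proj (?g (par (In d) x))) \<longlongrightarrow> w) (at 0)"
      using d 1 z0 by (intro biholo_tendsto[OF g', of _ _ e]) (auto simp: Idx_intros)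
    then have "w = z" using 2 tendsto_unique trivial_limit_at by blast
    then show ?thesis using 1 by blast
  next
    case (2 e)
    have "filterlim (\<lambda>x. proj (?g (par (In d) x))) at_infinity (at 0)"
      using d 2 z0 by (intro biholo_tends_to_infinity[OF g', of _ _ e]) (auto simp: Idx_intros)
    then show ?thesis using \<open>((\<lambda>x. proj (?g (par (In d) x))) \<longlongrightarrow> z) (at 0)\<close>
        not_tendsto_and_filterlim_at_infinity trivial_limit_at by blast
  qed
qed

lemma pole_unique:
  assumes g: "biholo g" and z: "z \<in> poles g" "z' \<in> poles g"
  shows "z' = z"
proof -
  obtain d where d: "d \<in> E" using E_nonempty by blast
  obtain e e' where "e \<in> E" "inv_into X g (infp d) = pt e z" "e' \<in> E" "inv_into X g (infp d) = pt e' z'"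
    using inverse_at_infinity[OF g _ d] z by metis
  then show ?thesis by (metis proj_pt)
qed

text \<open>If \<open>g (infp c)\<close> were at infinity, the inverse would send this point both to
  \<open>infp c\<close> and to a point over \<open>z\<close>.\<close>

lemma finite_at_infinity:
  assumes g: "biholo g" and z: "z \<in> poles g" and c: "c \<in> E"
  obtains d w where "d \<in> E" "g (infp c) = pt d w"
proof -
  have "g (infp c) \<in> X" using biholo_in_X[OF g infp_in_X[OF c]] .
  then show ?thesis
  proof (cases rule: X_cases)
    case (1 d w)
    then show ?thesis using that by blast
  next
    case (2 d)
    then have "inv_into X g (infp d) = infp c" using biholo_inv(2)[OF g infp_in_X[OF c]] by metis
    then show ?thesis using inverse_at_infinity[OF g z 2(1)] infp_neq_pt[OF c] by metis
  qed
qed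

text \<open>There is at most one pole. Without poles \<open>H\<close> is entire of linear growth,
  hence affine; with the pole \<open>p\<close> the same holds for \<open>H z * (z - p)\<close>.
  Injectivity excludes a constant, which gives the determinant condition.\<close>

lemma mobius_form:
  assumes g: "biholo g" and H: "H holomorphic_on - poles g"
    "\<And>c z. \<lbrakk>c \<in> E; z \<notin> poles g\<rbrakk> \<Longrightarrow> \<exists>d\<in>E. g (pt c z) = pt d (H z)"
  obtains a b c d where "a * d \<noteq> b * c" "poles g \<noteq> {} \<Longrightarrow> c \<noteq> 0"
    "\<And>z. z \<notin> poles g \<Longrightarrow> c * z + d \<noteq> 0 \<and> H z = (a * z + b) / (c * z + d)"
proof -
  obtain c0 where c0: "c0 \<in> E" using E_nonempty by blast
  let ?g = "inv_into X g"
  note g' = biholo_inv(1)[OF g]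
  obtain H' where H': "\<And>c z. \<lbrakk>c \<in> E; z \<notin> poles ?g\<rbrakk> \<Longrightarrow> \<exists>d\<in>E. ?g (pt c z) = pt d (H' z)"
    using closed_descends[OF g'] by metis
  have "H' (H z) = z" if z: "z \<notin> poles g" for z
  proof -
    obtain d where d: "d \<in> E" "g (pt c0 z) = pt d (H z)" using H(2)[OF c0 z] by blast
    then have eq: "?g (pt d (H z)) = pt c0 z" using biholo_inv(2)[OF g pt_in_X[OF c0 UNIV_I]] by metis
    then have "H z \<notin> poles ?g" using pole_fibre[OF g' _ d(1)] infp_neq_pt[OF _ c0] by (metis imageE)
    then obtain e where "e \<in> E" "?g (pt d (H z)) = pt e (H' (H z))" using H'[OF d(1)] by blast
    then show ?thesis using eq c0 by (metis proj_pt)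
  qed
  then have Hinj: "inj_on H (- poles g)" by (intro inj_on_inverseI[where g = H']) auto
  have nonconst: "\<not> (\<forall>z\<in>- poles g. H z = k)" for k
  proof
    assume k: "\<forall>z\<in>- poles g. H z = k"
    have "infinite (- poles g)" using finite_poles(1)[OF g] infinite_UNIV_char_0 by (metis Compl_eq_Diff_UNIV Diff_infinite_finite)
    then obtain x where x: "x \<in> - poles g" using infinite_imp_nonempty by blast
    then have "infinite (- poles g - {x})" using \<open>infinite (- poles g)\<close> by simp
    then obtain y where "y \<in> - poles g" "y \<noteq> x" using infinite_imp_nonempty by blast
    then show False using x k Hinj by (metis inj_onD)
  qed
  have val: "proj (g (pt d z)) = H z" if "d \<in> E" "z \<notin> poles g" for d z using H(2)[OF that] by fastforce
  have z0: "0 \<in> dom (In c0)" using R0_pos by simp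
  have I0: "In c0 \<in> Idx" using c0 by (simp add: Idx_intros)
  have evI: "\<forall>\<^sub>F w in at 0. w \<noteq> 0 \<and> proj (g (par (In c0) w)) = H (1 / w)"
    using eventually_far[OF finite_poles(1)[OF g]] by (rule eventually_mono) (use val c0 in auto)
  show ?thesis
  proof (cases "poles g = {}")
    case True
    obtain L where L: "((\<lambda>w. proj (g (par (In c0) w)) * (w - 0)) \<longlongrightarrow> L) (at 0)"
      using biholo_simple_pole[OF g I0 z0] by blast
    have "((\<lambda>w. H (1 / w) / (1 / w)) \<longlongrightarrow> L) (at 0)"
      by (rule Lim_transform_eventually[OF L]) (use evI in \<open>auto elim: eventually_mono\<close>)
    from bounded_at_infinity[of "\<lambda>z. H z / z", OF this]
    obtain A B where AB: "\<And>z. A \<le> norm z \<Longrightarrow> norm (H z / z) \<le> B" by blast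
    have "norm (H z) \<le> B * norm z" if "max A 1 \<le> norm z" for z
    proof -
      have "norm (H z) / norm z \<le> B" "norm z > 0" using AB[of z] that by (auto simp: norm_divide)
      then show ?thesis by (simp add: pos_divide_le_eq)
    qed
    moreover have "H holomorphic_on UNIV" using H(1) True by simp
    ultimately obtain a b where ab: "\<And>z. H z = a * z + b" using linear_growth_imp_affine by metis
    have "a \<noteq> 0" using nonconst[of b] ab by auto
    then show ?thesis using that[of a 1 b 0] True ab by simp
  next
    case False
    then obtain p where "p \<in> poles g" by blast
    then have p: "poles g = {p}" using pole_unique[OF g] by blast
    obtain s where s: "s \<in> K" "p \<in> Ys s" by (rule some_chart)
    obtain \<zeta> where \<zeta>: "\<zeta> \<in> DA s" "J s \<zeta> = p" using par_cover_all[OF s] by metis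
    have nz: "\<zeta> \<noteq> 0" using \<zeta> by (auto simp: DA_iff)
    have iA: "An s c0 \<in> Idx" using s c0 by (simp add: Idx_intros)
    have "\<zeta> \<in> dom (An s c0)" using \<zeta> by simp
    then obtain L where L: "((\<lambda>x. proj (g (par (An s c0) x)) * (x - \<zeta>)) \<longlongrightarrow> L) (at \<zeta>)"
      using biholo_simple_pole[OF g iA] by blast
    have "((\<lambda>x. (J s x - J s \<zeta>) / (x - \<zeta>)) \<longlongrightarrow> l s * (1 - 1 / \<zeta>\<^sup>2) / 2) (at \<zeta>)"
      using jk_has_field_derivative[OF nz, of "m s" "l s"] by (simp add: has_field_derivative_iff)
    with L have "((\<lambda>x. proj (g (par (An s c0) x)) * (x - \<zeta>) * ((J s x - J s \<zeta>) / (x - \<zeta>))) \<longlongrightarrow> L * (l s * (1 - 1 / \<zeta>\<^sup>2) / 2)) (at \<zeta>)"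
      by (rule tendsto_mult)
    then obtain C where C: "\<forall>\<^sub>F x in at \<zeta>. norm (proj (g (par (An s c0) x)) * (x - \<zeta>) * ((J s x - J s \<zeta>) / (x - \<zeta>))) \<le> C"
      using tendsto_imp_eventually_bounded by blast
    have "\<forall>\<^sub>F x in at \<zeta>. x \<notin> insert \<zeta> (insert 0 {x. x \<noteq> 0 \<and> J s x \<in> poles g})"
      using finite_J_fibres[OF s(1) finite_poles(1)[OF g]] by (intro eventually_not_in_finite) auto
    with C have "\<forall>\<^sub>F x in at \<zeta>. norm (H (J s x) * (J s x - p)) \<le> C"
    proof eventually_elim
      case (elim x)
      then have "J s x \<notin> poles g" "x \<noteq> \<zeta>" by auto
      then have "proj (g (par (An s c0) x)) = H (J s x)"
        using par_An_cases[of s c0 x] val c0 \<sigma>_in[OF s(1) c0] by metis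
      then show ?case using elim(1) \<open>x \<noteq> \<zeta>\<close> \<zeta>(2) by simp
    qed
    then have "\<forall>\<^sub>F z in at (J s \<zeta>). norm (H z * (z - p)) \<le> C" by (rule eventually_at_J[OF s(1) \<zeta>(1)])
    then have bd: "\<exists>C. \<forall>\<^sub>F z in at p. norm (H z * (z - p)) \<le> C" using \<zeta>(2) by auto
    have "(\<lambda>z. H z * (z - p)) holomorphic_on UNIV - {p}"
      using H(1) p by (intro holomorphic_intros) (simp add: Compl_eq_Diff_UNIV)
    then obtain F where F: "F holomorphic_on UNIV" "\<And>z. z \<noteq> p \<Longrightarrow> F z = H z * (z - p)"
      using holomorphic_on_extend_bounded[of "\<lambda>z. H z * (z - p)" UNIV p] bd by auto
    obtain e w where e: "e \<in> E" "g (infp c0) = pt e w" using finite_at_infinity[OF g \<open>p \<in> poles g\<close> c0] by blast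
    have "((\<lambda>x. proj (g (par (In c0) x))) \<longlongrightarrow> w) (at 0)"
      using e by (intro biholo_tendsto[OF g I0 z0, of e]) auto
    then have "((\<lambda>x. H (1 / x)) \<longlongrightarrow> w) (at 0)"
      by (rule Lim_transform_eventually) (use evI in \<open>auto elim: eventually_mono\<close>)
    from bounded_at_infinity[of H, OF this]
    obtain A B where AB: "\<And>z. A \<le> norm z \<Longrightarrow> norm (H z) \<le> B" by blast
    have "norm (F z) \<le> 2 * B * norm z" if "max A (norm p + 1) \<le> norm z" for z
    proof -
      have z: "A \<le> norm z" "norm p < norm z" using that by auto
      then have "norm (z - p) \<le> 2 * norm z" using norm_triangle_ineq4[of z p] by linarith
      moreover have "0 \<le> B" using AB[OF z(1)] norm_ge_zero order_trans by blast
      ultimately have "norm (H z) * norm (z - p) \<le> B * (2 * norm z)" using AB[OF z(1)] by (intro mult_mono) auto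
      moreover have "z \<noteq> p" using z by auto
      ultimately show ?thesis using F(2) by (simp add: norm_mult mult_ac)
    qed
    then obtain a b where ab: "\<And>z. F z = a * z + b" using linear_growth_imp_affine[OF F(1)] by metis
    have Hz: "H z = (a * z + b) / (1 * z + - p)" "1 * z + - p \<noteq> 0" if "z \<notin> poles g" for z
      using that F(2)[of z] ab[of z] p by (auto simp: field_simps)
    have "a * - p \<noteq> b * 1"
    proof
      assume "a * - p = b * 1"
      then have b: "b = - (a * p)" by simp
      have eq: "a * z + b = a * (1 * z + - p)" for z unfolding b by (simp add: algebra_simps)
      have "H z = a" if "z \<in> - poles g" for z
        using Hz[of z] that unfolding eq by simp
      then show False using nonconst by blast
    qed
    then show ?thesis using that[of a "- p" b 1] Hz by auto
  qed
qed

text \<open>Branch points are sent to finite branch points, so none is a pole and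
  \<open>mobius_rigid\<close> applies to the map of the base. Its conclusion \<open>e = 0\<close>
  also rules out poles.\<close>

theorem closed_rigid:
  assumes g: "biholo g" and c: "c \<in> E"
  shows "\<exists>d\<in>E. g (pt c z) = pt d z"
proof -
  obtain H where H: "H holomorphic_on - poles g"
    "\<And>c z. \<lbrakk>c \<in> E; z \<notin> poles g\<rbrakk> \<Longrightarrow> \<exists>d\<in>E. g (pt c z) = pt d (H z)"
    using closed_descends[OF g] by metis
  obtain a b e f where mf: "a * f \<noteq> b * e" "poles g \<noteq> {} \<Longrightarrow> e \<noteq> 0"
    "\<And>z. z \<notin> poles g \<Longrightarrow> e * z + f \<noteq> 0 \<and> H z = (a * z + b) / (e * z + f)"
    using mobius_form[OF g H] by metis
  have br: "x \<notin> poles g \<and> H x \<in> branch_set" if x: "x \<in> branch_set" for x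
  proof -
    obtain s where s: "s \<in> K" "x = m s + l s \<or> x = m s - l s" using x by (auto simp: branch_set_def)
    \<comment> \<open>That \<open>x\<close> is not a pole is still to be shown, so only the other
      poles are removed; \<open>branch_point_image\<close> asks for the descent only away from
      \<open>x\<close>.\<close>
    have oB: "open (- (poles g - {x}))" by (rule open_Compl[OF finite_imp_closed[OF finite_Diff[OF finite_poles(1)[OF g]]]])
    obtain d t w where w: "d \<in> E" "t \<in> K" "w = m t + l t \<or> w = m t - l t" "g (pt c x) = pt d w"
    proof (rule branch_point_image[OF g s(1) c s(2) oB])
      show "proj (g (pt d z)) = H z" if "d \<in> E" "z \<in> - (poles g - {x})" "z \<noteq> x" for d z
        using H(2)[OF that(1), of z] that by fastforce
    qed auto
    have np: "x \<notin> poles g" using pole_fibre[OF g _ c] w infp_neq_pt[OF _ w(1)] by (metis imageE)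
    then have "H x = w" using H(2)[OF c np] w by (metis proj_pt)
    then show ?thesis using np w by (auto simp: branch_set_def)
  qed
  have "e = 0 \<and> b = 0 \<and> a = f"
    by (rule mobius_rigid[OF mf(1)]) (use br mf(3) in metis)
  then have "poles g = {}" "H z = z" using mf by auto
  then show ?thesis using H(2)[OF c, of z] by simp
qed

end

section \<open>Labelling the sheets by a group\<close>

text \<open>The sheets are labelled by \<open>A \<times> {0..5}\<close>. The permutation \<open>switch k\<close> applies the
  \<open>k\<close>-th of four perfect matchings of \<open>{0..5}\<close> to the index, or, for \<open>k \<ge> 4\<close>, the matching
  \<open>0\<close> with the edge \<open>{0, 1}\<close> twisted by a generator. The product of the four matchings fixes only
  the index \<open>0\<close>, which makes every permutation commuting with all switches a left translation.\<close>

definition matching :: "nat \<Rightarrow> nat \<Rightarrow> nat" where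
  "matching k i = ([[1, 0, 3, 2, 5, 4], [1, 0, 4, 5, 2, 3], [2, 3, 0, 1, 5, 4], [2, 5, 0, 4, 3, 1]] ! k) ! i"

lemma less_6_cases:
  assumes "i < (6::nat)"
  obtains "i = 0" | "i = 1" | "i = 2" | "i = 3" | "i = 4" | "i = 5"
  using assms by linarith

lemma less_4_cases:
  assumes "k < (4::nat)"
  obtains "k = 0" | "k = 1" | "k = 2" | "k = 3"
  using assms by linarith

lemma matching:
  assumes "k < 4" "i < 6"
  shows "matching k i < 6" "matching k (matching k i) = i" "matching k i \<noteq> i"
  by (rule less_4_cases[OF assms(1)]; rule less_6_cases[OF assms(2)]; simp add: matching_def)+

lemma matching_word:
  assumes "i < 6"
  shows "matching 3 (matching 2 (matching 1 (matching 0 i))) = i \<longleftrightarrow> i = 0"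
  using assms by (cases rule: less_6_cases) (simp_all add: matching_def)

lemma matching_connected:
  assumes "Q 0" "\<And>k i. \<lbrakk>k < 4; i < 6; Q i\<rbrakk> \<Longrightarrow> Q (matching k i)" "i < 6"
  shows "Q i"
proof -
  have *: "matching 0 0 = 1" "matching 2 0 = 2" "matching 2 1 = 3" "matching 1 2 = 4" "matching 1 3 = 5"
    by (simp_all add: matching_def)
  have "Q 1" using assms(2)[of 0 0] assms(1) * by simp
  moreover have "Q 2" using assms(2)[of 2 0] assms(1) * by simp
  moreover have "Q 3" using assms(2)[of 2 1] calculation * by simp
  moreover have "Q 4" using assms(2)[of 1 2] calculation * by simp
  moreover have "Q 5" using assms(2)[of 1 3] calculation * by simp
  ultimately show ?thesis using assms(1,3) by (elim less_6_cases) auto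
qed

text \<open>The matchings are involutions, so reachability is symmetric; the complement of
  \<open>Q\<close> is closed under them too.\<close>

lemma matching_connected_to_0:
  assumes "Q i" "\<And>k i. \<lbrakk>k < 4; i < 6; Q i\<rbrakk> \<Longrightarrow> Q (matching k i)" "i < 6"
  shows "Q 0"
proof (rule ccontr)
  assume n: "\<not> Q 0"
  have "\<not> Q i"
  proof (rule matching_connected[of "\<lambda>i. \<not> Q i", OF n _ assms(3)])
    fix k i :: nat assume k: "k < 4" "i < (6::nat)" "\<not> Q i"
    then show "\<not> Q (matching k i)" using assms(2)[of k "matching k i"] matching[OF k(1,2)] by auto
  qed
  then show False using assms(1) by blast
qed

locale generated_labels = group A for A (structure) +
  fixes xs :: "'a list"
  assumes xs_carrier: "set xs \<subseteq> carrier A" and generated: "generate A (set xs) = carrier A"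
begin

definition labels :: "('a \<times> nat) set" where "labels = carrier A \<times> {..<6}"

definition ntypes :: nat where "ntypes = 4 + length xs"

definition switch :: "nat \<Rightarrow> 'a \<times> nat \<Rightarrow> 'a \<times> nat" where
  "switch k c = (if k < 4 then (fst c, matching k (snd c))
     else if snd c = 0 then (fst c \<otimes> xs ! (k - 4), 1)
     else if snd c = 1 then (fst c \<otimes> inv (xs ! (k - 4)), 0)
     else (fst c, matching 0 (snd c)))"

definition translate :: "'a \<Rightarrow> 'a \<times> nat \<Rightarrow> 'a \<times> nat" where
  "translate a c = (a \<otimes> fst c, snd c)"

lemma gen_closed: "k < ntypes \<Longrightarrow> \<not> k < 4 \<Longrightarrow> xs ! (k - 4) \<in> carrier A"
  using xs_carrier by (auto simp: ntypes_def)

lemma matching_0_other: "i < 6 \<Longrightarrow> i \<noteq> 0 \<Longrightarrow> i \<noteq> 1 \<Longrightarrow> matching 0 i \<noteq> 0 \<and> matching 0 i \<noteq> 1"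
  by (elim less_6_cases) (simp_all add: matching_def)

lemma switch:
  assumes k: "k < ntypes" and c: "c \<in> labels"
  shows "switch k c \<in> labels" "switch k (switch k c) = c" "switch k c \<noteq> c"
    and "a \<in> carrier A \<Longrightarrow> translate a (switch k c) = switch k (translate a c)"
proof -
  obtain x i where xi: "c = (x, i)" "x \<in> carrier A" "i < 6" using c by (auto simp: labels_def)
  have m0: "matching 0 i < 6" "matching 0 (matching 0 i) = i" "matching 0 i \<noteq> i" using matching[of 0] xi by auto
  show "switch k c \<in> labels" "switch k (switch k c) = c" "switch k c \<noteq> c"
    using xi gen_closed[OF k] m0 matching_0_other[OF xi(3)] matching[of k i]
    by (auto simp: switch_def labels_def m_assoc)
  show "translate a (switch k c) = switch k (translate a c)" if "a \<in> carrier A"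
    using xi gen_closed[OF k] that by (auto simp: switch_def translate_def m_assoc)
qed

lemma switch_matching: "k < 4 \<Longrightarrow> switch k (x, i) = (x, matching k i)"
  by (simp add: switch_def)

lemma ntypes_4: "k < 4 \<Longrightarrow> k < ntypes"
  by (simp add: ntypes_def)

lemma switch_gen:
  assumes "h \<in> set xs"
  obtains k where "k < ntypes" "\<And>x. switch k (x, 0) = (x \<otimes> h, 1)" "\<And>x. switch k (x, 1) = (x \<otimes> inv h, 0)"
proof -
  obtain j where "j < length xs" "h = xs ! j" using assms by (auto simp: in_set_conv_nth)
  then show ?thesis using that[of "j + 4"] by (simp add: ntypes_def switch_def)
qed

text \<open>Matchings connect all indices over one group element, and the twisted edges lead from
  \<open>x\<close> to \<open>x \<otimes> h\<close> or \<open>x \<otimes> inv h\<close>. Generation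
  then connects \<open>x\<close> to \<open>x \<otimes> (inv x \<otimes> y) = y\<close>.\<close>

lemma switch_transitive:
  assumes Q: "Q c0" "c0 \<in> labels" and step: "\<And>k c. \<lbrakk>k < ntypes; c \<in> labels; Q c\<rbrakk> \<Longrightarrow> Q (switch k c)"
    and c: "c \<in> labels"
  shows "Q c"
proof -
  obtain x i where xi: "c0 = (x, i)" "x \<in> carrier A" "i < 6" using Q(2) by (auto simp: labels_def)
  obtain y j where yj: "c = (y, j)" "y \<in> carrier A" "j < 6" using c by (auto simp: labels_def)
  have mstep: "Q (x, matching k i)" if "k < 4" "i < 6" "x \<in> carrier A" "Q (x, i)" for x k i
    using step[OF ntypes_4[OF that(1)], of "(x, i)"] switch_matching[OF that(1)] that by (simp add: labels_def)
  have to0: "Q (x, 0)" if "x \<in> carrier A" "i < 6" "Q (x, i)" for x i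
    by (rule matching_connected_to_0[of "\<lambda>i. Q (x, i)" i]) (use that mstep in auto)
  have from0: "Q (x, i)" if "x \<in> carrier A" "i < 6" "Q (x, 0)" for x i
    by (rule matching_connected[of "\<lambda>i. Q (x, i)"]) (use that mstep in auto)
  have gen: "\<forall>x\<in>carrier A. Q (x, 0) \<longrightarrow> Q (x \<otimes> h, 0)" if "h \<in> generate A (set xs)" for h
    using that
  proof (induction rule: generate.induct)
    case one
    then show ?case by simp
  next
    case (incl h)
    then have h: "h \<in> carrier A" using xs_carrier by blast
    obtain k where k: "k < ntypes" "\<And>x. switch k (x, 0) = (x \<otimes> h, 1)" using switch_gen[OF incl] by metis
    show ?case
    proof (intro ballI impI)
      fix x assume x: "x \<in> carrier A" "Q (x, 0)"
      then have "Q (x \<otimes> h, 1)" using step[OF k(1), of "(x, 0)"] k(2) by (simp add: labels_def)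
      then show "Q (x \<otimes> h, 0)" using to0[of "x \<otimes> h" 1] x h by simp
    qed
  next
    case (inv h)
    then have h: "h \<in> carrier A" using xs_carrier by blast
    obtain k where k: "k < ntypes" "\<And>x. switch k (x, 1) = (x \<otimes> inv h, 0)" using switch_gen[OF inv] by metis
    show ?case
    proof (intro ballI impI)
      fix x assume x: "x \<in> carrier A" "Q (x, 0)"
      then have "Q (x, 1)" using from0[of x 1] by simp
      then show "Q (x \<otimes> inv h, 0)" using step[OF k(1), of "(x, 1)"] k(2) x by (simp add: labels_def)
    qed
  next
    case (eng h1 h2)
    then have "h1 \<in> carrier A" "h2 \<in> carrier A" using generated by auto
    then show ?case using eng by (simp add: m_assoc[symmetric])
  qed
  have "Q (x \<otimes> (inv x \<otimes> y), 0)" using gen[of "inv x \<otimes> y"] generated to0[of x i] xi yj Q(1) by simp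
  then have "Q (y, 0)" using xi yj by (simp add: m_assoc[symmetric])
  then show ?thesis using from0 yj by simp
qed

text \<open>Once index \<open>0\<close> is preserved, the matchings give the form
  \<open>(x, i) \<mapsto> (\<phi> x, i)\<close>. The twisted edges give
  \<open>\<phi> (x \<otimes> h) = \<phi> x \<otimes> h\<close>, so \<open>\<phi>\<close> is left
  multiplication by \<open>\<phi> \<one>\<close>.\<close>

lemma commuting_imp_translation:
  assumes \<tau>: "\<And>c. c \<in> labels \<Longrightarrow> \<tau> c \<in> labels"
    and comm: "\<And>k c. \<lbrakk>k < ntypes; c \<in> labels\<rbrakk> \<Longrightarrow> \<tau> (switch k c) = switch k (\<tau> c)"
  shows "\<exists>a\<in>carrier A. \<forall>c\<in>labels. \<tau> c = translate a c"
proof -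
  have "\<exists>y\<in>carrier A. \<tau> (x, 0) = (y, 0)" if x: "x \<in> carrier A" for x
  proof -
    let ?c = "(x, 0 :: nat)"
    have c: "?c \<in> labels" using x by (simp add: labels_def)
    have k: "0 < ntypes" "1 < ntypes" "2 < ntypes" "3 < ntypes" by (simp_all add: ntypes_def)
    have w: "switch 3 (switch 2 (switch 1 (switch 0 (y, i)))) = (y, matching 3 (matching 2 (matching 1 (matching 0 i))))"
      for y i by (simp add: switch_matching)
    have "\<tau> (switch 3 (switch 2 (switch 1 (switch 0 ?c)))) = switch 3 (switch 2 (switch 1 (switch 0 (\<tau> ?c))))"
      using comm k switch(1) c by simp
    moreover have "switch 3 (switch 2 (switch 1 (switch 0 ?c))) = ?c" using w matching_word[of 0] by simp
    ultimately have fix': "switch 3 (switch 2 (switch 1 (switch 0 (\<tau> ?c)))) = \<tau> ?c" by simp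
    obtain y i where yi: "\<tau> ?c = (y, i)" "y \<in> carrier A" "i < 6" using \<tau>[OF c] by (auto simp: labels_def)
    then have "i = 0" using fix' w matching_word[OF yi(3)] by simp
    then show ?thesis using yi by blast
  qed
  then obtain \<phi> where \<phi>: "\<And>x. x \<in> carrier A \<Longrightarrow> \<phi> x \<in> carrier A \<and> \<tau> (x, 0) = (\<phi> x, 0)" by metis
  have \<tau>x: "\<tau> (x, i) = (\<phi> x, i)" if x: "x \<in> carrier A" and i: "i < 6" for x i
  proof (rule matching_connected[of "\<lambda>i. \<tau> (x, i) = (\<phi> x, i)", OF _ _ i])
    fix k i :: nat assume k: "k < 4" "i < (6::nat)" "\<tau> (x, i) = (\<phi> x, i)"
    then show "\<tau> (x, matching k i) = (\<phi> x, matching k i)"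
      using comm[OF ntypes_4[OF k(1)], of "(x, i)"] x switch_matching[OF k(1)] by (simp add: labels_def)
  qed (use \<phi> x in blast)
  have gen: "\<forall>x\<in>carrier A. \<phi> (x \<otimes> h) = \<phi> x \<otimes> h" if "h \<in> generate A (set xs)" for h
    using that
  proof (induction rule: generate.induct)
    case one
    then show ?case using \<phi> by simp
  next
    case (incl h)
    then have h: "h \<in> carrier A" using xs_carrier by blast
    obtain k where k: "k < ntypes" "\<And>x. switch k (x, 0) = (x \<otimes> h, 1)" using switch_gen[OF incl] by metis
    show ?case
    proof
      fix x assume x: "x \<in> carrier A"
      then have "\<tau> (x \<otimes> h, 1) = (\<phi> x \<otimes> h, 1)" using comm[OF k(1), of "(x, 0)"] k(2) \<phi> by (simp add: labels_def)
      then show "\<phi> (x \<otimes> h) = \<phi> x \<otimes> h" using \<tau>x[of "x \<otimes> h" 1] x h by simp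
    qed
  next
    case (inv h)
    then have h: "h \<in> carrier A" using xs_carrier by blast
    obtain k where k: "k < ntypes" "\<And>x. switch k (x, 1) = (x \<otimes> inv h, 0)" using switch_gen[OF inv] by metis
    show ?case
    proof
      fix x assume x: "x \<in> carrier A"
      then have "\<tau> (x \<otimes> inv h, 0) = (\<phi> x \<otimes> inv h, 0)"
        using comm[OF k(1), of "(x, 1)"] k(2) \<tau>x[of x 1] by (simp add: labels_def)
      then show "\<phi> (x \<otimes> inv h) = \<phi> x \<otimes> inv h" using \<phi>[of "x \<otimes> inv h"] x h by simp
    qed
  next
    case (eng h1 h2)
    then have "h1 \<in> carrier A" "h2 \<in> carrier A" using generated by auto
    then show ?case using eng \<phi> by (simp add: m_assoc[symmetric])
  qed
  have \<phi>1: "\<phi> x = \<phi> \<one> \<otimes> x" if "x \<in> carrier A" for x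
    using gen[of x] generated that by (metis l_one one_closed)
  show ?thesis
  proof (intro bexI[of _ "\<phi> \<one>"] ballI)
    fix c assume "c \<in> labels"
    then obtain x i where c: "c = (x, i)" "x \<in> carrier A" "i < 6" by (auto simp: labels_def)
    have "\<tau> c = (\<phi> \<one> \<otimes> x, i)" using \<tau>x[OF c(2,3)] c(1) \<phi>1[OF c(2)] by metis
    then show "\<tau> c = translate (\<phi> \<one>) c" using c(1) by (simp add: translate_def)
  qed (use \<phi>[OF one_closed] in blast)
qed

lemma translate_bij: "a \<in> carrier A \<Longrightarrow> bij_betw (translate a) labels labels"
  by (rule bij_betw_byWitness[where f' = "translate (inv a)"])
    (auto simp: translate_def labels_def m_assoc[symmetric])

text \<open>Every element is the value of a finite word in generators and their inverses. Countably
  many sheets give countably many charts, hence second countability.\<close>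

lemma countable_carrier: "countable (carrier A)"
proof -
  let ?S = "set xs \<union> (\<lambda>h. inv h) ` set xs"
  have S: "?S \<subseteq> carrier A" using xs_carrier by auto
  let ?f = "\<lambda>ys. foldr (\<otimes>) ys \<one>"
  have closed: "?f ys \<in> carrier A" if "ys \<in> lists ?S" for ys
    using that S by (induction ys) auto
  have app: "?f (ys @ zs) = ?f ys \<otimes> ?f zs" if "ys \<in> lists ?S" "zs \<in> lists ?S" for ys zs
    using that(1)
  proof (induction ys)
    case (Cons y ys)
    then have "y \<in> carrier A" "?f ys \<in> carrier A" using S closed[of ys] by auto
    then show ?case using Cons.IH closed[OF that(2)] m_assoc by simp
  qed (use closed[OF that(2)] in simp)
  have "h \<in> ?f ` lists ?S" if "h \<in> generate A (set xs)" for h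
    using that
  proof (induction rule: generate.induct)
    case one
    then show ?case by (intro image_eqI[of _ _ "[]"]) auto
  next
    case (incl h)
    then show ?case using xs_carrier by (intro image_eqI[of _ _ "[h]"]) auto
  next
    case (inv h)
    then show ?case using xs_carrier by (intro image_eqI[of _ _ "[inv h]"]) auto
  next
    case (eng h1 h2)
    then obtain ys zs where "ys \<in> lists ?S" "zs \<in> lists ?S" "h1 = ?f ys" "h2 = ?f zs" by blast
    then show ?case using app by (intro image_eqI[of _ _ "ys @ zs"]) auto
  qed
  then have "carrier A \<subseteq> ?f ` lists ?S" using generated by blast
  moreover have "countable (?f ` lists ?S)" by (intro countable_image countable_lists countable_finite) auto
  ultimately show ?thesis using countable_subset by blast
qed

lemma countable_labels: "countable labels"
  unfolding labels_def using countable_carrier by auto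

end

text \<open>An injection of \<open>nat \<times> complex\<close> into \<open>complex\<close>:
  \<open>arctan\<close> squeezes the plane into a vertical strip of width 1, and the strips are
  placed side by side. It only supplies names for points, so no topological property is required of
  it.\<close>

definition pack :: "nat \<Rightarrow> complex \<Rightarrow> complex" where
  "pack n z = Complex (real n + (arctan (Re z) / pi + 1 / 2)) (Im z)"

lemma pack_inj: "pack n z = pack k w \<longleftrightarrow> n = k \<and> z = w"
proof
  assume eq: "pack n z = pack k w"
  have b: "0 < arctan x / pi + 1 / 2" "arctan x / pi + 1 / 2 < 1" for x
    using arctan_bounded[of x] pi_gt_zero by (simp_all add: field_simps)
  have re: "real n + (arctan (Re z) / pi + 1 / 2) = real k + (arctan (Re w) / pi + 1 / 2)" and im: "Im z = Im w"
    using eq by (simp_all add: pack_def)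
  then have "\<bar>real n - real k\<bar> < 1" using b[of "Re z"] b[of "Re w"] by linarith
  then have "n = k" by (rule nat_eq_if_close)
  then have "arctan (Re z) = arctan (Re w)" using re by simp
  then show "n = k \<and> z = w" using \<open>n = k\<close> im by (simp add: arctan_eq_iff complex_eq_iff)
qed auto

text \<open>The points over \<open>z\<close> are the classes \<open>fibre c z\<close> of labels
  glued there, of at most two elements since different slits have different ends. Finite subsets of
  a countable set can be numbered; even numbers name finite points, odd ones points at
  infinity.\<close>

lemma point_labels_exist:
  fixes E :: "'e set" and \<sigma> :: "nat \<Rightarrow> 'e \<Rightarrow> 'e" and m l :: "nat \<Rightarrow> complex"
  assumes "countable E" "\<And>s c. \<lbrakk>s \<in> K; c \<in> E\<rbrakk> \<Longrightarrow> \<sigma> s c \<in> E"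
    and "\<And>s c. \<lbrakk>s \<in> K; c \<in> E\<rbrakk> \<Longrightarrow> \<sigma> s (\<sigma> s c) = c"
    and ends: "\<And>s t z. \<lbrakk>s \<in> K; t \<in> K; z = m s + l s \<or> z = m s - l s; z = m t + l t \<or> z = m t - l t\<rbrakk> \<Longrightarrow> s = t"
  obtains pt :: "'e \<Rightarrow> complex \<Rightarrow> complex" and infp :: "'e \<Rightarrow> complex" where
    "\<And>c d z w. \<lbrakk>c \<in> E; d \<in> E\<rbrakk> \<Longrightarrow> pt c z = pt d w \<longleftrightarrow>
       z = w \<and> (c = d \<or> (\<exists>s\<in>K. (z = m s + l s \<or> z = m s - l s) \<and> d = \<sigma> s c))"
    "\<And>c d. \<lbrakk>c \<in> E; d \<in> E\<rbrakk> \<Longrightarrow> infp c = infp d \<longleftrightarrow> c = d"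
    "\<And>c d z. \<lbrakk>c \<in> E; d \<in> E\<rbrakk> \<Longrightarrow> infp c \<noteq> pt d z"
proof -
  define fibre where "fibre c z = insert c {\<sigma> s c | s. s \<in> K \<and> (z = m s + l s \<or> z = m s - l s)}" for c z
  let ?F = "{F. F \<subseteq> E \<and> finite F}"
  have "countable ?F" using countable_Collect_finite_subset[OF assms(1)] by (simp add: conj_commute)
  then obtain code :: "'e set \<Rightarrow> nat" where code: "inj_on code ?F" unfolding countable_def by blast
  have single: "fibre c z = {c, \<sigma> s c}" if s: "s \<in> K" "z = m s + l s \<or> z = m s - l s" for c z s
  proof -
    have "t = s" if "t \<in> K" "z = m t + l t \<or> z = m t - l t" for t
      by (rule ends[OF that(1) s(1) that(2) s(2)])
    then have "{\<sigma> s c | s. s \<in> K \<and> (z = m s + l s \<or> z = m s - l s)} = {\<sigma> s c}" using s by blast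
    then show ?thesis by (simp only: fibre_def)
  qed
  have none: "fibre c z = {c}" if "\<not> (\<exists>s\<in>K. z = m s + l s \<or> z = m s - l s)" for c z
    using that by (auto simp: fibre_def)
  have fF: "fibre c z \<in> ?F" if "c \<in> E" for c z
    using single[of _ z c] none[of z c] that assms(2) by (cases "\<exists>s\<in>K. z = m s + l s \<or> z = m s - l s") auto
  have fibre_eq: "fibre c z = fibre d z \<longleftrightarrow> c = d \<or> (\<exists>s\<in>K. (z = m s + l s \<or> z = m s - l s) \<and> d = \<sigma> s c)"
    if "c \<in> E" "d \<in> E" for c d z
  proof
    assume "fibre c z = fibre d z"
    then have "d \<in> fibre c z" by (simp add: fibre_def)
    then show "c = d \<or> (\<exists>s\<in>K. (z = m s + l s \<or> z = m s - l s) \<and> d = \<sigma> s c)" by (auto simp: fibre_def)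
  next
    assume "c = d \<or> (\<exists>s\<in>K. (z = m s + l s \<or> z = m s - l s) \<and> d = \<sigma> s c)"
    then show "fibre c z = fibre d z"
    proof
      assume "\<exists>s\<in>K. (z = m s + l s \<or> z = m s - l s) \<and> d = \<sigma> s c"
      then obtain s where s: "s \<in> K" "z = m s + l s \<or> z = m s - l s" "d = \<sigma> s c" by blast
      show ?thesis
        using single[OF s(1,2), of c] single[OF s(1,2), of d] assms(3)[OF s(1) that(1)] s(3)
        by (simp add: insert_commute)
    qed simp
  qed
  define pt where "pt c z = pack (2 * code (fibre c z)) z" for c z
  define infp where "infp c = pack (2 * code {c} + 1) 0" for c
  show ?thesis
  proof (rule that[of pt infp])
    fix c d :: 'e and z w assume cd: "c \<in> E" "d \<in> E"
    have "pt c z = pt d w \<longleftrightarrow> z = w \<and> fibre c z = fibre d z"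
      unfolding pt_def pack_inj using inj_onD[OF code _ fF[OF cd(1)] fF[OF cd(2)]] by auto
    then show "pt c z = pt d w \<longleftrightarrow> z = w \<and> (c = d \<or> (\<exists>s\<in>K. (z = m s + l s \<or> z = m s - l s) \<and> d = \<sigma> s c))"
      using fibre_eq[OF cd] by blast
  next
    fix c d assume "c \<in> E" "d \<in> E"
    then show "infp c = infp d \<longleftrightarrow> c = d"
      unfolding infp_def pack_inj using inj_onD[OF code, of "{c}" "{d}"] by auto
  next
    fix c d z
    show "infp c \<noteq> pt d z" unfolding infp_def pt_def pack_inj by presburger
  qed
qed

section \<open>Placement of the slits\<close>

text \<open>On the unit circle \<open>1 / \<zeta>\<close> is the conjugate of
  \<open>\<zeta>\<close>, so the Joukowski map becomes \<open>m + l * Re \<zeta>\<close>, and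
  \<open>Re \<zeta>\<close> runs through the interval from -1 to 1.\<close>

lemma slit_real:
  assumes "(l::real) > 0"
  shows "slit (of_real m) (of_real l) = of_real ` {m - l..m + l}"
proof
  show "slit (of_real m) (of_real l) \<subseteq> of_real ` {m - l..m + l}"
  proof
    fix w assume "w \<in> slit (of_real m) (of_real l)"
    then obtain \<zeta> where \<zeta>: "norm \<zeta> = 1" "w = jk (of_real m) (of_real l) \<zeta>" by (auto simp: slit_def)
    then have "1 / \<zeta> = cnj \<zeta>" using divide_conv_cnj[of \<zeta> 1] by simp
    then have "\<zeta> + 1 / \<zeta> = of_real (2 * Re \<zeta>)" by (simp add: complex_add_cnj)
    then have w: "w = of_real (m + l * Re \<zeta>)" using \<zeta>(2) by (simp add: jk_def)
    have "\<bar>Re \<zeta>\<bar> \<le> 1" using abs_Re_le_cmod[of \<zeta>] \<zeta>(1) by simp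
    then have "\<bar>l * Re \<zeta>\<bar> \<le> l" using assms by (simp add: abs_mult mult_left_le)
    then have "m + l * Re \<zeta> \<in> {m - l..m + l}" by auto
    then show "w \<in> of_real ` {m - l..m + l}" using w by blast
  qed
  show "of_real ` {m - l..m + l} \<subseteq> slit (of_real m) (of_real l)"
  proof
    fix w :: complex assume "w \<in> of_real ` {m - l..m + l}"
    then obtain x where x: "w = of_real x" "m - l \<le> x" "x \<le> m + l" by auto
    define r where "r = (x - m) / l"
    have r: "\<bar>r\<bar> \<le> 1" using x(2,3) assms by (simp add: r_def abs_le_iff divide_le_eq minus_divide_left[symmetric] le_divide_eq)
    define \<zeta> where "\<zeta> = cis (arccos r)"
    have \<zeta>: "norm \<zeta> = 1" "Re \<zeta> = r" using r by (simp_all add: \<zeta>_def)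
    then have "1 / \<zeta> = cnj \<zeta>" using divide_conv_cnj[of \<zeta> 1] by simp
    then have "\<zeta> + 1 / \<zeta> = of_real (2 * r)" using \<zeta>(2) by (simp add: complex_add_cnj)
    then have "jk (of_real m) (of_real l) \<zeta> = of_real (m + l * r)" by (simp add: jk_def)
    also have "m + l * r = x" using assms by (simp add: r_def)
    finally show "w \<in> slit (of_real m) (of_real l)" using x(1) \<zeta>(1)
      by (auto simp: slit_def intro!: image_eqI[of _ _ \<zeta>])
  qed
qed

text \<open>The part of \<open>C - Z\<close> in each closed half-plane lies between a convex open
  half and its closure, so it is connected; the real point \<open>r\<close> belongs to both
  parts.\<close>

lemma connected_minus_real:
  fixes C Z :: "complex set"
  assumes "open C" "convex C" "\<And>z. z \<in> Z \<Longrightarrow> Im z = 0" "r \<in> C - Z" "Im r = 0"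
  shows "connected (C - Z)"
proof -
  have near: "\<exists>y\<in>C. sgn (Im y) = e \<and> dist y z < d"
    if z: "z \<in> C" "Im z = 0" and e: "e = 1 \<or> e = -1" and d: "d > 0" for z e d
  proof -
    obtain k where k: "k > 0" "ball z k \<subseteq> C" using assms(1) z(1) by (auto simp: open_contains_ball)
    define t where "t = min k d / 2"
    have t: "t > 0" "t < k" "t < d" using k d by (auto simp: t_def)
    let ?y = "z + Complex 0 (e * t)"
    have "norm (Complex 0 (e * t)) = t" using t e by (auto simp: cmod_def)
    then have "dist ?y z = t" "dist z ?y = t" by (simp_all add: dist_norm)
    moreover have "sgn (Im ?y) = e" using z(2) e t by (auto simp: sgn_if)
    ultimately show ?thesis using k t by (intro bexI[of _ ?y]) auto
  qed
  have half: "connected {z \<in> C - Z. 0 \<le> e * Im z}" if e: "e = 1 \<or> e = -1" for e :: real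
  proof (rule connected_intermediate_closure)
    let ?U = "C \<inter> {z. 0 < e * Im z}"
    have "convex {z. 0 < e * Im z}"
      using e by (auto simp: convex_halfspace_Im_gt[of 0] convex_halfspace_Im_lt[of 0])
    then show "connected ?U" using assms(2) convex_Int convex_connected by blast
    show "?U \<subseteq> {z \<in> C - Z. 0 \<le> e * Im z}" using assms(3) by force
    show "{z \<in> C - Z. 0 \<le> e * Im z} \<subseteq> closure ?U"
    proof
      fix z assume z: "z \<in> {z \<in> C - Z. 0 \<le> e * Im z}"
      show "z \<in> closure ?U"
      proof (cases "Im z = 0")
        case True
        show ?thesis
          unfolding closure_approachable
        proof (intro allI impI)
          fix d :: real assume "d > 0"
          then obtain y where "y \<in> C" "sgn (Im y) = e" "dist y z < d" using near[of z e d] z True e by auto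
          then show "\<exists>y\<in>?U. dist y z < d" using e by (intro bexI[of _ y]) (auto simp: sgn_if split: if_splits)
        qed
      next
        case False
        then have "z \<in> ?U" using z e by auto
        then show ?thesis by (rule subsetD[OF closure_subset])
      qed
    qed
  qed
  have "C - Z = {z \<in> C - Z. 0 \<le> 1 * Im z} \<union> {z \<in> C - Z. 0 \<le> -1 * Im z}" by auto
  moreover have "connected ({z \<in> C - Z. 0 \<le> 1 * Im z} \<union> {z \<in> C - Z. 0 \<le> -1 * Im z})"
    by (intro connected_Un half) (use assms(4,5) in auto)
  ultimately show ?thesis by (rule ssubst)
qed

definition mid :: "(nat \<Rightarrow> real) \<Rightarrow> (nat \<Rightarrow> real) \<Rightarrow> nat \<Rightarrow> complex" where
  "mid lo hi s = of_real ((lo s + hi s) / 2)"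

definition rad :: "(nat \<Rightarrow> real) \<Rightarrow> (nat \<Rightarrow> real) \<Rightarrow> nat \<Rightarrow> complex" where
  "rad lo hi s = of_real ((hi s - lo s) / 2)"

lemma mid_rad: "mid lo hi s + rad lo hi s = of_real (hi s)" "mid lo hi s - rad lo hi s = of_real (lo s)"
  unfolding mid_def rad_def of_real_add[symmetric] of_real_diff[symmetric] by (simp_all add: field_simps)

lemma slit_mid_rad: "lo s < hi s \<Longrightarrow> slit (mid lo hi s) (rad lo hi s) = of_real ` {lo s..hi s}"
  using slit_real[of "(hi s - lo s) / 2" "(lo s + hi s) / 2"] by (simp add: mid_def rad_def field_simps)

section \<open>Coverings with sheets labelled by the group\<close>

locale labelled_cover = gl: generated_labels A xs +
  slit_cover "generated_labels.labels A" K "\<lambda>s. generated_labels.switch A xs (s mod generated_labels.ntypes xs)"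
    m l Y E_inf R0 pt infp
  for A (structure) and xs K m l Y E_inf R0 pt infp +
  assumes types: "k < generated_labels.ntypes xs \<Longrightarrow> \<exists>s\<in>K. s mod generated_labels.ntypes xs = k"
begin

theorem Aut_labelled_iso:
  assumes rigid: "\<And>g c z. \<lbrakk>biholo g; c \<in> gl.labels; z \<in> Y0\<rbrakk> \<Longrightarrow> \<exists>d\<in>gl.labels. g (pt c z) = pt d z"
  shows "Aut surf \<cong> A"
proof (rule Aut_iso[where \<theta> = gl.translate])
  have N: "s mod gl.ntypes < gl.ntypes" for s by (simp add: gl.ntypes_def)
  show "group A" by (rule gl.is_group)
  show "commuting (gl.translate a)" if a: "a \<in> carrier A" for a
    unfolding commuting_def using gl.translate_bij[OF a] gl.switch(4)[OF N _ a] by simp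
  show "gl.translate (a \<otimes> b) c = gl.translate a (gl.translate b c)"
    if "a \<in> carrier A" "b \<in> carrier A" "c \<in> gl.labels" for a b c
    using that by (auto simp: gl.translate_def gl.labels_def gl.m_assoc)
  show "a = b" if ab: "a \<in> carrier A" "b \<in> carrier A" "\<forall>c\<in>gl.labels. gl.translate a c = gl.translate b c" for a b
  proof -
    have "gl.translate a (\<one>, 0) = gl.translate b (\<one>, 0)" using ab(3) by (simp add: gl.labels_def)
    then show ?thesis using ab by (simp add: gl.translate_def)
  qed
  show "\<exists>a\<in>carrier A. \<forall>c\<in>gl.labels. \<tau> c = gl.translate a c" if \<tau>: "commuting \<tau>" for \<tau>
  proof (rule gl.commuting_imp_translation)
    fix k c assume k: "k < gl.ntypes" "c \<in> gl.labels"
    \<comment> \<open>Every type occurs among the slits, so commuting with the slit permutations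
      means commuting with all switches.\<close>
    then obtain s where s: "s \<in> K" "s mod gl.ntypes = k" using types by blast
    then show "\<tau> (gl.switch k c) = gl.switch k (\<tau> c)"
      using commutingD(2)[OF \<tau> s(1) k(2)] by simp
  qed (use commutingD(1)[OF \<tau>] in auto)
  show "\<exists>d\<in>gl.labels. g (pt c z) = pt d z" if "g \<in> carrier (Aut surf)" "c \<in> gl.labels" "z \<in> Y0" for g c z
    using rigid Aut_biholo that by blast
qed

end

context generated_labels
begin

lemma ntypes_pos: "ntypes > 0" and ntypes_ge_4: "ntypes \<ge> 4" by (simp_all add: ntypes_def)

lemma mod_ntypes: "s mod ntypes < ntypes" using ntypes_pos by simp

lemma labels_nonempty: "labels \<noteq> {}"
proof -
  have "(\<one>, 0) \<in> labels" by (simp add: labels_def)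
  then show ?thesis by blast
qed

lemma typed_switch_transitive:
  assumes "Q c0" "c0 \<in> labels" "\<And>s c. \<lbrakk>s \<in> K; c \<in> labels; Q c\<rbrakk> \<Longrightarrow> Q (switch (s mod ntypes) c)" "c \<in> labels"
    and K: "\<And>k. k < ntypes \<Longrightarrow> \<exists>s\<in>K. s mod ntypes = k"
  shows "Q c"
  by (rule switch_transitive[where Q = Q, OF assms(1,2) _ assms(4)]) (use assms(3) K in blast)

text \<open>Both coverings use slits on the real line; the conditions of \<open>slit_cover\<close>
  are reduced here to statements about disjoint real intervals.\<close>

lemma slit_cover_real:
  fixes lo hi :: "nat \<Rightarrow> real"
  assumes lohi: "\<And>s. s \<in> K \<Longrightarrow> lo s < hi s"
    and dis: "\<And>s t. \<lbrakk>s \<in> K; t \<in> K; s \<noteq> t\<rbrakk> \<Longrightarrow> {lo s..hi s} \<inter> {lo t..hi t} = {}"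
    and K: "\<And>k. k < ntypes \<Longrightarrow> \<exists>s\<in>K. s mod ntypes = k"
    and Y: "open Y" "\<And>s. s \<in> K \<Longrightarrow> of_real ` {lo s..hi s} \<subseteq> Y"
    and cl: "\<And>K'. K' \<subseteq> K \<Longrightarrow> open (Y - (\<Union>s\<in>K'. of_real ` {lo s..hi s}))"
    and con: "connected (Y - (\<Union>s\<in>K. of_real ` {lo s..hi s}))" "Y - (\<Union>s\<in>K. of_real ` {lo s..hi s}) \<noteq> {}"
    and inf: "E_inf = {} \<or> E_inf = labels" "R0 > 0" "E_inf \<noteq> {} \<Longrightarrow> Y = UNIV"
      "\<And>s. \<lbrakk>E_inf \<noteq> {}; s \<in> K\<rbrakk> \<Longrightarrow> of_real ` {lo s..hi s} \<subseteq> cball (0::complex) R0"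
  obtains pt :: "'a \<times> nat \<Rightarrow> complex \<Rightarrow> complex" and infp :: "'a \<times> nat \<Rightarrow> complex"
  where "slit_cover labels K (\<lambda>s. switch (s mod ntypes)) (mid lo hi) (rad lo hi) Y E_inf R0 pt infp"
proof -
  let ?\<sigma> = "\<lambda>s. switch (s mod ntypes)"
  note sw = switch[OF mod_ntypes]
  have ends: "s = t" if sK: "s \<in> K" and tK: "t \<in> K"
    and zs: "z = mid lo hi s + rad lo hi s \<or> z = mid lo hi s - rad lo hi s"
    and zt: "z = mid lo hi t + rad lo hi t \<or> z = mid lo hi t - rad lo hi t" for s t z
  proof (rule ccontr)
    assume "s \<noteq> t"
    obtain x y where xy: "z = of_real x" "z = of_real y" "x \<in> {lo s..hi s}" "y \<in> {lo t..hi t}"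
    proof -
      have "\<exists>x\<in>{lo s..hi s}. z = of_real x" "\<exists>y\<in>{lo t..hi t}. z = of_real y"
        using zs zt lohi[OF sK] lohi[OF tK] unfolding mid_rad by auto
      then show thesis using that by blast
    qed
    then have "x = y" by (metis of_real_eq_iff)
    then show False using dis[OF sK tK \<open>s \<noteq> t\<close>] xy(3,4) by blast
  qed
  obtain pt :: "'a \<times> nat \<Rightarrow> complex \<Rightarrow> complex" and infp :: "'a \<times> nat \<Rightarrow> complex" where pt:
    "\<And>c d z w. \<lbrakk>c \<in> labels; d \<in> labels\<rbrakk> \<Longrightarrow> pt c z = pt d w \<longleftrightarrow>
       z = w \<and> (c = d \<or> (\<exists>s\<in>K. (z = mid lo hi s + rad lo hi s \<or> z = mid lo hi s - rad lo hi s) \<and> d = ?\<sigma> s c))"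
    "\<And>c d. \<lbrakk>c \<in> labels; d \<in> labels\<rbrakk> \<Longrightarrow> infp c = infp d \<longleftrightarrow> c = d"
    "\<And>c d z. \<lbrakk>c \<in> labels; d \<in> labels\<rbrakk> \<Longrightarrow> infp c \<noteq> pt d z"
    by (rule point_labels_exist[of labels K ?\<sigma> "mid lo hi" "rad lo hi", OF countable_labels sw(1,2) ends]) blast+
  have L: "(\<Union>s\<in>K'. slit (mid lo hi s) (rad lo hi s)) = (\<Union>s\<in>K'. of_real ` {lo s..hi s})" if "K' \<subseteq> K" for K'
    using slit_mid_rad lohi that by (intro SUP_cong) auto
  show ?thesis
  proof (rule that[of pt infp], unfold_locales)
    show "Q c" if "Q c0" "c0 \<in> labels" "\<And>s c. \<lbrakk>s \<in> K; c \<in> labels; Q c\<rbrakk> \<Longrightarrow> Q (?\<sigma> s c)" "c \<in> labels" for Q c0 c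
      by (rule typed_switch_transitive[where Q = Q, OF that K])
    show "slit (mid lo hi s) (rad lo hi s) \<inter> slit (mid lo hi t) (rad lo hi t) = {}" if "s \<in> K" "t \<in> K" "s \<noteq> t" for s t
      using dis[OF that] slit_mid_rad[of lo s hi] slit_mid_rad[of lo t hi] lohi that by auto
    show "rad lo hi s \<noteq> 0" if "s \<in> K" for s using lohi[OF that] unfolding rad_def by simp
    show "slit (mid lo hi s) (rad lo hi s) \<subseteq> Y" if "s \<in> K" for s
      using Y(2)[OF that] slit_mid_rad[of lo s hi] lohi[OF that] by simp
    show "open (Y - (\<Union>s\<in>K'. slit (mid lo hi s) (rad lo hi s)))" if "K' \<subseteq> K" for K'
      unfolding L[OF that] by (rule cl[OF that])
    show "connected (Y - (\<Union>s\<in>K. slit (mid lo hi s) (rad lo hi s)))" unfolding L[OF order_refl] by (rule con)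
    show "Y - (\<Union>s\<in>K. slit (mid lo hi s) (rad lo hi s)) \<noteq> {}" unfolding L[OF order_refl] by (rule con)
    show "slit (mid lo hi s) (rad lo hi s) \<subseteq> cball 0 R0" if "c \<in> E_inf" "s \<in> K" for c s
      using inf(4)[OF _ that(2)] slit_mid_rad[of lo s hi] lohi[OF that(2)] that(1) by auto
  qed (use countable_labels labels_nonempty sw Y inf pt in \<open>auto\<close>)
qed

end

section \<open>The covering of the punctured disc\<close>

context generated_labels
begin

theorem open_surface: "\<exists>S :: complex charted_space. riemann_surface S \<and> Aut S \<cong> A"
proof -
  define N where "N = ntypes"
  have N: "N > 0" "s mod N < N" for s using ntypes_pos mod_ntypes by (simp_all add: N_def)
  define lo hi where "lo s = real (s mod N) + eta (2 * s + 1)" and "hi s = real (s mod N) + eta (2 * s)" for s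
  define P where "P = (of_nat ` {..<N} :: complex set)"
  define Y where "Y = ball (0::complex) (real N + 1) - P"
  define I where "I s = (of_real ` {lo s..hi s} :: complex set)" for s
  have lohi: "lo s < hi s" for s using eta_antimono[of "2 * s" "2 * s + 1"] by (simp add: lo_def hi_def)
  have bounds: "real (s mod N) < x" "x \<le> real (s mod N) + 1 / 2" "x \<le> real (s mod N) + eta (2 * s)"
    if "x \<in> {lo s..hi s}" for s x
    using that eta_pos[of "2 * s + 1"] eta_le_half[of "2 * s"] by (auto simp: lo_def hi_def)
  have dis: "{lo s..hi s} \<inter> {lo t..hi t} = {}" if "s \<noteq> t" for s t
  proof (rule ccontr)
    assume "{lo s..hi s} \<inter> {lo t..hi t} \<noteq> {}"
    then obtain x where x: "x \<in> {lo s..hi s}" "x \<in> {lo t..hi t}" by blast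
    have "\<bar>real (s mod N) - real (t mod N)\<bar> < 1" using bounds[OF x(1)] bounds[OF x(2)] by linarith
    then have e: "s mod N = t mod N" by (rule nat_eq_if_close)
    have *: "hi b < lo a" if "a < b" "a mod N = b mod N" for a b
      using eta_antimono[of "2 * a + 1" "2 * b"] that by (simp add: lo_def hi_def)
    consider "s < t" | "t < s" using \<open>s \<noteq> t\<close> by linarith
    then show False using *[of s t] *[of t s] e x by cases auto
  qed
  have clP: "closed P" by (simp add: P_def finite_imp_closed)
  have oY: "open Y" unfolding Y_def using clP by (simp add: open_Diff)
  have not_int: "x \<noteq> real k" if "x \<in> {lo s..hi s}" for x s k
  proof
    assume "x = real k"
    then have "\<bar>real k - real (s mod N)\<bar> < 1" "real (s mod N) < real k" using bounds[OF that] by linarith+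
    then show False using nat_eq_if_close by fastforce
  qed
  have IY: "I s \<subseteq> Y" for s
  proof
    fix z assume "z \<in> I s"
    then obtain x where x: "z = of_real x" "x \<in> {lo s..hi s}" by (auto simp: I_def)
    have "real (s mod N) + 1 \<le> real N" using N(2)[of s] by linarith
    then have "\<bar>x\<bar> < real N + 1" using bounds[OF x(2)] by linarith
    moreover have "z \<notin> P"
    proof
      assume "z \<in> P"
      then obtain k where "of_real x = (of_real (real k) :: complex)" using x by (auto simp: P_def)
      then show False using not_int[OF x(2)] of_real_eq_iff by blast
    qed
    ultimately show "z \<in> Y" using x(1) by (simp add: Y_def)
  qed
  have closed_I: "closed (I s)" for s
    unfolding I_def by (intro compact_imp_closed compact_continuous_image continuous_intros compact_Icc)
  have cl: "open (Y - (\<Union>s\<in>K'. I s))" for K'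
  proof (subst open_subopen, intro ballI)
    fix z assume z: "z \<in> Y - (\<Union>s\<in>K'. I s)"
    obtain d where d: "d > 0" "ball z d \<subseteq> Y" using oY z by (auto simp: open_contains_ball)
    \<comment> \<open>Only finitely many slits are that long-ranged. Any other slit lies within
      \<open>d / 2\<close> of its puncture, which has distance at least \<open>d\<close> from
      \<open>z\<close>, so it misses the ball of radius \<open>d / 2\<close>.\<close>
    define F where "F = {s \<in> K'. eta (2 * s) \<ge> d / 2}"
    have "finite F"
    proof -
      have "\<forall>\<^sub>F n in sequentially. eta n < d / 2"
        using order_tendstoD(2)[OF eta_tendsto_0, of "d / 2"] d(1) by simp
      then obtain n0 where n0: "\<And>n. n \<ge> n0 \<Longrightarrow> eta n < d / 2" by (auto simp: eventually_sequentially)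
      have "F \<subseteq> {..<n0}"
      proof
        fix s assume "s \<in> F"
        then have "\<not> n0 \<le> 2 * s" using n0[of "2 * s"] by (auto simp: F_def)
        then show "s \<in> {..<n0}" by simp
      qed
      then show ?thesis using finite_subset by blast
    qed
    then have cF: "closed (\<Union>s\<in>F. I s)" using closed_I by auto
    have "ball z (d / 2) - (\<Union>s\<in>F. I s) \<subseteq> Y - (\<Union>s\<in>K'. I s)"
    proof
      fix w assume w: "w \<in> ball z (d / 2) - (\<Union>s\<in>F. I s)"
      have "w \<notin> I s" if "s \<in> K'" for s
      proof
        assume ws: "w \<in> I s"
        then have "s \<notin> F" using w by blast
        then have e: "eta (2 * s) < d / 2" using that by (auto simp: F_def)
        obtain x where x: "w = of_real x" "x \<in> {lo s..hi s}" using ws by (auto simp: I_def)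
        have "dist w (of_nat (s mod N)) = \<bar>x - real (s mod N)\<bar>"
          unfolding x(1) dist_norm by (metis norm_of_real of_real_diff of_real_of_nat_eq)
        then have "dist w (of_nat (s mod N)) < d / 2" using bounds[OF x(2)] e by linarith
        then have "of_nat (s mod N) \<in> ball z d"
          using w dist_triangle_half_r[of w z d "of_nat (s mod N)"] by (auto simp: dist_commute)
        moreover have "of_nat (s mod N) \<notin> Y" using N by (auto simp: Y_def P_def)
        ultimately show False using d(2) by blast
      qed
      then show "w \<in> Y - (\<Union>s\<in>K'. I s)" using w d by auto
    qed
    moreover have "z \<in> ball z (d / 2) - (\<Union>s\<in>F. I s)" using z d(1) by (auto simp: F_def)
    ultimately show "\<exists>T. open T \<and> z \<in> T \<and> T \<subseteq> Y - (\<Union>s\<in>K'. I s)"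
      using cF by (intro exI[of _ "ball z (d / 2) - (\<Union>s\<in>F. I s)"]) auto
  qed
  \<comment> \<open>A real point to the left of all punctures and slits, as needed for
    \<open>connected_minus_real\<close>.\<close>
  have r: "of_real (- 1 / 2) \<in> ball (0::complex) (real N + 1) - (P \<union> (\<Union>s. I s))"
  proof -
    have n: "complex_of_real (- 1 / 2) \<noteq> of_real x" if "x \<ge> 0" for x
      using that by (subst of_real_eq_iff) linarith
    have "complex_of_real (- 1 / 2) \<notin> I s" for s
      unfolding I_def using n bounds(1)[of _ s] by (force simp del: of_real_divide of_real_minus)
    moreover have "complex_of_real (- 1 / 2) \<notin> P"
      unfolding P_def using n[of "real _"] by (auto simp del: of_real_divide of_real_minus)
    moreover have "norm (complex_of_real (- 1 / 2)) < real N + 1" unfolding norm_of_real by simp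
    ultimately show ?thesis by (auto simp del: of_real_divide of_real_minus norm_of_real)
  qed
  have con: "connected (ball (0::complex) (real N + 1) - (P \<union> (\<Union>s. I s)))"
    by (rule connected_minus_real[OF open_ball convex_ball _ r]) (auto simp: P_def I_def)
  have YI: "Y - (\<Union>s. I s) = ball (0::complex) (real N + 1) - (P \<union> (\<Union>s. I s))" by (auto simp: Y_def)
  obtain pt :: "'a \<times> nat \<Rightarrow> complex \<Rightarrow> complex" and infp where
    sc: "slit_cover labels UNIV (\<lambda>s. switch (s mod ntypes)) (mid lo hi) (rad lo hi) Y {} 1 pt infp"
  proof (rule slit_cover_real[of UNIV lo hi Y "{}" 1])
    show "\<exists>s\<in>UNIV. s mod ntypes = k" if "k < ntypes" for k using that by (intro bexI[of _ k]) auto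
    show "of_real ` {lo s..hi s} \<subseteq> Y" for s using IY by (simp add: I_def)
    show "open (Y - (\<Union>s\<in>K'. of_real ` {lo s..hi s}))" for K' using cl by (simp add: I_def)
    show "connected (Y - (\<Union>s\<in>UNIV. of_real ` {lo s..hi s}))" using con YI by (simp add: I_def)
    show "Y - (\<Union>s\<in>UNIV. of_real ` {lo s..hi s}) \<noteq> {}" using r YI unfolding I_def by blast
  qed (use lohi dis oY in auto)
  interpret sc: slit_cover labels UNIV "\<lambda>s. switch (s mod ntypes)" "mid lo hi" "rad lo hi" Y "{}" 1 pt infp
    by (rule sc)
  interpret pc: punctured_cover labels "\<lambda>s. switch (s mod ntypes)" "mid lo hi" "rad lo hi" Y 1 pt infp N
    by unfold_locales
      (use N lohi in \<open>simp_all add: mid_rad slit_mid_rad Y_def P_def lo_def hi_def N_def\<close>)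
  interpret lc: labelled_cover A xs UNIV "mid lo hi" "rad lo hi" Y "{}" 1 pt infp
    by unfold_locales (use mod_less in blast)
  have "Aut sc.surf \<cong> A" using pc.punctured_rigid by (intro lc.Aut_labelled_iso) blast
  then show ?thesis using sc.riemann_surface_cover by blast
qed

end

section \<open>Arithmetic of the cube root of 2 and Moebius rigidity\<close>

lemma cube_root_2_irrational:
  fixes r :: real
  assumes "r \<in> \<rat>" "r ^ 3 = 2"
  shows False
proof -
  obtain p q :: nat where pq: "q \<noteq> 0" "\<bar>r\<bar> = real p / real q" using Rats_abs_nat_div_natE[OF assms(1)] by metis
  have "\<bar>r\<bar> ^ 3 = 2" using assms(2) by (simp add: power_abs[symmetric])
  then have "real p ^ 3 = 2 * real q ^ 3" using pq by (simp add: power_divide field_simps)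
  then have "real (p ^ 3) = real (2 * q ^ 3)" by simp
  then have eq: "p ^ 3 = 2 * q ^ 3" by (simp only: of_nat_eq_iff)
  then have "p \<noteq> 0" using pq by (metis mult_eq_0_iff power_eq_0_iff zero_neq_numeral zero_power zero_less_numeral)
  have pr: "prime_elem (2::nat)" by simp
  \<comment> \<open>Comparison of 2-adic valuations in \<open>eq\<close>: a multiple of 3 on the
    left, one more than a multiple of 3 on the right.\<close>
  have "multiplicity 2 (p ^ 3) = 3 * multiplicity 2 p" "multiplicity 2 (q ^ 3) = 3 * multiplicity 2 q"
    using \<open>p \<noteq> 0\<close> pq pr by (simp_all add: prime_elem_multiplicity_power_distrib)
  moreover have "multiplicity 2 (2 * q ^ 3) = multiplicity (2::nat) 2 + multiplicity 2 (q ^ 3)"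
    using pq pr by (intro prime_elem_multiplicity_mult_distrib) auto
  moreover have "multiplicity (2::nat) 2 = 1" by simp
  ultimately have "3 * multiplicity 2 p = 1 + 3 * multiplicity 2 q" using eq by simp
  then show False by presburger
qed

text \<open>Multiplying the relation by \<open>\<theta>\<close> gives a second one; eliminating
  \<open>\<theta>\<^sup>2\<close> leaves a linear relation, whose coefficients vanish by
  irrationality. For nonzero \<open>\<gamma>\<close> they would make
  \<open>\<beta> / \<gamma>\<close> a rational cube root of 2.\<close>

lemma cube_root_2_independent:
  fixes \<theta> :: real
  assumes \<theta>: "\<theta> ^ 3 = 2" and \<alpha>\<beta>\<gamma>: "\<alpha> \<in> \<rat>" "\<beta> \<in> \<rat>" "\<gamma> \<in> \<rat>" and eq: "\<alpha> + \<beta> * \<theta> + \<gamma> * \<theta>\<^sup>2 = 0"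
  shows "\<alpha> = 0 \<and> \<beta> = 0 \<and> \<gamma> = 0"
proof -
  have irr: "\<theta> \<notin> \<rat>" using cube_root_2_irrational \<theta> by blast
  have lin: "a = 0 \<and> b = 0" if "a \<in> \<rat>" "b \<in> \<rat>" "a + b * \<theta> = 0" for a b
  proof -
    have "b = 0"
    proof (rule ccontr)
      assume "b \<noteq> 0"
      then have "\<theta> = - a / b" using that(3) by (simp add: field_simps)
      then show False using irr that by simp
    qed
    then show ?thesis using that by simp
  qed
  have "\<theta> * (\<alpha> + \<beta> * \<theta> + \<gamma> * \<theta>\<^sup>2) = \<alpha> * \<theta> + \<beta> * \<theta>\<^sup>2 + \<gamma> * \<theta> ^ 3"
    by (simp add: algebra_simps power2_eq_square power3_eq_cube)
  then have eq2: "2 * \<gamma> + \<alpha> * \<theta> + \<beta> * \<theta>\<^sup>2 = 0" using eq \<theta> by simp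
  have "\<gamma> * (2 * \<gamma> + \<alpha> * \<theta> + \<beta> * \<theta>\<^sup>2) - \<beta> * (\<alpha> + \<beta> * \<theta> + \<gamma> * \<theta>\<^sup>2) = (2 * \<gamma>\<^sup>2 - \<alpha> * \<beta>) + (\<alpha> * \<gamma> - \<beta>\<^sup>2) * \<theta>"
    by (simp add: algebra_simps power2_eq_square)
  then have "(2 * \<gamma>\<^sup>2 - \<alpha> * \<beta>) + (\<alpha> * \<gamma> - \<beta>\<^sup>2) * \<theta> = 0" using eq eq2 by simp
  then have l: "2 * \<gamma>\<^sup>2 = \<alpha> * \<beta>" "\<alpha> * \<gamma> = \<beta>\<^sup>2" using lin[of "2 * \<gamma>\<^sup>2 - \<alpha> * \<beta>" "\<alpha> * \<gamma> - \<beta>\<^sup>2"] \<alpha>\<beta>\<gamma> by simp_all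
  have "\<gamma> = 0"
  proof (rule ccontr)
    assume g: "\<gamma> \<noteq> 0"
    have "\<beta> ^ 3 = \<beta>\<^sup>2 * \<beta>" by (simp add: power2_eq_square power3_eq_cube)
    also have "\<dots> = \<gamma> * (\<alpha> * \<beta>)" using l(2) by (simp add: algebra_simps)
    also have "\<dots> = 2 * \<gamma> ^ 3" using l(1)[symmetric] by (simp add: power2_eq_square power3_eq_cube)
    finally have "(\<beta> / \<gamma>) ^ 3 = 2" using g by (simp add: power_divide)
    then show False using cube_root_2_irrational[of "\<beta> / \<gamma>"] \<alpha>\<beta>\<gamma> by simp
  qed
  then show ?thesis using lin[of \<alpha> \<beta>] \<alpha>\<beta>\<gamma> eq by simp
qed

text \<open>\<open>eq\<close> is the equality of two cross ratios with denominators cleared;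
  \<open>w\<close> is the image of \<open>\<theta>\<close>. A rational \<open>w\<close> makes the
  equation linear in \<open>\<theta>\<close> and forces \<open>w = q1\<close> and
  \<open>w = q3\<close>, a contradiction. For \<open>w = \<theta>\<close> the coefficients of a
  quadratic are compared.\<close>

lemma cross_ratio_rigid:
  fixes \<theta> p1 p2 p3 q1 q2 q3 w :: real
  assumes \<theta>: "\<theta> ^ 3 = 2" and rat: "p1 \<in> \<rat>" "p2 \<in> \<rat>" "p3 \<in> \<rat>" "q1 \<in> \<rat>" "q2 \<in> \<rat>" "q3 \<in> \<rat>"
    and p: "p1 \<noteq> p2" "p2 \<noteq> p3" "p1 \<noteq> p3" and q: "q1 \<noteq> q2" "q2 \<noteq> q3" "q1 \<noteq> q3"
    and w: "w \<in> \<rat> \<or> w = \<theta>"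
    and eq: "(w - q1) * (q2 - q3) * (\<theta> - p3) * (p2 - p1) = (\<theta> - p1) * (p2 - p3) * (w - q3) * (q2 - q1)"
  shows "q1 = p1 \<and> q2 = p2 \<and> q3 = p3"
  using w
proof
  assume w: "w \<in> \<rat>"
  define a b where "a = (w - q1) * (q2 - q3) * (p2 - p1)" and "b = (p2 - p3) * (w - q3) * (q2 - q1)"
  have ab: "a \<in> \<rat>" "b \<in> \<rat>" using w rat by (simp_all add: a_def b_def)
  have "(b * p1 - a * p3) + (a - b) * \<theta> + 0 * \<theta>\<^sup>2 = 0" using eq by (simp add: a_def b_def algebra_simps)
  from cube_root_2_independent[OF \<theta> _ _ _ this]
  have "b * p1 - a * p3 = 0 \<and> a - b = 0" using ab rat by simp
  then have "a = b" "a * (p1 - p3) = 0" by (auto simp: algebra_simps)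
  then have "a = 0" "b = 0" using p by auto
  then have "w = q1" "w = q3" using p q by (auto simp: a_def b_def)
  then show ?thesis using q by simp
next
  assume w: "w = \<theta>"
  define a b where "a = (q2 - q3) * (p2 - p1)" and "b = (p2 - p3) * (q2 - q1)"
  have ab: "a \<in> \<rat>" "b \<in> \<rat>" "a \<noteq> 0" using rat p q by (simp_all add: a_def b_def)
  have "(\<theta> - q1) * (\<theta> - p3) * a = (\<theta> - p1) * (\<theta> - q3) * b" using eq w by (simp add: a_def b_def mult_ac)
  then have "(a * q1 * p3 - b * p1 * q3) + (b * (p1 + q3) - a * (q1 + p3)) * \<theta> + (a - b) * \<theta>\<^sup>2 = 0"
    by (simp add: algebra_simps power2_eq_square)
  note quadratic = this
  have "a * q1 * p3 - b * p1 * q3 \<in> \<rat>" "b * (p1 + q3) - a * (q1 + p3) \<in> \<rat>" "a - b \<in> \<rat>"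
    using ab rat by simp_all
  note cube_root_2_independent[OF \<theta> this quadratic]
  then have 1: "a = b" "a * (q1 * p3 - p1 * q3) = 0" "a * (p1 + q3 - (q1 + p3)) = 0" by (auto simp: algebra_simps)
  then have 2: "q1 * p3 = p1 * q3" "q3 = q1 + p3 - p1" using ab(3) by auto
  then have "(q1 - p1) * (p3 - p1) = 0" by (simp add: algebra_simps)
  then have q1: "q1 = p1" using p by simp
  then have q3: "q3 = p3" using 2(2) by simp
  have "(q2 - p3) * (p2 - p1) = (p2 - p3) * (q2 - p1)" using 1(1) q1 q3 by (simp add: a_def b_def)
  then have "(q2 - p2) * (p3 - p1) = 0" by (simp add: algebra_simps)
  then show ?thesis using q1 q3 p by simp
qed

text \<open>Three of the four points \<open>0\<close>, \<open>2\<close>, \<open>3\<close>, \<open>4\<close> have rational images. The invariance of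
  the cross ratio of these points and the cube root \<open>\<theta>\<close> is a polynomial equation of degree at most two
  for \<open>\<theta>\<close> with rational coefficients, which has to be trivial.\<close>

lemma mobius_rigid_set:
  fixes a b c d :: complex and \<theta> :: real
  assumes \<theta>: "\<theta> ^ 3 = 2" and S: "S \<subseteq> \<rat>" "{0, 2, 3, 4} \<subseteq> S"
    and det: "a * d \<noteq> b * c"
    and M: "\<And>z. z \<in> complex_of_real ` insert \<theta> S \<Longrightarrow> c * z + d \<noteq> 0 \<and> (a * z + b) / (c * z + d) \<in> of_real ` insert \<theta> S"
  shows "c = 0 \<and> b = 0 \<and> a = d"
proof -
  define f where "f z = (a * z + b) / (c * z + d)" for z
  define B where "B = insert \<theta> S"
  have nz: "c * of_real x + d \<noteq> 0" if "x \<in> B" for x using M that by (auto simp: B_def)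
  \<comment> \<open>With this formula the invariance of the cross ratio is a cancellation of the
    factors \<open>c * x + d\<close>.\<close>
  have diff: "f x - f y = (a * d - b * c) * (x - y) / ((c * x + d) * (c * y + d))"
    if "c * x + d \<noteq> 0" "c * y + d \<noteq> 0" for x y
    using that by (simp add: f_def divide_simps) (simp add: algebra_simps)
  have "\<exists>y\<in>B. f (of_real x) = of_real y" if "x \<in> B" for x using M that by (auto simp: B_def f_def)
  then obtain h where h: "\<And>x. x \<in> B \<Longrightarrow> h x \<in> B \<and> f (of_real x) = of_real (h x)" by metis
  have hinj: "x = y" if "x \<in> B" "y \<in> B" "h x = h y" for x y
  proof -
    have "f (of_real x) - f (of_real y) = 0" using h that by simp
    then have "(of_real x - of_real y :: complex) = 0" using diff[OF nz nz] det nz that by simp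
    then show ?thesis by simp
  qed
  have four: "x \<in> B" if "x \<in> {0, 2, 3, 4}" for x using S(2) that by (auto simp: B_def)
  have hS: "h x \<in> \<rat>" if "x \<in> {0, 2, 3, 4}" "h x \<noteq> \<theta>" for x
    using h[OF four[OF that(1)]] that(2) S(1) by (auto simp: B_def)
  have "\<exists>p1 p2 p3. p1 \<in> {0, 2, 3, 4} \<and> p2 \<in> {0, 2, 3, 4} \<and> p3 \<in> {0, 2, 3, 4} \<and> p1 \<noteq> p2 \<and> p2 \<noteq> p3 \<and> p1 \<noteq> p3 \<and>
    h p1 \<noteq> \<theta> \<and> h p2 \<noteq> \<theta> \<and> h p3 \<noteq> \<theta>"
  proof -
    have ne: "\<not> (h x = \<theta> \<and> h y = \<theta>)" if "x \<in> {0, 2, 3, 4}" "y \<in> {0, 2, 3, 4}" "x \<noteq> y" for x y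
      using hinj[OF four four] that by metis
    consider "h 0 = \<theta>" | "h 2 = \<theta>" | "h 0 \<noteq> \<theta>" "h 2 \<noteq> \<theta>" "h 3 \<noteq> \<theta>" | "h 0 \<noteq> \<theta>" "h 2 \<noteq> \<theta>" "h 4 \<noteq> \<theta>"
      using ne[of 3 4] by auto
    then show ?thesis
    proof cases
      case 1
      then show ?thesis using ne[of 0 2] ne[of 0 3] ne[of 0 4] by (intro exI[of _ 2] exI[of _ 3] exI[of _ 4]) auto
    next
      case 2
      then show ?thesis using ne[of 2 0] ne[of 2 3] ne[of 2 4] by (intro exI[of _ 0] exI[of _ 3] exI[of _ 4]) auto
    next
      case 3
      then show ?thesis by (intro exI[of _ 0] exI[of _ 2] exI[of _ 3]) auto
    next
      case 4
      then show ?thesis by (intro exI[of _ 0] exI[of _ 2] exI[of _ 4]) auto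
    qed
  qed
  then obtain p1 p2 p3 where p: "p1 \<in> {0, 2, 3, 4}" "p2 \<in> {0, 2, 3, 4}" "p3 \<in> {0, 2, 3, 4}"
    "p1 \<noteq> p2" "p2 \<noteq> p3" "p1 \<noteq> p3" "h p1 \<noteq> \<theta>" "h p2 \<noteq> \<theta>" "h p3 \<noteq> \<theta>" by blast
  have pB: "p1 \<in> B" "p2 \<in> B" "p3 \<in> B" "\<theta> \<in> B" using four p by (auto simp: B_def)
  have pQ: "p1 \<in> \<rat>" "p2 \<in> \<rat>" "p3 \<in> \<rat>" using p(1-3) by auto
  let ?P = "\<lambda>x. complex_of_real x"
  have "(f (?P \<theta>) - f (?P p1)) * (f (?P p2) - f (?P p3)) * (?P \<theta> - ?P p3) * (?P p2 - ?P p1) =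
      (?P \<theta> - ?P p1) * (?P p2 - ?P p3) * (f (?P \<theta>) - f (?P p3)) * (f (?P p2) - f (?P p1))"
    unfolding diff[OF nz[OF pB(4)] nz[OF pB(1)]] diff[OF nz[OF pB(2)] nz[OF pB(3)]]
      diff[OF nz[OF pB(4)] nz[OF pB(3)]] diff[OF nz[OF pB(2)] nz[OF pB(1)]]
    by (simp add: mult_ac)
  then have "?P ((h \<theta> - h p1) * (h p2 - h p3) * (\<theta> - p3) * (p2 - p1)) =
      ?P ((\<theta> - p1) * (p2 - p3) * (h \<theta> - h p3) * (h p2 - h p1))"
    using h pB by simp
  then have eq: "(h \<theta> - h p1) * (h p2 - h p3) * (\<theta> - p3) * (p2 - p1) =
      (\<theta> - p1) * (p2 - p3) * (h \<theta> - h p3) * (h p2 - h p1)"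
    by (simp only: of_real_eq_iff)
  have "h \<theta> \<in> \<rat> \<or> h \<theta> = \<theta>" using h[OF pB(4)] S(1) by (auto simp: B_def)
  then have fixed: "h p1 = p1 \<and> h p2 = p2 \<and> h p3 = p3"
    using cross_ratio_rigid[OF \<theta> pQ hS[OF p(1,7)] hS[OF p(2,8)] hS[OF p(3,9)] p(4-6) _ _ _ _ eq]
      hinj[OF pB(1,2)] hinj[OF pB(2,3)] hinj[OF pB(1,3)] p(4-6) by blast
  \<comment> \<open>Fixed points are roots of a polynomial of degree at most two; three distinct
    ones make all its coefficients vanish.\<close>
  have root: "c * ?P x * ?P x + (d - a) * ?P x - b = 0" if "x \<in> B" "h x = x" for x
  proof -
    have "(a * ?P x + b) / (c * ?P x + d) = ?P x" using h[OF that(1)] that(2) by (simp add: f_def)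
    then have "a * ?P x + b = ?P x * (c * ?P x + d)" using nz[OF that(1)] by (simp add: divide_eq_eq)
    then show ?thesis by (simp add: algebra_simps)
  qed
  note r1 = root[OF pB(1)] and r2 = root[OF pB(2)] and r3 = root[OF pB(3)]
  have "(?P p1 - ?P p2) * (c * (?P p1 + ?P p2) + (d - a)) = 0"
    using r1 r2 fixed by (simp add: algebra_simps) 
  then have 12: "c * (?P p1 + ?P p2) + (d - a) = 0" using p(4) by simp
  have "(?P p1 - ?P p3) * (c * (?P p1 + ?P p3) + (d - a)) = 0"
    using r1 r3 fixed by (simp add: algebra_simps)
  then have 13: "c * (?P p1 + ?P p3) + (d - a) = 0" using p(6) by simp
  have "c * (?P p2 - ?P p3) = (c * (?P p1 + ?P p2) + (d - a)) - (c * (?P p1 + ?P p3) + (d - a))"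
    by (simp add: algebra_simps)
  also have "\<dots> = 0" unfolding 12 13 by simp
  finally have c: "c = 0" using p(5) by simp
  then have "a = d" using 12 by simp
  then show ?thesis using c r1 fixed by simp
qed

section \<open>The covering of the sphere\<close>

context generated_labels
begin

theorem closed_surface:
  assumes "finite (carrier A)"
  shows "\<exists>S :: complex charted_space. compact_riemann_surface S \<and> Aut S \<cong> A"
proof -
  define N where "N = ntypes"
  have N: "N \<ge> 4" "N > 0" using ntypes_ge_4 ntypes_pos by (simp_all add: N_def)
  have fl: "finite labels" using assms by (simp add: labels_def)
  define n where "n = card labels"
  \<comment> \<open>The number of slits of each type: one more than the bound in
    \<open>many_branch_points\<close>.\<close>
  define k where "k = n\<^sup>2 + n\<^sup>2 * n + n + 1"
  define K where "K = {..<N * k}"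
  have NK: "N * k \<ge> 4" using N mult_le_mono[of 4 N 1 k] by (simp add: k_def)
  have K012: "0 \<in> K" "1 \<in> K" "2 \<in> K" unfolding K_def lessThan_iff using NK by linarith+
  define \<theta> where "\<theta> = root 3 (2::real)"
  have \<theta>: "\<theta> ^ 3 = 2" by (simp add: \<theta>_def)
  have \<theta>12: "1 < \<theta>" "\<theta> < 2"
  proof -
    show "1 < \<theta>" by (simp add: \<theta>_def)
    have "root 3 2 < root 3 (2 ^ 3 :: real)" by (subst real_root_less_iff) auto
    then show "\<theta> < 2" by (simp add: \<theta>_def real_root_power_cancel del: power_numeral)
  qed
  define lo where "lo s = 2 * real s" for s :: nat
  \<comment> \<open>The right end of slit \<open>0\<close> is the only irrational end. Since
    \<open>\<theta>\<close> lies between 1 and 2, the slits remain disjoint.\<close>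
  define hi where "hi s = (if s = 0 then \<theta> else 2 * real s + 1)" for s :: nat
  have lohi: "lo s < hi s" and hi2: "hi s < 2 * real s + 2" for s using \<theta>12 by (auto simp: lo_def hi_def)
  have dis: "{lo s..hi s} \<inter> {lo t..hi t} = {}" if "s \<noteq> t" for s t
  proof (rule ccontr)
    assume "{lo s..hi s} \<inter> {lo t..hi t} \<noteq> {}"
    then obtain x where "x \<in> {lo s..hi s}" "x \<in> {lo t..hi t}" by blast
    then have "\<bar>real s - real t\<bar> < 1" using hi2[of s] hi2[of t] by (auto simp: lo_def)
    then show False using nat_eq_if_close that by blast
  qed
  have types: "\<exists>s\<in>K. s mod ntypes = j" if "j < ntypes" for j
  proof -
    have "j < N * k" using that mult_le_mono[of N N 1 k] by (simp add: N_def k_def)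
    then show ?thesis using that by (intro bexI[of _ j]) (auto simp: K_def)
  qed
  have closed_I: "closed (complex_of_real ` {lo s..hi s})" for s
    by (intro compact_imp_closed compact_continuous_image continuous_intros compact_Icc)
  define R where "R = 2 * real (N * k) + 2"
  have r: "complex_of_real (-1) \<in> UNIV - (\<Union>s\<in>K. of_real ` {lo s..hi s})"
  proof -
    have "complex_of_real (-1) \<notin> of_real ` {lo s..hi s}" for s
    proof
      assume "complex_of_real (-1) \<in> of_real ` {lo s..hi s}"
      then obtain x where "complex_of_real (-1) = of_real x" "x \<ge> lo s" by auto
      then have "lo s \<le> -1" by (simp only: of_real_eq_iff)
      then show False by (simp add: lo_def)
    qed
    then show ?thesis by blast
  qed
  obtain pt :: "'a \<times> nat \<Rightarrow> complex \<Rightarrow> complex" and infp where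
    sc: "slit_cover labels K (\<lambda>s. switch (s mod ntypes)) (mid lo hi) (rad lo hi) UNIV labels R pt infp"
  proof (rule slit_cover_real[of K lo hi UNIV labels R])
    show "open (UNIV - (\<Union>s\<in>K'. complex_of_real ` {lo s..hi s}))" if "K' \<subseteq> K" for K'
    proof -
      have "finite K'" using that finite_subset by (auto simp: K_def)
      then have "closed (\<Union>s\<in>K'. complex_of_real ` {lo s..hi s})" using closed_I by auto
      then show ?thesis by (simp add: open_Diff)
    qed
    show "connected (UNIV - (\<Union>s\<in>K. complex_of_real ` {lo s..hi s}))"
      by (rule connected_minus_real[OF open_UNIV convex_UNIV _ r]) auto
    show "UNIV - (\<Union>s\<in>K. complex_of_real ` {lo s..hi s}) \<noteq> {}" using r by blast
    show "R > 0" unfolding R_def by (intro add_nonneg_pos) simp_all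
    show "complex_of_real ` {lo s..hi s} \<subseteq> cball 0 R" if "s \<in> K" for s
    proof -
      have "real s \<le> real (N * k)" using that unfolding K_def of_nat_le_iff by simp
      then show ?thesis using hi2[of s] by (auto simp: R_def lo_def)
    qed
  qed (use lohi dis types in auto)
  interpret sc: slit_cover labels K "\<lambda>s. switch (s mod ntypes)" "mid lo hi" "rad lo hi" UNIV labels R pt infp
    by (rule sc)
  have many: "\<exists>Z. finite Z \<and> card Z > (card labels)\<^sup>2 + (card labels)\<^sup>2 * card labels + card labels \<and>
    (\<forall>b\<in>Z. \<exists>t\<in>K. switch (t mod ntypes) = switch (s mod ntypes) \<and>
      (b = mid lo hi t + rad lo hi t \<or> b = mid lo hi t - rad lo hi t))" for s
  proof -
    \<comment> \<open>The \<open>k\<close> slits in \<open>K\<close> with the type of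
      \<open>s\<close>; their lower ends alone are already enough distinct branch points.\<close>
    let ?t = "\<lambda>j. s mod N + j * N"
    let ?Z = "(\<lambda>j. complex_of_real (lo (?t j))) ` {..<k}"
    have "inj (\<lambda>j. complex_of_real (lo (?t j)))" using N(2) by (intro injI) (simp add: lo_def)
    then have "card ?Z = k" using card_image[OF inj_on_subset[OF _ subset_UNIV]] by fastforce
    moreover have "\<exists>t\<in>K. switch (t mod ntypes) = switch (s mod ntypes) \<and>
      (b = mid lo hi t + rad lo hi t \<or> b = mid lo hi t - rad lo hi t)" if bZ: "b \<in> ?Z" for b
    proof -
      obtain j where j: "j < k" "b = of_real (lo (?t j))" using bZ by blast
      have "?t j < N + j * N" using N(2) by simp
      also have "\<dots> = N * Suc j" by simp
      also have "\<dots> \<le> N * k" using j(1) by (intro mult_le_mono) auto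
      finally have "?t j \<in> K" by (simp add: K_def)
      moreover have "?t j mod ntypes = s mod ntypes" by (simp add: N_def)
      ultimately show ?thesis using j(2) by (intro bexI[of _ "?t j"]) (simp_all add: mid_rad)
    qed
    ultimately show ?thesis by (intro exI[of _ ?Z]) (auto simp: k_def n_def)
  qed
  interpret cc: closed_cover labels K "\<lambda>s. switch (s mod ntypes)" "mid lo hi" "rad lo hi" R pt infp
    by unfold_locales (use fl many in \<open>auto simp: K_def\<close>)
  have bs: "sc.branch_set = complex_of_real ` insert \<theta> (lo ` K \<union> hi ` (K - {0}))"
  proof -
    have "insert 0 (K - {0}) = K" using K012(1) by blast
    then have "hi ` K = insert (hi 0) (hi ` (K - {0}))" by (metis image_insert)
    moreover have "hi 0 = \<theta>" by (simp add: hi_def)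
    ultimately have "lo ` K \<union> hi ` K = insert \<theta> (lo ` K \<union> hi ` (K - {0}))" by simp
    moreover have "sc.branch_set = complex_of_real ` (lo ` K \<union> hi ` K)"
      unfolding sc.branch_set_def mid_rad by auto
    ultimately show ?thesis by (simp only:)
  qed
  interpret rc: rigid_closed_cover labels K "\<lambda>s. switch (s mod ntypes)" "mid lo hi" "rad lo hi" R pt infp
  proof unfold_locales
    show "K \<noteq> {}" using K012 by blast
    fix a b c d assume M: "a * d \<noteq> b * c"
      "\<And>z. z \<in> sc.branch_set \<Longrightarrow> c * z + d \<noteq> 0 \<and> (a * z + b) / (c * z + d) \<in> sc.branch_set"
    show "c = 0 \<and> b = 0 \<and> a = d"
    proof (rule mobius_rigid_set[OF \<theta> _ _ M(1) M(2)[unfolded bs]])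
      show "lo ` K \<union> hi ` (K - {0}) \<subseteq> \<rat>" by (auto simp: lo_def hi_def)
      have "0 \<in> lo ` K" by (rule image_eqI[of _ _ 0]) (simp_all add: lo_def K012)
      moreover have "2 \<in> lo ` K" by (rule image_eqI[of _ _ 1]) (simp add: lo_def, rule K012)
      moreover have "4 \<in> lo ` K" by (rule image_eqI[of _ _ 2]) (simp_all add: lo_def K012)
      moreover have "3 \<in> hi ` (K - {0})" by (rule image_eqI[of _ _ 1]) (use K012 in \<open>auto simp: hi_def\<close>)
      ultimately show "{0, 2, 3, 4} \<subseteq> lo ` K \<union> hi ` (K - {0})" by simp
    qed
  qed
  interpret lc: labelled_cover A xs K "mid lo hi" "rad lo hi" UNIV labels R pt infp
    by unfold_locales (rule types)
  have "Aut sc.surf \<cong> A" using rc.closed_rigid by (intro lc.Aut_labelled_iso) blast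
  moreover have "compact_riemann_surface sc.surf"
  proof -
    have "finite K" by (simp add: K_def)
    then show ?thesis
      unfolding compact_riemann_surface_def
      using sc.riemann_surface_cover sc.compact_T[OF order_refl fl] by simp
  qed
  ultimately show ?thesis by blast
qed

end

theorem theorem1:
  fixes A :: "('g, 'm) monoid_scheme"
  assumes "finitely_generated_group A"
  shows "(\<exists>\<S> :: complex charted_space. riemann_surface \<S> \<and> Aut \<S> \<cong> A) \<and>
         (finite (carrier A) \<longrightarrow>
           (\<exists>\<S> :: complex charted_space. compact_riemann_surface \<S> \<and> Aut \<S> \<cong> A))"
proof -
  obtain S where S: "group A" "finite S" "S \<subseteq> carrier A" "generate A S = carrier A"
    using assms by (auto simp: finitely_generated_group_def)
  obtain xs where "set xs = S" using finite_list[OF S(2)] by blast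
  then interpret generated_labels A xs
    using S by (intro generated_labels.intro generated_labels_axioms.intro) auto
  show ?thesis using open_surface closed_surface by blast
qed

end
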